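(* Let $\mu$ be a measure on the Borel subsets of $(0,\infty)$ with $\int_0^{\infty}\frac{\lambda}{\lambda^2 + 1} \,\mathrm{d}\mu(\lambda)< \infty$, let $\delta>0$, and let $\nu$ be the measure $\nu(E)=\mu(\delta E)$ on Borel $E\subseteq(0,\infty)$, where $\delta E=\{\delta x:x\in E\}$. For a measure $\rho$ satisfying the same integrability condition define $f_\rho(x)=\int_0^\infty\{e^{-\lambda|x|}-e^{-\lambda}\}\,\mathrm{d}\rho(\lambda)$ (possibly $\infty$ at $x=0$) and $K_\rho(z)=\lim_{N\to\infty}\left(\frac{\cos\pi z}{\pi}\right)\sum_{n=-N}^{N+1}\frac{(-1)^n f_\rho(n-\frac12)}{z-n+\frac12}$ (a real entire function, the limit being uniform on compact sets). For $\lambda>0$ let $K(\lambda, z) = \left(\frac{\cos \pi z}{\pi}\right)\sum_{n \in \mathbb{Z}} \frac{ (-1)^{n}\, e^{-\lambda|n- \frac{1}{2}|}}{z - n + \frac{1}{2}}$ and $\widehat{K}(\lambda,t)=\int_{-\infty}^\infty K(\lambda,x)e(-tx)\,\mathrm{d}x$. Then: (i) The real entire function $z\mapsto K_{\nu}(\delta z) + f_{\mu}(\delta^{-1})$ has exponential type at most $\pi\delta$. (ii) For real $x\neq 0$ the function $\lambda \mapsto e^{-\lambda |x|} - K(\delta^{-1}\lambda, \delta x)$ is integrable on $(0, \infty)$ with respect to $\mu$. (iii) For all real $x$, $f_{\mu}(x) - f_{\mu}(\delta^{-1})- K_{\nu}(\delta x) = \int_0^{\infty} \{e^{-\lambda |x|}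 - K(\delta^{-1}\lambda, \delta x)\}\,\mathrm{d}\mu(\lambda)$. (iv) The function $x\mapsto f_{\mu}(x) - f_{\mu}(\delta^{-1}) - K_{\nu}(\delta x)$ is integrable on $\mathbb{R}$ and $$\int_{-\infty}^{\infty} | f_{\mu}(x) - f_{\mu}(\delta^{-1})- K_{\nu}(\delta x)|\,\mathrm{d}x = \int_0^{\infty}\{\tfrac{2}{\lambda} - \tfrac{2}{\lambda}\,\mathrm{sech}(\tfrac{\lambda}{2\delta}) \}\,\mathrm{d}\mu(\lambda).$$ (v) If $t\neq 0$ then $$\int_{-\infty}^{\infty} \{f_{\mu}(x) - f_{\mu}(\delta^{-1}) - K_{\nu}(\delta x)\}e(-tx)\,\mathrm{d}x = \int_0^{\infty} \frac{2\lambda}{\lambda^2 + 4\pi^2 t^2}\,\mathrm{d}\mu(\lambda) - \delta^{-1} \int_0^{\infty} \widehat{K}(\delta^{-1}\lambda, \delta^{-1}t)\,\mathrm{d}\mu(\lambda).$$ (vi) If $\widetilde{K}(z)$ is an entire function of exponential type at most $\pi\delta$, then $$\int_{-\infty}^{\infty} |f_{\mu}(x) - \widetilde{K}(x)|\,\mathrm{d}x \geq \int_0^{\infty}\{\tfrac{2}{\lambda} - \tfrac{2}{\lambda}\,\mathrm{sech}(\tfrac{\lambda}{2\delta})\} \,\mathrm{d}\mu(\lambda).$$ (vii) Equality holds in (vi) if and only if $\widetilde{K}(z) = K_{\nu}(\delta z) + f_{\mu}(\delta^{-1})$.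
   Context: $e(z)=e^{2\pi i z}$. An entire function $K$ has exponential type at most $\sigma$ if for every $\epsilon>0$ there is $C_\epsilon$ with $|K(z)|\le C_\epsilon e^{(\sigma+\epsilon)|z|}$ for all $z$. The measure $\nu$ also satisfies $\int_0^\infty\frac{\lambda}{\lambda^2+1}\,\mathrm{d}\nu<\infty$. *)

theory Defs
  imports "HOL-Analysis.Analysis"
begin

definition ee :: "complex \<Rightarrow> complex" where
  "ee z = exp (2 * of_real pi * \<i> * z)"

definition exp_type_le :: "(complex \<Rightarrow> complex) \<Rightarrow> real \<Rightarrow> bool" where
  "exp_type_le K \<sigma> \<longleftrightarrow> K holomorphic_on UNIV \<and>
     (\<forall>\<epsilon>>0. \<exists>C. \<forall>z. norm (K z) \<le> C * exp ((\<sigma> + \<epsilon>) * norm z))"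

text \<open>Extended-real Lebesgue integral: positive part minus negative part
  (meaningful whenever at least one part is finite).\<close>
definition ext_int :: "real measure \<Rightarrow> (real \<Rightarrow> real) \<Rightarrow> ereal" where
  "ext_int M g = enn2ereal (\<integral>\<^sup>+ l. ennreal (g l) \<partial>M) - enn2ereal (\<integral>\<^sup>+ l. ennreal (- g l) \<partial>M)"

text \<open>f_rho(x) = int (e^{-lambda |x|} - e^{-lambda}) d rho(lambda), possibly +infinity at x = 0.\<close>
definition f_rho :: "real measure \<Rightarrow> real \<Rightarrow> ereal" where
  "f_rho \<rho> x = ext_int \<rho> (\<lambda>l. exp (- l * \<bar>x\<bar>) - exp (- l))"

text \<open>Real-valued version (used where f is finite, i.e. x \<noteq> 0, or under Lebesgue integrals).\<close>
definition fr :: "real measure \<Rightarrow> real \<Rightarrow> real" where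
  "fr \<rho> x = real_of_ereal (f_rho \<rho> x)"

text \<open>The entire function z \<mapsto> cos(pi z) / (pi (z - n + 1/2)), with its removable
  singularity at z = n - 1/2 filled in by its limit (-1)^n.\<close>
definition cq :: "int \<Rightarrow> complex \<Rightarrow> complex" where
  "cq n z = (if z = of_int n - 1/2 then (-1) powi n
             else cos (of_real pi * z) / (of_real pi * (z - of_int n + 1/2)))"

definition K_rho :: "real measure \<Rightarrow> complex \<Rightarrow> complex" where
  "K_rho \<rho> z = lim (\<lambda>N::nat. \<Sum>n\<in>{- int N..int N + 1}.
       (-1) powi n * of_real (fr \<rho> (of_int n - 1/2)) * cq n z)"

definition K_lam :: "real \<Rightarrow> complex \<Rightarrow> complex" where
  "K_lam lam z = infsum (\<lambda>n::int. (-1) powi n * of_real (exp (- lam * \<bar>of_int n - 1/2\<bar>)) * cq n z) UNIV"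

definition K_hat :: "real \<Rightarrow> real \<Rightarrow> complex" where
  "K_hat lam t = (LINT x|lborel. K_lam lam (of_real x) * ee (of_real (- t * x)))"

end

theory Submission
  imports Defs "HOL-Complex_Analysis.Complex_Analysis" "HOL-Real_Asymp.Real_Asymp"
begin

text \<open>
  For \<^term>\<open>Re z \<ge> 0\<close> the error \<open>exp (- \<lambda> z) - K(\<lambda>, z)\<close> equals \<open>cos (\<pi> z) / \<pi>\<close> times the Laplace transform of
  \<open>g \<bar>\<lambda> - w\<bar> - g (\<lambda> + w)\<close>, where \<open>g w = 1 / (2 cosh (w / 2))\<close>.  As \<open>g\<close> decreases on the positive axis, the
  error has the sign of \<open>cos (\<pi> x)\<close> on the real line for every \<open>\<lambda>\<close>, and the same formula bounds
  \<open>K(\<lambda>, z) - exp (- \<lambda>)\<close> by a multiple of \<open>\<lambda> / (\<lambda>\<^sup>2 + 1)\<close>, so that everything can be integrated over \<open>\<lambda>\<close>.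

  Extremality is duality: an integrable entire function \<open>G\<close> of exponential type at most \<open>\<pi>\<close> has a Fourier
  transform vanishing outside \<open>(- \<pi>, \<pi>)\<close>, and \<open>sgn (cos (\<pi> x))\<close> only contains odd multiples of the
  frequency \<open>\<pi>\<close>, hence \<open>G\<close> integrates to zero against it.  In the case of equality \<open>G\<close> vanishes at all zeros
  of \<open>cos (\<pi> z)\<close>; the quotient is then entire and bounded, and integrability forces \<open>G = 0\<close>.
\<close>

section \<open>Entire functions of exponential type\<close>

text \<open>Several obstacles shape the details. The dilation is confined to the measures:
  everything is proved for type \<open>pi\<close> and one measure, and \<nu> is the image of \<mu>
  under division by \<delta>; the constant f(1/\<delta>) appears because the subtracted
  exp(-\<lambda>) is rescaled as well. The measure may have infinite mass both near 0 and near
  infinity, so every integrand has to be O(\<lambda>) at 0 and O(1/\<lambda>) at infinity; this is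
  why exp(-\<lambda>) is carried along and all bounds are stated against \<lambda>/(\<lambda>^2+1).
  The sampling series converges only conditionally and its coefficients may grow; pairing the nodes
  k+1/2 and -(k+1/2) and splitting off cos(pi z) times the value at 0 leaves an absolutely
  convergent remainder and one scalar alternating series. Finally f may be infinite at 0, so
  identities on the line are used off a null set, and the equality case needs continuity of f away
  from 0 to pass from almost every point to the half-integers.\<close>

lemma mult_exp_minus_le_iff: "x * exp (- t) \<le> y \<longleftrightarrow> x \<le> y * exp (t::real)"
  by (simp add: exp_minus field_simps)

section \<open>Phragmen-Lindelof principles and growth of functions bounded on the real line\<close>

text \<open>The product is v^(3/2). The hypothesis says that |arg v| is at most pi/4, so the power
  has argument at most 3 pi/8 and its real part is at least cos(3 pi/8) |v|^(3/2); 1/8 is a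
  convenient smaller constant. In coordinates csqrt v = a + i b with 2|b| <= a, and the real part is
  a (a^2 - 3 b^2).\<close>

lemma Re_mult_csqrt_ge:
  fixes v :: complex
  assumes v: "\<bar>Im v\<bar> \<le> Re v"
  shows "Re (v * csqrt v) \<ge> norm v * sqrt (norm v) / 8"
proof -
  define a b where "a = Re (csqrt v)" and "b = Im (csqrt v)"
  have s: "csqrt v = Complex a b" unfolding a_def b_def by (rule complex.collapse[symmetric])
  have v_eq: "v = (Complex a b)^2" using power2_csqrt[of v] s by simp
  have a0: "a \<ge> 0" using csqrt_principal[of v] by (auto simp: a_def)
  have Rev: "Re v = a^2 - b^2" "Im v = 2 * a * b"
    by (auto simp: v_eq power2_eq_square complex_eq_iff)
  have ab: "2 * a * \<bar>b\<bar> \<le> a^2 - b^2"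
    using v a0 unfolding Rev by (simp add: abs_mult)
  have "2 * \<bar>b\<bar> \<le> a"
  proof (cases "a = 0")
    case True
    then show ?thesis using ab by simp
  next
    case False
    then have "a > 0" using a0 by simp
    have "a * (2 * \<bar>b\<bar>) \<le> a * a" using ab by (simp add: power2_eq_square algebra_simps) (smt (verit) zero_le_square)
    then show ?thesis using \<open>a > 0\<close> by simp
  qed
  then have "(2 * \<bar>b\<bar>)^2 \<le> a^2" by (intro power_mono) auto
  then have b2: "4 * b^2 \<le> a^2" by (simp add: power_mult_distrib)
  have n: "norm (Complex a b) \<le> 6/5 * a"
  proof -
    have "a^2 + b^2 \<le> (6/5 * a)^2" proof -
      have "25 * b^2 \<le> 11 * a^2" using b2 zero_le_power2[of a] by linarith
      then show ?thesis by (simp add: power_mult_distrib power_divide)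
    qed
    then show ?thesis unfolding cmod_def complex.sel by (rule real_le_lsqrt[rotated -1]) (use a0 in auto)
  qed
  have "norm v * sqrt (norm v) = norm (Complex a b)^3"
  proof -
    have nv: "norm v = norm (Complex a b)^2" by (simp only: v_eq norm_power)
    show ?thesis unfolding nv by (simp only: real_sqrt_abs abs_norm_cancel) (simp only: power3_eq_cube power2_eq_square)
  qed
  also have "\<dots> \<le> (6/5 * a)^3" by (intro power_mono n) auto
  also have "\<dots> \<le> 8 * (a * (a^2 - 3 * b^2))"
  proof -
    have "a * (1/4 * a^2) \<le> a * (a^2 - 3 * b^2)" using b2 a0 by (intro mult_left_mono) auto
    moreover have "(6/5 * a)^3 = 216/125 * (a * a^2)" by (simp add: power_mult_distrib power3_eq_cube power2_eq_square)
    moreover have "a * a^2 \<ge> 0" using a0 by simp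
    ultimately show ?thesis by simp
  qed
  also have "a * (a^2 - 3 * b^2) = Re (v * csqrt v)"
    unfolding s by (subst v_eq) (simp add: power2_eq_square algebra_simps)
  finally show ?thesis by simp
qed

text \<open>The frontier of the truncated set lies on the arc of radius \<open>R\<close> or outside
  \<open>T\<close>, because \<open>T\<close> is contained in the interior of \<open>S\<close>; the
  frontier of \<open>S\<close> itself never has to be computed. Applied to a sector and to a half
  plane.\<close>

lemma maximum_modulus_truncated:
  fixes f :: "complex \<Rightarrow> complex"
  assumes clS: "closed S" and T: "open T" "T \<subseteq> S" and hol: "f holomorphic_on S"
    and z: "z \<in> S" "norm z \<le> R"
    and boundary: "\<And>w. w \<in> S \<Longrightarrow> w \<notin> T \<Longrightarrow> norm (f w) \<le> B"
    and arc: "\<And>w. w \<in> S \<Longrightarrow> norm w = R \<Longrightarrow> norm (f w) \<le> B"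
  shows "norm (f z) \<le> B"
proof (rule maximum_modulus_frontier[where S = "S \<inter> cball 0 R" and f = f])
  have cl: "closed (S \<inter> cball 0 R)" using clS by (intro closed_Int closed_cball)
  show "f holomorphic_on interior (S \<inter> cball 0 R)"
    using hol by (rule holomorphic_on_subset) (use interior_subset in auto)
  show "continuous_on (closure (S \<inter> cball 0 R)) f"
    unfolding closure_closed[OF cl]
    by (intro holomorphic_on_imp_continuous_on holomorphic_on_subset[OF hol]) auto
  show "bounded (S \<inter> cball 0 R)" by auto
  show "z \<in> S \<inter> cball 0 R" using z by simp
  fix w assume "w \<in> frontier (S \<inter> cball 0 R)"
  then have w: "w \<in> S" "norm w \<le> R" "w \<notin> interior S \<or> w \<notin> ball 0 R"
    by (auto simp: frontier_def closure_closed[OF cl])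
  have "T \<subseteq> interior S" using T by (intro interior_maximal)
  then show "norm (f w) \<le> B" using w boundary[of w] arc[of w] by fastforce
qed

text \<open>The damping factor decays like \<open>exp (- \<eta> \<bar>w\<bar> powr (3/2))\<close> in the sector, which beats order one.\<close>

lemma phragmen_lindelof_sector:
  fixes F :: "complex \<Rightarrow> complex"
  assumes hol: "F holomorphic_on UNIV"
    and growth: "\<And>z. norm (F z) \<le> C * exp (c * norm z)"
    and bd: "\<And>z. Re z \<ge> 0 \<Longrightarrow> \<bar>Im z\<bar> = Re z \<Longrightarrow> norm (F z) \<le> M"
    and z: "\<bar>Im z\<bar> \<le> Re z"
  shows "norm (F z) \<le> M"
proof -
  define S where "S = {w::complex. \<bar>Im w\<bar> \<le> Re w}"
  have M0: "M \<ge> 0" using bd[of 0] by (smt (verit) norm_ge_zero zero_complex.sel)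
  have C0: "C \<ge> 0" using order_trans[OF norm_ge_zero growth[of 0]] by simp
  \<comment> \<open>A branch of (1+w)^(3/2). The exponent lies between the order 1 of the growth and
    the critical order 2 of a right angle; the shift by 1 keeps the argument off the branch cut, the
    vertex of the sector included.\<close>
  define q where "q = (\<lambda>w::complex. (1 + w) * csqrt (1 + w))"
  have q_ge: "Re (q w) \<ge> norm w * sqrt (norm w) / 8" if "w \<in> S" for w
  proof -
    have "norm w \<le> norm (1 + w)" using that unfolding S_def cmod_def
      by (auto intro!: real_sqrt_le_mono simp: power2_eq_square algebra_simps)
    then have "norm w * sqrt (norm w) \<le> norm (1 + w) * sqrt (norm (1 + w))"
      by (intro mult_mono) auto
    moreover have "Re (q w) \<ge> norm (1 + w) * sqrt (norm (1 + w)) / 8"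
      unfolding q_def using that by (intro Re_mult_csqrt_ge) (auto simp: S_def)
    ultimately show ?thesis by linarith
  qed
  \<comment> \<open>\<tau> leaves room for the remainder C exp(-R) on the arc, since
    \<open>M\<close> may be 0. At the end \<eta> and \<tau> tend to 0 together.\<close>
  have main: "norm (F z) \<le> (M + \<tau>) * exp (\<eta> * Re (q z))" if "\<eta> > 0" "\<tau> > 0" for \<eta> \<tau> :: real
  proof -
    define f where "f = (\<lambda>w. F w * exp (- of_real \<eta> * q w))"
    have nf: "norm (f w) = norm (F w) * exp (- \<eta> * Re (q w))" for w
      by (simp add: f_def norm_mult)
    have "((\<lambda>R. C * exp (- R)) \<longlongrightarrow> C * 0) at_top"
      by (intro tendsto_intros filterlim_compose[OF exp_at_bot] filterlim_uminus_at_bot_at_top)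
    then have "eventually (\<lambda>R. C * exp (- R) < \<tau>) at_top"
      using \<open>\<tau> > 0\<close> by (auto dest!: order_tendstoD)
    moreover have "eventually (\<lambda>R::real. R \<ge> (8 * (\<bar>c\<bar> + 1) / \<eta>)^2) at_top"
      "eventually (\<lambda>R::real. R \<ge> norm z) at_top" "eventually (\<lambda>R::real. R > 0) at_top"
      by (auto intro: eventually_ge_at_top eventually_gt_at_top)
    ultimately have "eventually (\<lambda>R. C * exp (- R) < \<tau> \<and> R \<ge> (8 * (\<bar>c\<bar> + 1) / \<eta>)^2 \<and> R \<ge> norm z \<and> R > 0) at_top"
      by eventually_elim auto
    then obtain R where R: "C * exp (- R) < \<tau>" "R \<ge> (8 * (\<bar>c\<bar> + 1) / \<eta>)^2" "R \<ge> norm z" "R > 0"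
      by (auto simp: eventually_at_top_linorder)
    \<comment> \<open>With this, \<eta> R^(3/2)/8 is at least (|c|+1) R, which exceeds the growth c
      R by at least R on the arc.\<close>
    have sR: "8 * (\<bar>c\<bar> + 1) / \<eta> \<le> sqrt R"
      using R(2) by (rule real_le_rsqrt)
    have clS: "closed S"
      unfolding S_def by (intro closed_Collect_le continuous_intros)
    have np: "1 + w \<notin> \<real>\<^sub>\<le>\<^sub>0" if "w \<in> S" for w
      using that by (auto simp: complex_nonpos_Reals_iff S_def)
    have holf: "f holomorphic_on S"
      unfolding f_def q_def using np
      by (intro holomorphic_intros holomorphic_on_subset[OF hol]) auto
    have "norm (f z) \<le> M + \<tau>"
    proof (rule maximum_modulus_truncated[OF clS _ _ holf])
      show "open {w. \<bar>Im w\<bar> < Re w}" by (intro open_Collect_less continuous_intros)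
      show "{w. \<bar>Im w\<bar> < Re w} \<subseteq> S" by (auto simp: S_def)
      show "z \<in> S" "norm z \<le> R" using z R by (auto simp: S_def)
      show "norm (f w) \<le> M + \<tau>" if wS: "w \<in> S" and "w \<notin> {w. \<bar>Im w\<bar> < Re w}" for w
      proof -
        have "\<bar>Im w\<bar> = Re w" using that unfolding S_def by simp
        then have "norm (F w) \<le> M" using wS by (intro bd) (auto simp: S_def)
        moreover have "exp (- \<eta> * Re (q w)) \<le> 1"
        proof -
          have "0 \<le> norm w * sqrt (norm w) / 8" by simp
          then have "0 \<le> Re (q w)" using q_ge[OF wS] by linarith
          then show ?thesis using \<open>\<eta> > 0\<close> by simp
        qed
        ultimately have "norm (f w) \<le> M * 1"
          unfolding nf using M0 by (intro mult_mono) auto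
        then show ?thesis using \<open>\<tau> > 0\<close> by simp
      qed
      show "norm (f w) \<le> M + \<tau>" if wS: "w \<in> S" and nw: "norm w = R" for w
      proof -
        have "\<eta> * (R * sqrt R / 8) \<le> \<eta> * Re (q w)" using q_ge[OF wS] \<open>\<eta> > 0\<close> by (simp add: nw)
        moreover have "R * (8 * (\<bar>c\<bar> + 1)) \<le> R * (\<eta> * sqrt R)"
          using sR R \<open>\<eta> > 0\<close> by (intro mult_left_mono) (auto simp: field_simps)
        moreover have "c * R \<le> \<bar>c\<bar> * R" using R by (intro mult_right_mono) auto
        moreover have "R * (8 * (\<bar>c\<bar> + 1)) = 8 * (\<bar>c\<bar> * R) + 8 * R" "\<eta> * (R * sqrt R / 8) = R * (\<eta> * sqrt R) / 8"
          by (auto simp: algebra_simps)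
        ultimately have e: "c * R - \<eta> * Re (q w) \<le> - R" by linarith
        have "norm (f w) \<le> C * exp (c * R) * exp (- \<eta> * Re (q w))"
          unfolding nf using growth[of w] nw by (intro mult_right_mono) auto
        also have "\<dots> = C * exp (c * R - \<eta> * Re (q w))" by (simp add: exp_diff exp_minus divide_inverse)
        also have "\<dots> \<le> C * exp (- R)" using C0 e by (intro mult_left_mono) auto
        finally show ?thesis using R M0 by simp
      qed
    qed
    then show ?thesis unfolding nf by (simp add: mult_exp_minus_le_iff)
  qed
  have lim: "((\<lambda>t. (M + t) * exp (t * Re (q z))) \<longlongrightarrow> (M + 0) * exp (0 * Re (q z))) (at_right 0)"
    by (intro tendsto_intros)
  show ?thesis
    using tendsto_lowerbound[OF lim, of "norm (F z)"] main
    by (simp add: eventually_at_right_less trivial_limit_at_right_real eventually_at_filter)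
qed

text \<open>An a priori bound \<open>B\<close>, however large, permits a damping factor of merely
  linear growth: in the upper half plane |1 - i \<eta> z| is at least 1 and at least \<eta> |z|. The
  point is that \<open>B\<close> disappears from the conclusion.\<close>

lemma phragmen_lindelof_bounded_half_plane:
  fixes Q :: "complex \<Rightarrow> complex"
  assumes hol: "Q holomorphic_on UNIV"
    and growth: "\<And>z. Im z \<ge> 0 \<Longrightarrow> norm (Q z) \<le> B"
    and bd: "\<And>x::real. norm (Q (of_real x)) \<le> M"
    and z: "Im z \<ge> 0"
  shows "norm (Q z) \<le> M"
proof -
  define S where "S = {w::complex. Im w \<ge> 0}"
  have M0: "M \<ge> 0" using order_trans[OF norm_ge_zero bd[of 0]] .
  have B0: "B \<ge> 0" using order_trans[OF norm_ge_zero growth[of 0]] by simp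
  have main: "norm (Q z) \<le> (M + \<eta>) * norm (1 - \<i> * of_real \<eta> * z)" if "\<eta> > 0" for \<eta> :: real
  proof -
    define f where "f = (\<lambda>w. Q w / (1 - \<i> * of_real \<eta> * w))"
    \<comment> \<open>Large enough for B/(\<eta> R) <= \<eta>, the slack granted on the arc.\<close>
    define R where "R = max (norm z) (B / \<eta>^2 + 1)"
    have R: "R > 0" "R \<ge> norm z" "B \<le> R * \<eta>^2"
    proof -
      have "0 < B / \<eta>^2 + 1" "(B / \<eta>^2) * \<eta>^2 = B" using B0 that by (auto intro: add_nonneg_pos)
      moreover have "B / \<eta>^2 \<le> R" "B / \<eta>^2 + 1 \<le> R" by (auto simp: R_def)
      then have "(B / \<eta>^2) * \<eta>^2 \<le> R * \<eta>^2" by (intro mult_right_mono) auto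
      ultimately show "R > 0" "B \<le> R * \<eta>^2" using \<open>B / \<eta>^2 + 1 \<le> R\<close> by auto
    qed (simp add: R_def)
    have d1: "norm (1 - \<i> * of_real \<eta> * w) \<ge> 1" if "w \<in> S" for w
    proof -
      have "1 \<le> Re (1 - \<i> * of_real \<eta> * w)" using that \<open>\<eta> > 0\<close> by (simp add: S_def)
      also have "\<dots> \<le> norm (1 - \<i> * of_real \<eta> * w)" by (rule complex_Re_le_cmod)
      finally show ?thesis .
    qed
    have d2: "norm (1 - \<i> * of_real \<eta> * w) \<ge> \<eta> * norm w" if "w \<in> S" for w
    proof -
      have "\<eta> * norm w = norm (\<i> * of_real \<eta> * w)" using \<open>\<eta> > 0\<close> by (simp add: norm_mult)
      also have "\<dots> \<le> norm (1 - \<i> * of_real \<eta> * w)"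
        unfolding cmod_def using that \<open>\<eta> > 0\<close>
        by (intro real_sqrt_le_mono) (auto simp: S_def power2_eq_square algebra_simps)
      finally show ?thesis .
    qed
    have clS: "closed S"
      unfolding S_def by (intro closed_Collect_le continuous_intros)
    have nz: "1 - \<i> * of_real \<eta> * w \<noteq> 0" if "w \<in> S" for w using d1[OF that] by auto
    have holf: "f holomorphic_on S"
      unfolding f_def using nz
      by (intro holomorphic_intros holomorphic_on_subset[OF hol]) auto
    have "norm (f z) \<le> M + \<eta>"
    proof (rule maximum_modulus_truncated[OF clS _ _ holf])
      show "open {w. Im w > 0}" by (intro open_Collect_less continuous_intros)
      show "{w. Im w > 0} \<subseteq> S" by (auto simp: S_def)
      show "z \<in> S" "norm z \<le> R" using z R by (auto simp: S_def)
      show "norm (f w) \<le> M + \<eta>" if wS: "w \<in> S" and "w \<notin> {w. Im w > 0}" for w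
      proof -
        have "Im w = 0" using that unfolding S_def by simp
        then have "w = of_real (Re w)" by (simp add: complex_eq_iff)
        then have "norm (Q w) \<le> M" using bd[of "Re w"] by simp
        then have "norm (f w) \<le> M / 1"
          unfolding f_def norm_divide using d1[OF wS] M0 by (intro frac_le) auto
        then show ?thesis using \<open>\<eta> > 0\<close> by simp
      qed
      show "norm (f w) \<le> M + \<eta>" if wS: "w \<in> S" and nw: "norm w = R" for w
      proof -
        have "norm (f w) \<le> B / (\<eta> * R)"
          unfolding f_def norm_divide using d2[OF wS] nw growth[of w] wS \<open>\<eta> > 0\<close> R B0
          by (intro frac_le) (auto simp: S_def)
        also have "\<dots> \<le> \<eta>" using R \<open>\<eta> > 0\<close> by (simp add: field_simps power2_eq_square)
        finally show ?thesis using M0 by simp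
      qed
    qed
    then show ?thesis unfolding f_def norm_divide using nz[of z] z by (simp add: S_def divide_simps)
  qed
  have lim: "((\<lambda>t. (M + t) * norm (1 - \<i> * of_real t * z)) \<longlongrightarrow> (M + 0) * norm (1 - \<i> * of_real 0 * z)) (at_right 0)"
    by (intro tendsto_intros)
  show ?thesis
    using tendsto_lowerbound[OF lim, of "norm (Q z)"] main
    by (simp add: eventually_at_right_less trivial_limit_at_right_real eventually_at_filter)
qed

text \<open>With s slightly above \<sigma>, the function P(z) exp(i s z) is bounded by
  \<open>M\<close> on the real axis and by the constant \<open>C\<close> of the growth estimate on
  the positive imaginary axis. The sector principle in both quadrants makes it bounded in the half
  plane, and the half plane principle then improves the bound to \<open>M\<close>, independently of
  \<open>C\<close>; so s may tend to \<sigma>.\<close>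

lemma exp_type_le_bounded_upper:
  fixes P :: "complex \<Rightarrow> complex"
  assumes P: "exp_type_le P \<sigma>" and bd: "\<And>x::real. norm (P (of_real x)) \<le> M" and z: "Im z \<ge> 0"
  shows "norm (P z) \<le> M * exp (\<sigma> * Im z)"
proof -
  have hol: "P holomorphic_on UNIV" using P by (simp add: exp_type_le_def)
  have "norm (P z) \<le> M * exp ((\<sigma> + \<epsilon>) * Im z)" if "\<epsilon> > 0" for \<epsilon>
  proof -
    obtain C where C: "\<And>z. norm (P z) \<le> C * exp ((\<sigma> + \<epsilon>) * norm z)"
      using P \<open>\<epsilon> > 0\<close> unfolding exp_type_le_def by blast
    have C0: "C \<ge> 0" using order_trans[OF norm_ge_zero C[of 0]] by simp
    define s where "s = \<sigma> + \<epsilon>"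
    define Q where "Q = (\<lambda>z. P z * exp (\<i> * of_real s * z))"
    have nQ: "norm (Q w) = norm (P w) * exp (- s * Im w)" for w
      by (simp add: Q_def norm_mult)
    have holQ: "Q holomorphic_on UNIV" unfolding Q_def by (intro holomorphic_intros hol)
    have gQ: "norm (Q w) \<le> C * exp (2 * \<bar>s\<bar> * norm w)" for w
    proof -
      have "- s * Im w \<le> \<bar>s\<bar> * norm w"
      proof -
        have "- s * Im w \<le> \<bar>s\<bar> * \<bar>Im w\<bar>" by (simp add: abs_mult[symmetric] abs_if)
        also have "\<dots> \<le> \<bar>s\<bar> * norm w" by (intro mult_left_mono abs_Im_le_cmod) auto
        finally show ?thesis .
      qed
      moreover have "s * norm w \<le> \<bar>s\<bar> * norm w" by (intro mult_right_mono) auto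
      ultimately have "s * norm w + - s * Im w \<le> 2 * \<bar>s\<bar> * norm w" by linarith
      then have "C * exp (s * norm w) * exp (- s * Im w) \<le> C * exp (2 * \<bar>s\<bar> * norm w)"
        using C0 by (simp add: exp_add[symmetric] mult.assoc mult_left_mono)
      moreover have "norm (Q w) \<le> C * exp (s * norm w) * exp (- s * Im w)"
        unfolding nQ using C[of w] by (intro mult_right_mono) (auto simp: s_def)
      ultimately show ?thesis by linarith
    qed
    have Qre: "norm (Q w) \<le> max M C" if "Im w = 0" for w
    proof -
      have "w = of_real (Re w)" using that by (simp add: complex_eq_iff)
      then show ?thesis using bd[of "Re w"] that by (simp add: nQ)
    qed
    have Qim: "norm (Q w) \<le> max M C" if "Re w = 0" "Im w \<ge> 0" for w
    proof -
      have "norm w = Im w" using that by (simp add: cmod_def)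
      then have "norm (Q w) \<le> C * exp (s * Im w) * exp (- s * Im w)"
        unfolding nQ using C[of w] by (intro mult_right_mono) (auto simp: s_def)
      also have "\<dots> = C" by (simp add: exp_minus)
      finally show ?thesis by simp
    qed
    \<comment> \<open>Multiplication by 1 + i or -1 + i turns the sector around the positive real
      axis into the first or the second quadrant.\<close>
    have quad: "norm (Q (a * w)) \<le> max M C" if a: "a = 1 + \<i> \<or> a = -1 + \<i>" and w: "\<bar>Im w\<bar> \<le> Re w" for a w
    proof (rule phragmen_lindelof_sector[OF _ _ _ w, where C = C and c = "2 * \<bar>s\<bar> * norm a"])
      show "(\<lambda>w. Q (a * w)) holomorphic_on UNIV"
        by (rule holomorphic_on_compose[OF _ holomorphic_on_subset[OF holQ], unfolded o_def]) (auto intro!: holomorphic_intros)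
      show "norm (Q (a * z)) \<le> C * exp (2 * \<bar>s\<bar> * norm a * norm z)" for z
        using gQ[of "a * z"] by (simp add: norm_mult mult.assoc)
      show "norm (Q (a * z)) \<le> max M C" if "Re z \<ge> 0" "\<bar>Im z\<bar> = Re z" for z
      proof -
        have "Im z = Re z \<or> Im z = - Re z" using that by auto
        then have "Im (a * z) = 0 \<or> Re (a * z) = 0 \<and> Im (a * z) \<ge> 0"
          using a that by auto
        then show ?thesis using Qre Qim by blast
      qed
    qed
    have up: "norm (Q w) \<le> max M C" if "Im w \<ge> 0" for w
    proof (cases "Re w \<ge> 0")
      case True
      have "(1 + \<i>) * (w / (1 + \<i>)) = w" by (simp add: complex_eq_iff)
      moreover have "w / (1 + \<i>) = Complex ((Re w + Im w)/2) ((Im w - Re w)/2)"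
        by (simp add: complex_eq_iff Re_divide Im_divide power2_eq_square)
      ultimately show ?thesis
        using quad[of "1 + \<i>" "w / (1 + \<i>)"] True that by auto
    next
      case False
      have "-1 + \<i> \<noteq> 0" by (simp add: complex_eq_iff)
      then have "(-1 + \<i>) * (w / (-1 + \<i>)) = w" by simp
      moreover have "w / (-1 + \<i>) = Complex ((Im w - Re w)/2) (- (Im w + Re w)/2)"
        by (simp add: complex_eq_iff Re_divide Im_divide power2_eq_square)
      ultimately show ?thesis
      proof -
        have "\<bar>Im (w / (-1 + \<i>))\<bar> \<le> Re (w / (-1 + \<i>))"
          unfolding \<open>w / (-1 + \<i>) = _\<close> complex.sel using False that by (auto simp: abs_le_iff field_simps)
        then show ?thesis using quad[of "-1 + \<i>" "w / (-1 + \<i>)"] \<open>(-1 + \<i>) * (w / (-1 + \<i>)) = w\<close> by metis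
      qed
    qed
    have "norm (Q z) \<le> M"
      by (rule phragmen_lindelof_bounded_half_plane[OF holQ up _ z]) (use bd nQ in auto)
    then show ?thesis unfolding nQ s_def mult_minus_left mult_exp_minus_le_iff .
  qed note main = this
  have lim: "((\<lambda>t. M * exp ((\<sigma> + t) * Im z)) \<longlongrightarrow> M * exp ((\<sigma> + 0) * Im z)) (at_right 0)"
    by (intro tendsto_intros)
  show ?thesis
    using tendsto_lowerbound[OF lim, of "norm (P z)"] main
    by (simp add: eventually_at_right_less trivial_limit_at_right_real eventually_at_filter)
qed

lemma exp_type_le_uminus:
  assumes "exp_type_le P \<sigma>" shows "exp_type_le (\<lambda>z. P (- z)) \<sigma>"
proof -
  have "(P \<circ> uminus) holomorphic_on UNIV"
    using assms by (intro holomorphic_on_compose holomorphic_on_minus holomorphic_on_ident)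
      (auto simp: exp_type_le_def intro: holomorphic_on_subset)
  moreover have "\<exists>C. \<forall>z. norm (P (- z)) \<le> C * exp ((\<sigma> + \<epsilon>) * norm z)" if "\<epsilon> > 0" for \<epsilon>
    using assms that unfolding exp_type_le_def by (metis norm_minus_cancel)
  ultimately show ?thesis by (simp add: exp_type_le_def o_def)
qed

lemma exp_type_le_bounded:
  assumes P: "exp_type_le P \<sigma>" and bd: "\<And>x::real. norm (P (of_real x)) \<le> M"
  shows "norm (P z) \<le> M * exp (\<sigma> * \<bar>Im z\<bar>)"
proof (cases "Im z \<ge> 0")
  case True
  then show ?thesis using exp_type_le_bounded_upper[OF P bd] by simp
next
  case False
  then show ?thesis
    using exp_type_le_bounded_upper[OF exp_type_le_uminus[OF P], of M "- z"] bd[of "- x" for x] by simp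
qed

section \<open>Fourier transforms of integrable functions of exponential type\<close>

lemma complex_primitive_diff_eq_integral:
  fixes G P :: "complex \<Rightarrow> complex"
  assumes P: "\<And>x. a \<le> x \<Longrightarrow> x \<le> b \<Longrightarrow> (P has_field_derivative G (of_real x)) (at (of_real x))"
    and cont: "continuous_on {a..b} (\<lambda>x. G (of_real x))" and ab: "a \<le> b"
  shows "(LINT x|lborel. indicator {a..b} x *\<^sub>R G (of_real x)) = P (of_real b) - P (of_real a)"
proof -
  have "((\<lambda>x. P (of_real x)) has_vector_derivative G (of_real x)) (at x within {a..b})" if "a \<le> x" "x \<le> b" for x
    using has_vector_derivative_real_field[OF P[OF that]] by (rule has_vector_derivative_at_within)
  from integral_FTC_atLeastAtMost[OF ab this cont] show ?thesis by simp
qed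

lemma entire_continuous_on_real:
  fixes G :: "complex \<Rightarrow> complex"
  assumes "G holomorphic_on UNIV"
  shows "continuous_on A (\<lambda>x::real. G (of_real x))"
  by (rule continuous_on_compose2[OF holomorphic_on_imp_continuous_on[OF assms] continuous_on_of_real[OF continuous_on_id]]) simp

lemma integrable_mult_bounded:
  fixes f h :: "'a \<Rightarrow> complex"
  assumes "integrable M f" "h \<in> borel_measurable M" "\<And>x. norm (h x) \<le> B"
  shows "integrable M (\<lambda>x. f x * h x)"
proof (rule Bochner_Integration.integrable_bound[of M "\<lambda>x. B * norm (f x)"])
  show "integrable M (\<lambda>x. B * norm (f x))" using assms by auto
  show "(\<lambda>x. f x * h x) \<in> borel_measurable M" using assms by auto
  have "norm (f x * h x) \<le> norm (B * norm (f x))" for x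
  proof -
    have "norm (f x) * norm (h x) \<le> norm (f x) * B" using assms(3) by (intro mult_left_mono) auto
    then show ?thesis using order_trans[OF norm_ge_zero assms(3)[of x]] by (simp add: norm_mult mult.commute)
  qed
  then show "AE x in M. norm (f x * h x) \<le> norm (B * norm (f x))" by simp
qed

text \<open>Integrability gives no direct pointwise bound for \<open>G\<close>, but the primitive
  vanishing at 0 is bounded on the real line by the L1 norm and has the same type. Its bound extends
  to the plane by Phragmen-Lindelof, and Cauchy's inequality on unit discs returns a bound for
  \<open>G\<close>, at the cost of a factor exp \<sigma>.\<close>

lemma exp_type_le_integrable_bounded:
  fixes G :: "complex \<Rightarrow> complex"
  assumes G: "exp_type_le G \<sigma>" and int: "integrable lborel (\<lambda>x::real. G (of_real x))"
    and s0: "\<sigma> \<ge> 0"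
  obtains M where "\<And>z. norm (G z) \<le> M * exp (\<sigma> * \<bar>Im z\<bar>)"
proof -
  have hol: "G holomorphic_on UNIV" using G by (simp add: exp_type_le_def)
  obtain P where P: "\<And>z. (P has_field_derivative G z) (at z)"
    using holomorphic_convex_primitive'[OF convex_UNIV open_UNIV hol] by auto
  define Q where "Q = (\<lambda>z. P z - P 0)"
  define I where "I = (LINT x|lborel. norm (G (of_real x)))"
  have cont: "continuous_on A (\<lambda>x::real. G (of_real x))" for A
    by (rule entire_continuous_on_real[OF hol])
  have PI: "norm (P (of_real b) - P (of_real a)) \<le> I" if "a \<le> b" for a b :: real
  proof -
    have "norm (P (of_real b) - P (of_real a)) = norm (LINT x|lborel. indicator {a..b} x *\<^sub>R G (of_real x))"
      using complex_primitive_diff_eq_integral[OF P cont that] by simp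
    also have "\<dots> \<le> (LINT x|lborel. norm (indicator {a..b} x *\<^sub>R G (of_real x)))"
      by (rule integral_norm_bound)
    also have "\<dots> \<le> I" unfolding I_def
      by (intro integral_mono integrable_norm integrable_mult_indicator int) (auto simp: indicator_def)
    finally show ?thesis .
  qed
  have Qreal: "norm (Q (of_real x)) \<le> I" for x :: real
    using PI[of 0 x] PI[of x 0] by (cases "x \<ge> 0") (auto simp: Q_def norm_minus_commute)
  have "exp_type_le Q \<sigma>"
    unfolding exp_type_le_def
  proof (intro conjI allI impI)
    show "Q holomorphic_on UNIV"
      unfolding Q_def using P by (intro holomorphic_intros) (auto simp: holomorphic_on_def field_differentiable_def)
    fix \<epsilon> :: real assume "\<epsilon> > 0"
    \<comment> \<open>Half of \<epsilon> is kept in reserve for the factor |z| that integration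
      along a segment from 0 produces.\<close>
    then obtain C where C: "\<And>z. norm (G z) \<le> C * exp ((\<sigma> + \<epsilon>/2) * norm z)"
      using G unfolding exp_type_le_def by (metis half_gt_zero)
    have C0: "C \<ge> 0" using order_trans[OF norm_ge_zero C[of 0]] by simp
    have "norm (Q z) \<le> C * (2 / \<epsilon>) * exp ((\<sigma> + \<epsilon>) * norm z)" for z
    proof -
      have "norm (P z - P 0) \<le> C * exp ((\<sigma> + \<epsilon>/2) * norm z) * norm (z - 0)"
      proof (rule field_differentiable_bound[of "cball 0 (norm z)" P G])
        show "(P has_field_derivative G w) (at w within cball 0 (norm z))" for w
          using P by (rule has_field_derivative_at_within)
        fix w :: complex assume "w \<in> cball 0 (norm z)"
        then have "C * exp ((\<sigma> + \<epsilon>/2) * norm w) \<le> C * exp ((\<sigma> + \<epsilon>/2) * norm z)"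
          using C0 s0 \<open>\<epsilon> > 0\<close> by (intro mult_left_mono) auto
        with C[of w] show "norm (G w) \<le> C * exp ((\<sigma> + \<epsilon>/2) * norm z)" by linarith
      qed auto
      also have "norm (z - 0) \<le> 2 / \<epsilon> * exp (\<epsilon>/2 * norm z)"
      proof -
        have "\<epsilon>/2 * norm z \<le> exp (\<epsilon>/2 * norm z)" using exp_ge_add_one_self[of "\<epsilon>/2 * norm z"] by linarith
        then show ?thesis using \<open>\<epsilon> > 0\<close> by (simp add: field_simps)
      qed
      finally have "norm (P z - P 0) \<le> C * exp ((\<sigma> + \<epsilon>/2) * norm z) * (2 / \<epsilon> * exp (\<epsilon>/2 * norm z))"
        using C0 by (simp add: mult_left_mono)
      also have "\<dots> = C * (2 / \<epsilon>) * exp ((\<sigma> + \<epsilon>) * norm z)"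
      proof -
        have "exp ((\<sigma> + \<epsilon>) * norm z) = exp ((\<sigma> + \<epsilon>/2) * norm z) * exp (\<epsilon>/2 * norm z)"
          by (simp add: exp_add[symmetric] algebra_simps)
        then show ?thesis by (simp only: mult_ac)
      qed
      finally show ?thesis by (simp add: Q_def)
    qed
    then show "\<exists>C. \<forall>z. norm (Q z) \<le> C * exp ((\<sigma> + \<epsilon>) * norm z)" by blast
  qed
  then have Qb: "norm (Q z) \<le> I * exp (\<sigma> * \<bar>Im z\<bar>)" for z
    using Qreal by (rule exp_type_le_bounded)
  have I0: "I \<ge> 0" using order_trans[OF norm_ge_zero Qreal[of 0]] .
  have "norm (G z) \<le> (I * exp \<sigma>) * exp (\<sigma> * \<bar>Im z\<bar>)" for z
  proof -
    have dQ: "(Q has_field_derivative G w) (at w)" for w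
      unfolding Q_def by (auto intro!: derivative_eq_intros P)
    have "norm ((deriv ^^ 1) Q z) \<le> fact 1 * (I * exp (\<sigma> * (\<bar>Im z\<bar> + 1))) / 1 ^ 1"
    proof (rule Cauchy_inequality)
      show "Q holomorphic_on ball z 1" using dQ by (auto simp: holomorphic_on_def field_differentiable_def intro: has_field_derivative_at_within)
      show "continuous_on (cball z 1) Q" using dQ by (meson DERIV_continuous continuous_at_imp_continuous_on)
      fix w assume "norm (z - w) = 1"
      then have "\<bar>Im z - Im w\<bar> \<le> 1" using abs_Im_le_cmod[of "z - w"] by simp
      then have "\<bar>Im w\<bar> \<le> \<bar>Im z\<bar> + 1" by linarith
      then have "I * exp (\<sigma> * \<bar>Im w\<bar>) \<le> I * exp (\<sigma> * (\<bar>Im z\<bar> + 1))"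
        using s0 I0 mult_left_mono[of "\<bar>Im w\<bar>" "\<bar>Im z\<bar> + 1" \<sigma>] by (intro mult_left_mono) auto
      then show "norm (Q w) \<le> I * exp (\<sigma> * (\<bar>Im z\<bar> + 1))" using Qb[of w] by linarith
    qed simp
    moreover have "deriv Q z = G z" using dQ by (rule DERIV_imp_deriv)
    ultimately show ?thesis by (simp add: exp_add algebra_simps)
  qed
  then show ?thesis by (rule that)
qed

text \<open>The contour is the rectangle with corners \<open>\<plusminus> n\<^sup>2\<close> and \<open>\<plusminus> n\<^sup>2 + \<i> n\<close>; the factor \<open>1 / (1 - \<i> \<eta> z)\<close>, whose pole lies
  in the lower half plane, makes the vertical sides negligible.\<close>

lemma exp_type_le_fourier_damped_zero:
  fixes G :: "complex \<Rightarrow> complex"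
  assumes G: "exp_type_le G \<sigma>" and int: "integrable lborel (\<lambda>x::real. G (of_real x))"
    and s0: "\<sigma> \<ge> 0" and a: "a > \<sigma>" and \<eta>: "\<eta> > 0"
  shows "(LINT x|lborel. G (of_real x) * (exp (\<i> * of_real (a * x)) / (1 - \<i> * of_real (\<eta> * x)))) = 0"
proof -
  have hol: "G holomorphic_on UNIV" using G by (simp add: exp_type_le_def)
  obtain M where M: "\<And>z. norm (G z) \<le> M * exp (\<sigma> * \<bar>Im z\<bar>)"
    using exp_type_le_integrable_bounded[OF G int s0] by blast
  have M0: "M \<ge> 0" using order_trans[OF norm_ge_zero M[of 0]] by simp
  define F where "F = (\<lambda>z. G z * (exp (\<i> * of_real a * z) / (1 - \<i> * of_real \<eta> * z)))"
  \<comment> \<open>A convex region that contains the closed upper half plane and avoids the pole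
    -i/\<eta>. On it \<open>F\<close> has a primitive, so contour integrals become differences of
    values of \<open>P\<close>.\<close>
  define S where "S = {z. Im z > - 1 / \<eta>}"
  have Sc: "convex S" "open S" unfolding S_def
    by (auto intro!: open_Collect_less continuous_intros simp: convex_halfspace_Im_gt)
  have nz: "1 - \<i> * of_real \<eta> * z \<noteq> 0" if "z \<in> S" for z
  proof -
    have "Re (1 - \<i> * of_real \<eta> * z) > 0" using that \<eta> by (simp add: S_def field_simps)
    then show ?thesis by force
  qed
  have holF: "F holomorphic_on S" unfolding F_def using nz
    by (intro holomorphic_intros holomorphic_on_subset[OF hol]) auto
  obtain P where P: "\<And>z. z \<in> S \<Longrightarrow> (P has_field_derivative F z) (at z)"
    using holomorphic_convex_primitive'[OF Sc holF] at_within_open[OF _ Sc(2)] by metis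
  have upS: "z \<in> S" if "Im z \<ge> 0" for z
  proof -
    have "- 1 / \<eta> < 0" using \<eta> by simp
    then have "- 1 / \<eta> < Im z" using that by linarith
    then show ?thesis unfolding S_def by (rule CollectI)
  qed
  have realF: "F (of_real x) = G (of_real x) * (exp (\<i> * of_real (a * x)) / (1 - \<i> * of_real (\<eta> * x)))" for x :: real
    by (simp add: F_def mult.assoc)
  have d1: "norm (1 - \<i> * of_real \<eta> * w) \<ge> 1" if "Im w \<ge> 0" for w
  proof -
    have "1 \<le> Re (1 - \<i> * of_real \<eta> * w)" using that \<eta> by simp
    also have "\<dots> \<le> norm (1 - \<i> * of_real \<eta> * w)" by (rule complex_Re_le_cmod)
    finally show ?thesis .
  qed
  have d2: "norm (1 - \<i> * of_real \<eta> * w) \<ge> \<eta> * \<bar>Re w\<bar>" for w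
    using abs_Im_le_cmod[of "1 - \<i> * of_real \<eta> * w"] \<eta> by (simp add: abs_mult)
  have nF: "norm (F z) = norm (G z) * exp (- (a * Im z)) / norm (1 - \<i> * of_real \<eta> * z)" for z
    by (simp add: F_def norm_mult norm_divide)
  have Fb: "norm (F z) \<le> M * exp (- ((a - \<sigma>) * Im z)) / norm (1 - \<i> * of_real \<eta> * z)" if "Im z \<ge> 0" for z
  proof -
    have "norm (G z) * exp (- (a * Im z)) \<le> M * exp (\<sigma> * \<bar>Im z\<bar>) * exp (- (a * Im z))"
      using M by (intro mult_right_mono) auto
    also have "\<dots> = M * exp (- ((a - \<sigma>) * Im z))" using that by (simp add: exp_add[symmetric] algebra_simps)
    finally show ?thesis unfolding nF by (intro divide_right_mono) auto
  qed
  have seg: "norm (P u - P v) \<le> B * norm (u - v)"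
    if "Im u \<ge> 0" "Im v \<ge> 0" "\<And>w. w \<in> closed_segment u v \<Longrightarrow> norm (F w) \<le> B" for u v B
  proof (rule field_differentiable_bound[of "closed_segment u v" P F])
    fix w assume w: "w \<in> closed_segment u v"
    have "closed_segment u v \<subseteq> {z. Im z \<ge> 0}"
      by (rule closed_segment_subset) (use that convex_halfspace_Im_ge in auto)
    then have "w \<in> S" using w upS by auto
    then show "(P has_field_derivative F w) (at w within closed_segment u v)"
      by (rule has_field_derivative_at_within[OF P])
  qed (use that in auto)
  \<comment> \<open>Each vertical side has length n and a real part of modulus n^2, which gives
    M/(\<eta> n); the top side has length 2 n^2 and height n.\<close>
  define e where "e = (\<lambda>n::nat. 2 * M / (\<eta> * real n) + M * exp (- ((a - \<sigma>) * real n)) * (2 * real n ^ 2))"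
  have Pb: "norm (P (of_real (real n ^ 2)) - P (of_real (- (real n ^ 2)))) \<le> e n" if n: "n > 0" for n
  proof -
    define R Y where "R = real n ^ 2" and "Y = real n"
    have R: "R > 0" "Y > 0" "R = Y^2" using n by (auto simp: R_def Y_def)
    have side: "norm (P (Complex x 0) - P (Complex x Y)) \<le> M / (\<eta> * Y)" if x: "\<bar>x\<bar> = R" for x
    proof -
      have "norm (P (Complex x 0) - P (Complex x Y)) \<le> M / (\<eta> * R) * norm (Complex x 0 - Complex x Y)"
      proof (rule seg)
        fix w assume "w \<in> closed_segment (Complex x 0) (Complex x Y)"
        then obtain u where u: "w = (1 - u) *\<^sub>R Complex x 0 + u *\<^sub>R Complex x Y" "0 \<le> u" "u \<le> 1"
          by (auto simp: in_segment)
        have "Re w = (1 - u) * x + u * x" "Im w = u * Y" by (auto simp: u(1))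
        then have w: "Re w = x" "Im w \<ge> 0" using R u(2,3) by (auto simp: algebra_simps)
        have "norm (F w) \<le> M * exp (- ((a - \<sigma>) * Im w)) / norm (1 - \<i> * of_real \<eta> * w)" by (rule Fb) fact
        also have "\<dots> \<le> M / (\<eta> * R)"
        proof (rule frac_le)
          show "\<eta> * R \<le> norm (1 - \<i> * of_real \<eta> * w)" using d2[of w] w x by simp
          have "M * exp (- ((a - \<sigma>) * Im w)) \<le> M * 1" using M0 a w by (intro mult_left_mono) auto
          then show "M * exp (- ((a - \<sigma>) * Im w)) \<le> M" by simp
        qed (use M0 \<eta> R in auto)
        finally show "norm (F w) \<le> M / (\<eta> * R)" .
      qed (use R in auto)
      also have "norm (Complex x 0 - Complex x Y) = Y" using R by (simp add: complex_diff cmod_def)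
      also have "M / (\<eta> * R) * Y = M / (\<eta> * Y)" using R \<eta> by (simp add: power2_eq_square field_simps)
      finally show ?thesis .
    qed
    have top: "norm (P (Complex R Y) - P (Complex (-R) Y)) \<le> M * exp (- ((a - \<sigma>) * Y)) * (2 * R)"
    proof -
      have "norm (P (Complex R Y) - P (Complex (-R) Y)) \<le> M * exp (- ((a - \<sigma>) * Y)) * norm (Complex R Y - Complex (-R) Y)"
      proof (rule seg)
        fix w assume "w \<in> closed_segment (Complex R Y) (Complex (-R) Y)"
        then obtain u where u: "w = (1 - u) *\<^sub>R Complex R Y + u *\<^sub>R Complex (-R) Y"
          by (auto simp: in_segment)
        have "Im w = (1 - u) * Y + u * Y" by (auto simp: u)
        then have w: "Im w = Y" by (simp add: algebra_simps)
        then have "Im w \<ge> 0" using R by simp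
        have "norm (F w) \<le> M * exp (- ((a - \<sigma>) * Im w)) / norm (1 - \<i> * of_real \<eta> * w)" by (rule Fb) fact
        also have "\<dots> \<le> M * exp (- ((a - \<sigma>) * Y)) / 1"
          using d1[OF \<open>Im w \<ge> 0\<close>] M0 w by (intro frac_le) auto
        finally show "norm (F w) \<le> M * exp (- ((a - \<sigma>) * Y))" by simp
      qed (use R in auto)
      also have "norm (Complex R Y - Complex (-R) Y) = 2 * R"
      proof -
        have "Complex R Y - Complex (-R) Y = of_real (2 * R)" by (simp add: complex_eq_iff)
        then show ?thesis using R(1) by (metis abs_of_pos norm_of_real zero_less_mult_iff zero_less_numeral)
      qed
      finally show ?thesis .
    qed
    have "norm (P (Complex R 0) - P (Complex (-R) 0)) \<le>
      norm (P (Complex R 0) - P (Complex R Y)) + norm (P (Complex R Y) - P (Complex (-R) Y)) + norm (P (Complex (-R) 0) - P (Complex (-R) Y))"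
      using norm_triangle_ineq[of "P (Complex R 0) - P (Complex R Y)" "P (Complex R Y) - P (Complex (-R) Y)"]
        norm_triangle_ineq4[of "P (Complex R 0) - P (Complex (-R) Y)" "P (Complex (-R) 0) - P (Complex (-R) Y)"]
      by simp
    also have "\<dots> \<le> M / (\<eta> * Y) + M * exp (- ((a - \<sigma>) * Y)) * (2 * R) + M / (\<eta> * Y)"
      using side[of R] side[of "-R"] top R by (intro add_mono) auto
    finally have "norm (P (Complex R 0) - P (Complex (-R) 0)) \<le> e n"
      by (simp add: e_def R_def Y_def)
    moreover have "complex_of_real R = Complex R 0" "complex_of_real (-R) = Complex (-R) 0" by (simp_all add: complex_eq_iff)
    ultimately show ?thesis unfolding R_def[symmetric] by metis
  qed
  define J where "J = (\<lambda>n::nat. LINT x|lborel. indicator {-(real n ^ 2)..real n ^ 2} x *\<^sub>R F (of_real x))"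
  have contF: "continuous_on A (\<lambda>x::real. F (of_real x))" for A
    by (rule continuous_on_compose2[OF holomorphic_on_imp_continuous_on[OF holF] continuous_on_of_real[OF continuous_on_id]])
      (auto simp: upS)
  have JP: "J n = P (of_real (real n ^ 2)) - P (of_real (- (real n ^ 2)))" for n
    unfolding J_def by (intro complex_primitive_diff_eq_integral P contF upS) auto
  have e0: "e \<longlonglongrightarrow> 0"
  proof -
    have "a - \<sigma> > 0" using a by simp
    then show ?thesis unfolding e_def using \<eta> by real_asymp
  qed
  have "J \<longlonglongrightarrow> 0"
    by (rule Lim_null_comparison[OF _ e0])
      (use Pb in \<open>auto simp: JP eventually_sequentially intro!: exI[of _ 1]\<close>)
  moreover have "J \<longlonglongrightarrow> (LINT x|lborel. F (of_real x))"
    unfolding J_def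
  proof (rule integral_dominated_convergence[where w = "\<lambda>x. norm (G (of_real x))"])
    show "integrable lborel (\<lambda>x::real. norm (G (of_real x)))" using int by simp
    have [measurable]: "(\<lambda>x::real. F (of_real x)) \<in> borel_measurable borel"
      using contF by (intro borel_measurable_continuous_onI)
    show "(\<lambda>x. F (complex_of_real x)) \<in> borel_measurable lborel" by measurable
    show "(\<lambda>x. indicator {- ((real n)\<^sup>2)..(real n)\<^sup>2} x *\<^sub>R F (complex_of_real x)) \<in> borel_measurable lborel" for n by measurable
    show "AE x in lborel. norm (indicator {- ((real n)\<^sup>2)..(real n)\<^sup>2} x *\<^sub>R F (complex_of_real x)) \<le> norm (G (of_real x))" for n
    proof (rule AE_I2)
      fix x :: real
      have "norm (F (of_real x)) \<le> norm (G (of_real x)) / 1"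
        unfolding nF using d1[of "of_real x"] by (intro frac_le) auto
      then show "norm (indicator {- ((real n)\<^sup>2)..(real n)\<^sup>2} x *\<^sub>R F (complex_of_real x)) \<le> norm (G (of_real x))"
        by (auto simp: indicator_def)
    qed
    show "AE x in lborel. (\<lambda>n. indicator {- ((real n)\<^sup>2)..(real n)\<^sup>2} x *\<^sub>R F (complex_of_real x)) \<longlonglongrightarrow> F (complex_of_real x)"
    proof (rule AE_I2, rule tendsto_eventually)
      fix x :: real
      have "filterlim (\<lambda>n. real n ^ 2) at_top sequentially" by real_asymp
      then have "eventually (\<lambda>n. real n ^ 2 \<ge> \<bar>x\<bar>) sequentially" by (simp add: filterlim_at_top)
      then show "\<forall>\<^sub>F n in sequentially. indicator {- ((real n)\<^sup>2)..(real n)\<^sup>2} x *\<^sub>R F (complex_of_real x) = F (complex_of_real x)"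
        by eventually_elim (auto simp: indicator_def)
    qed
  qed
  ultimately have "(LINT x|lborel. F (of_real x)) = 0" by (rule LIMSEQ_unique[symmetric])
  then show ?thesis by (simp add: realF)
qed

text \<open>The damping factor has modulus at most 1 on the real line, so \<eta> = 1/(n+1) can be
  sent to 0 by dominated convergence with dominating function |G|.\<close>

lemma exp_type_le_fourier_zero_gt:
  fixes G :: "complex \<Rightarrow> complex"
  assumes G: "exp_type_le G \<sigma>" and int: "integrable lborel (\<lambda>x::real. G (of_real x))"
    and s0: "\<sigma> \<ge> 0" and a: "a > \<sigma>"
  shows "(LINT x|lborel. G (of_real x) * exp (\<i> * of_real (a * x))) = 0"
proof -
  have [measurable]: "(\<lambda>x::real. G (of_real x)) \<in> borel_measurable borel"
    using G by (intro borel_measurable_continuous_onI entire_continuous_on_real) (simp add: exp_type_le_def)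
  define f where "f = (\<lambda>\<eta> x. G (of_real x) * (exp (\<i> * of_real (a * x)) / (1 - \<i> * of_real (\<eta> * x))))"
  have nz: "norm (1 - \<i> * of_real t) \<ge> 1" for t :: real
    using complex_Re_le_cmod[of "1 - \<i> * of_real t"] by simp
  have "(\<lambda>n. LINT x|lborel. f (1 / Suc n) x) \<longlonglongrightarrow> (LINT x|lborel. f 0 x)"
  proof (rule integral_dominated_convergence[where w = "\<lambda>x. norm (G (of_real x))"])
    show "integrable lborel (\<lambda>x::real. norm (G (of_real x)))" using int by simp
    show "f 0 \<in> borel_measurable lborel" "f (1 / Suc n) \<in> borel_measurable lborel" for n
      unfolding f_def by measurable
    show "AE x in lborel. norm (f (1 / Suc n) x) \<le> norm (G (of_real x))" for n
    proof (rule AE_I2)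
      fix x :: real
      have "norm (f (1 / Suc n) x) = norm (G (of_real x)) / norm (1 - \<i> * of_real (1 / Suc n * x))"
        unfolding f_def norm_mult norm_divide by simp
      also have "\<dots> \<le> norm (G (of_real x)) / 1" using nz[of "1 / Suc n * x"] by (intro frac_le) (auto simp del: of_real_mult of_real_divide of_nat_Suc)
      finally show "norm (f (1 / Suc n) x) \<le> norm (G (of_real x))" by simp
    qed
    show "AE x in lborel. (\<lambda>n. f (1 / Suc n) x) \<longlonglongrightarrow> f 0 x"
    proof (rule AE_I2)
      fix x :: real
      have "(\<lambda>n. 1 / real (Suc n)) \<longlonglongrightarrow> 0" by real_asymp
      then show "(\<lambda>n. f (1 / Suc n) x) \<longlonglongrightarrow> f 0 x" unfolding f_def by (intro tendsto_intros) auto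
    qed
  qed
  moreover have "(LINT x|lborel. f (1 / Suc n) x) = 0" for n
    unfolding f_def by (rule exp_type_le_fourier_damped_zero[OF G int s0 a]) simp
  ultimately have "(LINT x|lborel. f 0 x) = 0" by (simp add: LIMSEQ_const_iff)
  then show ?thesis by (simp add: f_def)
qed

text \<open>Negative frequencies follow by reflection, and the endpoint |a| = \<sigma> by continuity
  of the Fourier transform along a (1 + 1/(n+1)). The endpoint matters: sgn(cos(\<sigma> x))
  contains the frequencies \<plusminus>\<sigma> themselves.\<close>

lemma exp_type_le_fourier_zero:
  fixes G :: "complex \<Rightarrow> complex"
  assumes G: "exp_type_le G \<sigma>" and int: "integrable lborel (\<lambda>x::real. G (of_real x))"
    and s0: "\<sigma> > 0" and a: "\<bar>a\<bar> \<ge> \<sigma>"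
  shows "(LINT x|lborel. G (of_real x) * exp (\<i> * of_real (a * x))) = 0"
proof -
  have gt: "(LINT x|lborel. G (of_real x) * exp (\<i> * of_real (b * x))) = 0" if b: "\<bar>b\<bar> > \<sigma>" for b
  proof (cases "b > 0")
    case True
    then show ?thesis using exp_type_le_fourier_zero_gt[OF G int] s0 b by simp
  next
    case False
    have "integrable lborel (\<lambda>x::real. G (- of_real x))"
      using lborel_integrable_real_affine[OF int, of "-1" 0] by simp
    then have "(LINT x|lborel. G (- of_real x) * exp (\<i> * of_real (- b * x))) = 0"
      using exp_type_le_fourier_zero_gt[OF exp_type_le_uminus[OF G], of "- b"] s0 b False by simp
    then show ?thesis
      using lborel_integral_real_affine[of "-1" "\<lambda>x. G (of_real x) * exp (\<i> * of_real (b * x))" 0] by simp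
  qed
  have [measurable]: "(\<lambda>x::real. G (of_real x)) \<in> borel_measurable borel"
    using G by (intro borel_measurable_continuous_onI entire_continuous_on_real) (simp add: exp_type_le_def)
  define f where "f = (\<lambda>\<eta> x. G (of_real x) * exp (\<i> * of_real (a * (1 + \<eta>) * x)))"
  have "(\<lambda>n. LINT x|lborel. f (1 / Suc n) x) \<longlonglongrightarrow> (LINT x|lborel. f 0 x)"
  proof (rule integral_dominated_convergence[where w = "\<lambda>x. norm (G (of_real x))"])
    show "integrable lborel (\<lambda>x::real. norm (G (of_real x)))" using int by simp
    show "f 0 \<in> borel_measurable lborel" "f (1 / Suc n) \<in> borel_measurable lborel" for n
      unfolding f_def by measurable
    show "AE x in lborel. norm (f (1 / Suc n) x) \<le> norm (G (of_real x))" for n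
      unfolding f_def norm_mult by simp
    show "AE x in lborel. (\<lambda>n. f (1 / Suc n) x) \<longlonglongrightarrow> f 0 x"
    proof (rule AE_I2)
      fix x :: real
      have "(\<lambda>n. 1 / real (Suc n)) \<longlonglongrightarrow> 0" by real_asymp
      then show "(\<lambda>n. f (1 / Suc n) x) \<longlonglongrightarrow> f 0 x" unfolding f_def by (intro tendsto_intros) auto
    qed
  qed
  moreover have "(LINT x|lborel. f (1 / Suc n) x) = 0" for n
    unfolding f_def
  proof (rule gt)
    have "\<bar>a\<bar> * 1 < \<bar>a\<bar> * (1 + 1 / real (Suc n))" using a s0 by (intro mult_strict_left_mono) auto
    then show "\<sigma> < \<bar>a * (1 + 1 / real (Suc n))\<bar>" using a by (simp add: abs_mult)
  qed
  ultimately have "(LINT x|lborel. f 0 x) = 0" by (simp add: LIMSEQ_const_iff)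
  then show ?thesis by (simp add: f_def)
qed

section \<open>Orthogonality to the sign of the cosine\<close>

text \<open>By the binomial theorem the power is a combination of exponentials of frequency \<sigma>
  (2j - n). For odd n the integer 2j - n is odd, hence nonzero, so no frequency lies inside
  (-\<sigma>, \<sigma>).\<close>

lemma exp_type_le_cos_power_zero:
  fixes G :: "complex \<Rightarrow> complex"
  assumes G: "exp_type_le G \<sigma>" and int: "integrable lborel (\<lambda>x::real. G (of_real x))"
    and s0: "\<sigma> > 0" and n: "odd n"
  shows "(LINT x|lborel. G (of_real x) * of_real (cos (\<sigma> * x) ^ n)) = 0"
proof -
  define e where "e = (\<lambda>j x. exp (\<i> * of_real (\<sigma> * (2 * real j - real n) * x)))"
  have "of_real (cos (\<sigma> * x) ^ n) = (\<Sum>j\<le>n. of_nat (n choose j) / 2 ^ n * e j x)" for x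
  proof -
    have "complex_of_real (cos (\<sigma> * x)) = (exp (\<i> * of_real (\<sigma> * x)) + exp (- (\<i> * of_real (\<sigma> * x)))) / 2"
      by (simp add: cos_of_real[symmetric] cos_exp_eq)
    then have "of_real (cos (\<sigma> * x) ^ n) = (exp (\<i> * of_real (\<sigma> * x)) + exp (- (\<i> * of_real (\<sigma> * x)))) ^ n / 2 ^ n"
      by (simp only: of_real_power power_divide)
    also have "\<dots> = (\<Sum>j\<le>n. of_nat (n choose j) * exp (\<i> * of_real (\<sigma> * x)) ^ j * exp (- (\<i> * of_real (\<sigma> * x))) ^ (n - j)) / 2 ^ n"
      by (simp add: binomial_ring)
    also have "\<dots> = (\<Sum>j\<le>n. of_nat (n choose j) / 2 ^ n * e j x)"
      unfolding sum_divide_distrib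
    proof (rule sum.cong)
      fix j assume "j \<in> {..n}"
      then have "exp (\<i> * of_real (\<sigma> * x)) ^ j * exp (- (\<i> * of_real (\<sigma> * x))) ^ (n - j) = e j x"
        by (simp add: exp_of_nat_mult[symmetric] exp_add[symmetric] e_def of_nat_diff algebra_simps)
      then show "of_nat (n choose j) * exp (\<i> * of_real (\<sigma> * x)) ^ j * exp (- (\<i> * of_real (\<sigma> * x))) ^ (n - j) / 2 ^ n
        = of_nat (n choose j) / 2 ^ n * e j x" by (simp add: mult.assoc)
    qed simp
    finally show ?thesis .
  qed
  then have "(LINT x|lborel. G (of_real x) * of_real (cos (\<sigma> * x) ^ n))
    = (LINT x|lborel. (\<Sum>j\<le>n. of_nat (n choose j) / 2 ^ n * (G (of_real x) * e j x)))"
    by (simp add: sum_distrib_left mult_ac)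
  also have "\<dots> = (\<Sum>j\<le>n. LINT x|lborel. of_nat (n choose j) / 2 ^ n * (G (of_real x) * e j x))"
    unfolding e_def
    by (intro Bochner_Integration.integral_sum integrable_mult_right integrable_mult_bounded[where B = 1] int) auto
  also have "\<dots> = (\<Sum>j\<le>n. 0)"
  proof (rule sum.cong)
    fix j assume "j \<in> {..n}"
    have "(LINT x|lborel. G (of_real x) * e j x) = 0"
      unfolding e_def
    proof (rule exp_type_le_fourier_zero[OF G int s0])
      have "2 * int j - int n \<noteq> 0" using n by presburger
      then have "\<bar>2 * int j - int n\<bar> \<ge> 1" by linarith
      then have "\<bar>2 * real j - real n\<bar> \<ge> 1" by linarith
      then have "\<sigma> * 1 \<le> \<sigma> * \<bar>2 * real j - real n\<bar>" using s0 by (intro mult_left_mono) auto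
      then show "\<sigma> \<le> \<bar>\<sigma> * (2 * real j - real n)\<bar>" using s0 by (simp add: abs_mult)
    qed
    then show "(LINT x|lborel. of_nat (n choose j) / 2 ^ n * (G (of_real x) * e j x)) = 0" by simp
  qed simp
  finally show ?thesis by simp
qed

text \<open>The sign function is a bounded pointwise limit of odd polynomials on the range of the cosine.\<close>

lemma exp_type_le_sgn_cos_zero:
  fixes G :: "complex \<Rightarrow> complex"
  assumes G: "exp_type_le G \<sigma>" and int: "integrable lborel (\<lambda>x::real. G (of_real x))"
    and s0: "\<sigma> > 0"
  shows "(LINT x|lborel. G (of_real x) * of_real (sgn (cos (\<sigma> * x)))) = 0"
proof -
  have Gm [measurable]: "(\<lambda>x::real. G (of_real x)) \<in> borel_measurable borel"
    using G by (intro borel_measurable_continuous_onI entire_continuous_on_real) (simp add: exp_type_le_def)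
  \<comment> \<open>Continuous, odd, bounded by 1 and convergent to sgn at every point, including
    the value 0 at 0. A continuous intermediate function is required because sgn itself is not a
    uniform limit of polynomials.\<close>
  define \<phi> where "\<phi> = (\<lambda>k c::real. c / (1 / Suc k + \<bar>c\<bar>))"
  have pos: "1 / real (Suc k) + \<bar>c\<bar> > 0" for k and c :: real by (simp add: add_pos_nonneg)
  have \<phi>_odd: "\<phi> k (- c) = - \<phi> k c" for k c by (simp add: \<phi>_def)
  have \<phi>_le: "\<bar>\<phi> k c\<bar> \<le> 1" for k c
    using pos[of k c] by (simp add: \<phi>_def abs_divide divide_le_eq)
  have "\<exists>p. real_polynomial_function p \<and> (\<forall>c\<in>{-1..1}. \<bar>\<phi> k c - p c\<bar> < 1 / Suc k)" for k
  proof -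
    have "continuous_on {-1..1} (\<phi> k)" unfolding \<phi>_def
      using pos[of k] by (intro continuous_intros) (metis less_irrefl)
    from Stone_Weierstrass_real_polynomial_function[OF compact_Icc this, of "1 / Suc k"]
    show ?thesis by (metis of_nat_0_less_iff zero_less_Suc zero_less_divide_1_iff)
  qed
  then obtain p where p: "\<And>k. real_polynomial_function (p k)" "\<And>k c. c \<in> {-1..1} \<Longrightarrow> \<bar>\<phi> k c - p k c\<bar> < 1 / Suc k"
    by metis
  \<comment> \<open>The odd part of the approximating polynomial approximates the odd function
    \<open>\<phi> k\<close> equally well and contains only odd powers of the cosine.\<close>
  define q where "q = (\<lambda>k c. (p k c - p k (- c)) / 2)"
  have q: "\<bar>\<phi> k c - q k c\<bar> \<le> 1 / Suc k" if "c \<in> {-1..1}" for k c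
  proof -
    have "\<bar>\<phi> k c - p k c\<bar> < 1 / Suc k" "\<bar>\<phi> k (- c) - p k (- c)\<bar> < 1 / Suc k"
      using p(2)[of c k] p(2)[of "- c" k] that by auto
    moreover have "\<bar>a - (b - d) / 2\<bar> \<le> e" if "\<bar>a - b\<bar> < e" "\<bar>- a - d\<bar> < e" for a b d e :: real
      using that unfolding abs_less_iff abs_le_iff by (simp add: field_simps)
    ultimately show ?thesis unfolding q_def \<phi>_odd by blast
  qed
  have cosin: "cos x \<in> {-1..1}" for x :: real by simp
  have q_le: "\<bar>q k (cos x)\<bar> \<le> 2" for k x
  proof -
    have "1 / real (Suc k) \<le> 1" by simp
    then show ?thesis using q[OF cosin[of x], of k] \<phi>_le[of k "cos x"] by linarith
  qed
  have pc: "continuous_on UNIV (p k)" for k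
    using p(1)[of k] by (intro continuous_on_polymonial_function) (simp add: real_polynomial_function_eq)
  have pmc: "continuous_on UNIV (\<lambda>c. p k (- c))" for k
    by (rule continuous_on_compose2[OF pc continuous_on_minus[OF continuous_on_id]]) simp
  have "continuous_on UNIV (q k)" for k
    unfolding q_def by (intro continuous_on_divide continuous_on_diff pc pmc continuous_on_const) simp
  then have [measurable]: "q k \<in> borel_measurable borel" for k by (rule borel_measurable_continuous_onI)
  have zero: "(LINT x|lborel. G (of_real x) * of_real (q k (cos (\<sigma> * x)))) = 0" for k
  proof -
    obtain a n where an: "p k = (\<lambda>x. \<Sum>i\<le>n. a i * x ^ i)"
      using p(1)[of k] real_polynomial_function_iff_sum by blast
    have "q k c = (\<Sum>i\<le>n. (if odd i then a i else 0) * c ^ i)" for c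
    proof -
      have "q k c = (\<Sum>i\<le>n. (a i * c ^ i - a i * (- c) ^ i) / 2)"
        by (simp only: q_def an sum_subtractf sum_divide_distrib[symmetric])
      also have "\<dots> = (\<Sum>i\<le>n. (if odd i then a i else 0) * c ^ i)"
        by (intro sum.cong) auto
      finally show ?thesis .
    qed
    then have "(LINT x|lborel. G (of_real x) * of_real (q k (cos (\<sigma> * x)))) =
       (LINT x|lborel. (\<Sum>i\<le>n. of_real (if odd i then a i else 0) * (G (of_real x) * of_real (cos (\<sigma> * x) ^ i))))"
      by (simp add: sum_distrib_left mult_ac)
    also have "\<dots> = (\<Sum>i\<le>n. LINT x|lborel. of_real (if odd i then a i else 0) * (G (of_real x) * of_real (cos (\<sigma> * x) ^ i)))"
      by (intro Bochner_Integration.integral_sum integrable_mult_right integrable_mult_bounded[where B = 1] int)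
        (auto simp: norm_power power_le_one)
    also have "\<dots> = (\<Sum>i\<le>n. 0)"
      using exp_type_le_cos_power_zero[OF G int s0] by (intro sum.cong) auto
    finally show ?thesis by simp
  qed
  have "(\<lambda>k. LINT x|lborel. G (of_real x) * of_real (q k (cos (\<sigma> * x)))) \<longlonglongrightarrow>
    (LINT x|lborel. G (of_real x) * of_real (sgn (cos (\<sigma> * x))))"
  proof (rule integral_dominated_convergence[where w = "\<lambda>x. 2 * norm (G (of_real x))"])
    show "integrable lborel (\<lambda>x::real. 2 * norm (G (of_real x)))" using int by simp
    show "AE x in lborel. norm (G (of_real x) * of_real (q k (cos (\<sigma> * x)))) \<le> 2 * norm (G (of_real x))" for k
    proof (rule AE_I2)
      fix x :: real
      have "norm (G (of_real x)) * \<bar>q k (cos (\<sigma> * x))\<bar> \<le> norm (G (of_real x)) * 2"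
        using q_le by (intro mult_left_mono) auto
      then show "norm (G (of_real x) * of_real (q k (cos (\<sigma> * x)))) \<le> 2 * norm (G (of_real x))"
        by (simp add: norm_mult mult.commute)
    qed
    show "AE x in lborel. (\<lambda>k. G (of_real x) * of_real (q k (cos (\<sigma> * x)))) \<longlonglongrightarrow> G (of_real x) * of_real (sgn (cos (\<sigma> * x)))"
    proof (rule AE_I2, intro tendsto_intros)
      fix x :: real
      define c where "c = cos (\<sigma> * x)"
      have i0: "(\<lambda>k. 1 / real (Suc k)) \<longlonglongrightarrow> 0" by real_asymp
      have "(\<lambda>k. \<phi> k c) \<longlonglongrightarrow> sgn c"
      proof (cases "c = 0")
        case False
        then have "(\<lambda>k. \<phi> k c) \<longlonglongrightarrow> c / (0 + \<bar>c\<bar>)"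
          unfolding \<phi>_def by (intro tendsto_intros i0) auto
        then show ?thesis using False by (simp add: sgn_if abs_if split: if_splits)
      qed (simp add: \<phi>_def)
      moreover have "(\<lambda>k. \<phi> k c - q k c) \<longlonglongrightarrow> 0"
        by (rule Lim_null_comparison[OF _ i0]) (use q cosin in \<open>auto simp: c_def\<close>)
      ultimately have "(\<lambda>k. \<phi> k c - (\<phi> k c - q k c)) \<longlonglongrightarrow> sgn c - 0" by (intro tendsto_diff)
      then show "(\<lambda>k. q k (cos (\<sigma> * x))) \<longlonglongrightarrow> sgn (cos (\<sigma> * x))" by (simp add: c_def)
    qed
  qed simp_all
  then show ?thesis by (simp add: zero LIMSEQ_const_iff)
qed

section \<open>Functions of type \<open>pi\<close> vanishing at the half-integers\<close>

text \<open>All zeros of \<open>C\<close> are simple and cancelled by zeros of \<open>G\<close>. The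
  value inserted there is the limit given by l'Hopital's rule, so the singularity is
  removable.\<close>

lemma entire_quotient:
  fixes G C :: "complex \<Rightarrow> complex"
  assumes G: "G holomorphic_on UNIV" and C: "C holomorphic_on UNIV"
    and zeros: "\<And>z. C z = 0 \<Longrightarrow> G z = 0 \<and> deriv C z \<noteq> 0"
  shows "(\<lambda>z. if C z = 0 then deriv G z / deriv C z else G z / C z) holomorphic_on UNIV"
    (is "?H holomorphic_on UNIV")
proof -
  have "?H field_differentiable (at z)" for z
  proof (cases "C z = 0")
    case False
    have "continuous_on UNIV C" using C by (rule holomorphic_on_imp_continuous_on)
    then have op: "open {w. C w \<noteq> 0}" by (intro open_Collect_neq continuous_intros)
    have "(\<lambda>z. G z / C z) holomorphic_on {w. C w \<noteq> 0}"
      by (intro holomorphic_intros holomorphic_on_subset[OF G] holomorphic_on_subset[OF C]) auto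
    then have "?H holomorphic_on {w. C w \<noteq> 0}"
      by (rule holomorphic_transform) auto
    then show ?thesis using op False by (auto intro: holomorphic_on_imp_differentiable_at)
  next
    case True
    have dC: "(C has_field_derivative deriv C z) (at z)" and dG: "(G has_field_derivative deriv G z) (at z)"
      using C G by (auto intro: holomorphic_derivI[of _ UNIV])
    have nz: "deriv C z \<noteq> 0" and Gz: "G z = 0" using zeros[OF True] by auto
    have "((\<lambda>w. (C w - C z) / (w - z)) \<longlongrightarrow> deriv C z) (at z)"
      using dC by (simp add: has_field_derivative_iff)
    then have "eventually (\<lambda>w. (C w - C z) / (w - z) \<noteq> 0) (at z)"
      using nz by (rule tendsto_imp_eventually_ne)
    then have ev: "eventually (\<lambda>w. C w \<noteq> 0) (at z)"
      by eventually_elim (use True in auto)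
    then obtain r where r: "r > 0" "\<And>w. w \<noteq> z \<Longrightarrow> dist w z < r \<Longrightarrow> C w \<noteq> 0"
      by (auto simp: eventually_at)
    have "?H holomorphic_on ball z r"
    proof (rule no_isolated_singularity'[where K = "{z}"])
      have "((\<lambda>w. G w / C w) \<longlongrightarrow> deriv G z / deriv C z) (at z)"
        by (rule lhopital_complex_simple[OF dG dC Gz True nz refl])
      moreover have "eventually (\<lambda>w. G w / C w = ?H w) (at z)"
        using ev by eventually_elim auto
      ultimately have "(?H \<longlongrightarrow> deriv G z / deriv C z) (at z)"
        by (rule Lim_transform_eventually)
      then have "(?H \<longlongrightarrow> ?H z) (at z)" using True by simp
      then show "(?H \<longlongrightarrow> ?H w) (at w within ball z r)" if "w \<in> {z}" for w
        using that by (auto intro: Lim_at_imp_Lim_at_within)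
      have "(\<lambda>z. G z / C z) holomorphic_on (ball z r - {z})"
        using r by (intro holomorphic_intros holomorphic_on_subset[OF G] holomorphic_on_subset[OF C]) (auto simp: dist_commute)
      then show "?H holomorphic_on (ball z r - {z})"
        by (rule holomorphic_transform) (use r in \<open>auto simp: dist_commute\<close>)
    qed auto
    then show ?thesis using r by (auto intro: holomorphic_on_imp_differentiable_at)
  qed
  then show ?thesis by (auto simp: holomorphic_on_def intro: field_differentiable_at_within)
qed

text \<open>|cos(pi z)|^2 = cos(pi x)^2 + sinh(pi y)^2. On vertical lines through integers the first
  summand is 1 and the sum is cosh(pi y)^2; for |y| >= 1 the hyperbolic sine alone suffices.
  Together these sets contain the boundary of every square with integer half-side at least
  1.\<close>

lemma norm_cos_pi_ge:
  assumes "\<bar>Re z\<bar> = real n \<or> \<bar>Im z\<bar> \<ge> 1"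
  shows "norm (cos (of_real pi * z)) \<ge> exp (pi * \<bar>Im z\<bar>) / 4"
proof -
  define y where "y = pi * \<bar>Im z\<bar>"
  have sq: "norm (cos (of_real pi * z)) ^ 2 = cos (pi * Re z) ^ 2 + (exp y - exp (- y)) ^ 2 / 4"
    by (cases "Im z \<ge> 0") (simp_all add: norm_cos_squared y_def exp_minus power2_commute)
  have "(exp y / 4) ^ 2 \<le> norm (cos (of_real pi * z)) ^ 2"
  proof (cases "\<bar>Im z\<bar> \<ge> 1")
    case True
    then have "pi * 1 \<le> y" unfolding y_def by (intro mult_left_mono) auto
    then have y1: "y \<ge> 1" using pi_gt3 by linarith
    have "exp (- y) \<le> 1" "exp y \<ge> 2" using y1 exp_ge_add_one_self[of y] by (auto simp del: exp_ge_add_one_self) 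
    then have "exp y / 2 \<le> exp y - exp (- y)" by linarith
    then have "(exp y / 2) ^ 2 \<le> (exp y - exp (- y)) ^ 2" by (intro power_mono) auto
    then have "(exp y / 4) ^ 2 \<le> (exp y - exp (- y)) ^ 2 / 4" by (simp add: power_divide)
    then show ?thesis unfolding sq by (simp add: add_increasing)
  next
    case False
    then have "\<bar>Re z\<bar> = real n" using assms by simp
    moreover have "cos (pi * \<bar>Re z\<bar>) = cos (pi * Re z)" by (cases "Re z \<ge> 0") auto
    ultimately have "cos (pi * Re z) = cos (real n * pi)" by (simp add: mult.commute)
    then have "cos (pi * Re z) ^ 2 = 1" by (simp add: cos_npi power_mult[symmetric] mult.commute[of n])
    then have "norm (cos (of_real pi * z)) ^ 2 = (exp y + exp (- y)) ^ 2 / 4"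
    proof -
      have "exp y * exp (- y) = 1" by (simp add: exp_minus)
      then have "(exp y + exp (- y)) ^ 2 = (exp y - exp (- y)) ^ 2 + 4"
        by (simp add: power2_sum power2_diff)
      then show ?thesis unfolding sq \<open>cos (pi * Re z) ^ 2 = 1\<close> by simp
    qed
    moreover have "(exp y / 2) ^ 2 \<le> ((exp y + exp (- y))) ^ 2" by (intro power_mono) (auto simp: add_increasing)
    ultimately show ?thesis by (simp add: power_divide)
  qed
  then show ?thesis unfolding y_def by (rule power2_le_imp_le) simp
qed

text \<open>The cosine is at least 1/2 on [-1/3, 1/3]. The lemma serves a proof by contradiction, in
  which duality would force this integral to be 0.\<close>

lemma integral_abs_cos_pos:
  assumes int: "integrable lborel (\<lambda>x. \<bar>cos (pi * x)\<bar>)"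
  shows "(LINT x|lborel. \<bar>cos (pi * x)\<bar>) > 0"
proof -
  have "(LINT x|lborel. indicator {-1/3..1/3::real} x * (1/2)) \<le> (LINT x|lborel. \<bar>cos (pi * x)\<bar>)"
  proof (intro integral_mono int)
    fix x :: real
    show "indicator {-1/3..1/3} x * (1/2) \<le> \<bar>cos (pi * x)\<bar>"
    proof (cases "x \<in> {-1/3..1/3}")
      case True
      then have x: "\<bar>x\<bar> \<le> 1/3" by auto
      have "cos (pi * \<bar>x\<bar>) \<ge> cos (pi / 3)"
        using x mult_left_mono[of "\<bar>x\<bar>" "1/3" pi] by (intro cos_monotone_0_pi_le) auto
      moreover have "cos (pi * \<bar>x\<bar>) = cos (pi * x)" by (cases "x \<ge> 0") auto
      ultimately show ?thesis using True by (simp add: cos_60)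
    qed simp
  qed simp
  moreover have "(LINT x|lborel. indicator {-1/3..1/3::real} x * (1/2 :: real)) = 1/3"
    by simp
  ultimately show ?thesis by linarith
qed

text \<open>\<open>G\<close> is at most M exp(pi |Im z|) and the cosine at least a quarter of that
  exponential on boundaries of large squares, so the quotient is bounded by 4 M there and, by the
  maximum principle, everywhere. Liouville leaves G = c cos(pi z).\<close>

lemma exp_type_le_pi_eq_0:
  fixes G :: "complex \<Rightarrow> complex"
  assumes G: "exp_type_le G pi" and int: "integrable lborel (\<lambda>x::real. G (of_real x))"
    and zeros: "\<And>k::int. G (of_int k + 1/2) = 0"
  shows "G z = 0"
proof -
  have hol: "G holomorphic_on UNIV" using G by (simp add: exp_type_le_def)
  obtain M where M: "\<And>z. norm (G z) \<le> M * exp (pi * \<bar>Im z\<bar>)"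
    using exp_type_le_integrable_bounded[OF G int] by auto
  have M0: "M \<ge> 0" using order_trans[OF norm_ge_zero M[of 0]] by simp
  define C where "C = (\<lambda>z::complex. cos (of_real pi * z))"
  define H where "H = (\<lambda>z. if C z = 0 then deriv G z / deriv C z else G z / C z)"
  have holC: "C holomorphic_on UNIV" unfolding C_def by (intro holomorphic_intros)
  have C0: "G z = 0 \<and> deriv C z \<noteq> 0" if z0: "C z = 0" for z
  proof
    have "(C has_field_derivative - sin (of_real pi * z) * of_real pi) (at z)"
      unfolding C_def by (auto intro!: derivative_eq_intros)
    then have "deriv C z = - sin (of_real pi * z) * of_real pi" by (rule DERIV_imp_deriv)
    moreover have "sin (of_real pi * z) \<noteq> 0"
      using that sin_cos_squared_add[of "of_real pi * z"] by (auto simp: C_def)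
    ultimately show "deriv C z \<noteq> 0" by simp
    obtain n :: int where "of_real pi * z = of_real (of_int n * pi) + of_real pi / 2"
      using z0 unfolding C_def cos_eq_0 by blast
    then have "of_real pi * z = of_real pi * (of_int n + 1/2)" by (simp add: algebra_simps)
    then have "z = of_int n + 1/2" by (subst (asm) mult_cancel_left) auto
    then show "G z = 0" using zeros by simp
  qed
  have holH: "H holomorphic_on UNIV"
    unfolding H_def by (rule entire_quotient[OF hol holC C0])
  have GH: "G z = H z * C z" for z using C0 by (auto simp: H_def)
  have Hb: "norm (H z) \<le> 4 * M" if "\<bar>Re z\<bar> = real n \<or> \<bar>Im z\<bar> \<ge> 1" for z n
  proof -
    have c: "norm (C z) \<ge> exp (pi * \<bar>Im z\<bar>) / 4" unfolding C_def by (rule norm_cos_pi_ge[OF that])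
    then have "C z \<noteq> 0" by (metis divide_le_0_iff exp_gt_zero norm_zero not_less zero_less_numeral)
    have "norm (H z) * (exp (pi * \<bar>Im z\<bar>) / 4) \<le> norm (H z) * norm (C z)"
      using c by (rule mult_left_mono) simp
    also have "\<dots> \<le> M * exp (pi * \<bar>Im z\<bar>)" using M[of z] by (simp add: GH norm_mult)
    finally show ?thesis by (simp add: field_simps)
  qed
  have "norm (H z) \<le> 4 * M" for z
  proof -
    \<comment> \<open>n >= 1 ensures |Im w| >= 1 on the horizontal sides of the square; the vertical
      sides lie over integers.\<close>
    obtain n :: nat where n: "real n \<ge> max 1 (norm z)" using real_arch_simple by blast
    define S where "S = cbox (- Complex n n) (Complex n n)"
    show ?thesis
    proof (rule maximum_modulus_frontier[where S = S and f = H and \<xi> = z])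
      show "H holomorphic_on interior S" "continuous_on (closure S) H"
        using holH by (auto intro: holomorphic_on_subset holomorphic_on_imp_continuous_on)
      show "bounded S" by (simp add: S_def)
      show "z \<in> S" using n abs_Re_le_cmod[of z] abs_Im_le_cmod[of z]
        by (auto simp: S_def in_cbox_complex_iff)
      fix w assume "w \<in> frontier S"
      then have "w \<in> S" "w \<notin> box (- Complex n n) (Complex n n)"
        by (auto simp: S_def frontier_cbox)
      then have "\<bar>Re w\<bar> = real n \<or> \<bar>Im w\<bar> = real n"
        by (auto simp: S_def in_cbox_complex_iff in_box_complex_iff)
      then have "\<bar>Re w\<bar> = real n \<or> \<bar>Im w\<bar> \<ge> 1" using n by auto
      then show "norm (H w) \<le> 4 * M" by (rule Hb)
    qed
  qed
  then have "bounded (range H)" by (auto simp: bounded_iff)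
  then obtain c where c: "\<And>z. H z = c"
    using Liouville_theorem[OF holH] by (auto simp: constant_on_def)
  have Gc: "G z = c * cos (of_real pi * z)" for z using GH[of z] c by (simp add: C_def)
  have "c = 0"
  proof (rule ccontr)
    assume "c \<noteq> 0"
    have cr: "cos (of_real pi * of_real x) = complex_of_real (cos (pi * x))" for x :: real
      by (metis cos_of_real of_real_mult)
    have "integrable lborel (\<lambda>x. norm (G (of_real x)) / norm c)" using int by simp
    then have i: "integrable lborel (\<lambda>x. \<bar>cos (pi * x)\<bar>)"
      using \<open>c \<noteq> 0\<close> by (simp add: Gc cr norm_mult)
    \<comment> \<open>Orthogonality to the sign of the cosine, applied to c cos(pi x), gives c times
      the integral of |cos(pi x)|; thus c = 0 without evaluating a divergent integral.\<close>
    have "0 = (LINT x|lborel. G (of_real x) * of_real (sgn (cos (pi * x))))"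
      using exp_type_le_sgn_cos_zero[OF G int] by simp
    also have "\<dots> = (LINT x|lborel. c * of_real \<bar>cos (pi * x)\<bar>)"
      by (simp add: Gc cr abs_sgn mult.assoc)
    also have "\<dots> = c * of_real (LINT x|lborel. \<bar>cos (pi * x)\<bar>)"
      by (simp only: integral_mult_right_zero integral_complex_of_real)
    finally show False using \<open>c \<noteq> 0\<close> integral_abs_cos_pos[OF i] by simp
  qed
  then show ?thesis using Gc by simp
qed

section \<open>The sampling kernel and the partial fractions of the secant\<close>

definition sinc_pi :: "complex \<Rightarrow> complex" where
  "sinc_pi w = (if w = 0 then 1 else sin (of_real pi * w) / (of_real pi * w))"

lemma sinc_pi_holomorphic: "sinc_pi holomorphic_on UNIV"
proof -
  have d1: "((\<lambda>w. sin (of_real pi * w)) has_field_derivative cos (of_real pi * w) * of_real pi) (at w)"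
    and d2: "((\<lambda>w. of_real pi * w) has_field_derivative of_real pi) (at w)" for w :: complex
    by (auto intro!: derivative_eq_intros)
  note d = DERIV_imp_deriv[OF d1] DERIV_imp_deriv[OF d2]
  have eq: "sinc_pi = (\<lambda>z. if of_real pi * z = 0 then deriv (\<lambda>w. sin (of_real pi * w)) z / deriv (\<lambda>w. of_real pi * w) z
    else sin (of_real pi * z) / (of_real pi * z))"
    unfolding d by (auto simp: sinc_pi_def fun_eq_iff)
  show ?thesis
    by (subst eq, rule entire_quotient) (auto intro!: holomorphic_intros simp: d)
qed

lemma sinc_pi_minus [simp]: "sinc_pi (- w) = sinc_pi w"
  by (simp add: sinc_pi_def)

lemma norm_cos_le_exp_Im: "norm (cos z) \<le> exp \<bar>Im z\<bar>"
proof -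
  have "norm (cos z) = norm (exp (\<i> * z) + exp (- (\<i> * z))) / 2" by (simp add: cos_exp_eq norm_divide)
  also have "\<dots> \<le> (norm (exp (\<i> * z)) + norm (exp (- (\<i> * z)))) / 2"
    by (intro divide_right_mono norm_triangle_ineq) auto
  also have "\<dots> \<le> (exp \<bar>Im z\<bar> + exp \<bar>Im z\<bar>) / 2"
    by (intro divide_right_mono add_mono) auto
  finally show ?thesis by simp
qed

lemma norm_sin_le_exp_Im: "norm (sin z) \<le> norm z * exp \<bar>Im z\<bar>"
proof -
  have "norm (sin z - sin 0) \<le> exp \<bar>Im z\<bar> * norm (z - 0)"
  proof (rule field_differentiable_bound[of "closed_segment 0 z" sin cos])
    fix w assume "w \<in> closed_segment 0 z"
    then obtain u where u: "w = u *\<^sub>R z" "0 \<le> u" "u \<le> 1" by (auto simp: in_segment)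
    have "\<bar>Im w\<bar> \<le> \<bar>Im z\<bar>" using u by (simp add: abs_mult mult_left_le_one_le)
    then show "norm (cos w) \<le> exp \<bar>Im z\<bar>" using norm_cos_le_exp_Im[of w] by (meson exp_le_cancel_iff order_trans)
  qed (auto intro: DERIV_sin has_field_derivative_at_within)
  then show ?thesis by (simp add: mult.commute)
qed

lemma norm_sinc_pi_le: "norm (sinc_pi w) \<le> exp (pi * \<bar>Im w\<bar>)"
proof (cases "w = 0")
  case False
  have "norm (sin (of_real pi * w)) \<le> norm (of_real pi * w) * exp (pi * \<bar>Im w\<bar>)"
    using norm_sin_le_exp_Im[of "of_real pi * w"] by (simp add: abs_mult)
  then show ?thesis using False by (simp add: sinc_pi_def norm_divide divide_le_eq mult.commute)
qed (simp add: sinc_pi_def)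

lemma sin_pi_shift:
  fixes z :: complex
  shows "sin (of_real pi * (z - of_int n + 1/2)) = (if even n then 1 else -1) * cos (of_real pi * z)"
proof -
  have "of_real pi * (z - of_int n + 1/2) = (of_real pi * z - of_real (pi * of_int n)) + of_real (pi / 2)"
    by (simp add: algebra_simps)
  then have "sin (of_real pi * (z - of_int n + 1/2)) = cos (of_real pi * z - of_real (pi * of_int n))"
    by (simp only: sin_add sin_of_real cos_of_real) simp
  also have "\<dots> = (if even n then 1 else -1) * cos (of_real pi * z)"
    by (simp only: cos_diff sin_of_real cos_of_real cos_npi_int sin_npi_int) simp
  finally show ?thesis .
qed

lemma minus_one_powi: "(-1 :: complex) powi n = (if even n then 1 else -1)"
  by (simp add: power_int_minus_left)

text \<open>Every signed sampling term is a translate of one entire function, so the filled-in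
  singularities of \<open>cq\<close> need no further attention.\<close>

lemma powi_cq_eq_sinc_pi: "(-1) powi n * cq n z = sinc_pi (z - of_int n + 1/2)"
proof (cases "z = of_int n - 1/2")
  case True
  then show ?thesis by (simp add: cq_def sinc_pi_def minus_one_powi)
next
  case False
  then have "z - of_int n + 1/2 \<noteq> 0" by (auto simp: algebra_simps add_eq_0_iff)
  then show ?thesis unfolding sinc_pi_def sin_pi_shift
    using False by (simp add: cq_def minus_one_powi)
qed

text \<open>The positive zeros of cos(pi x), which are the sampling nodes.\<close>

definition hf :: "nat \<Rightarrow> real" where "hf k = real k + 1/2"

text \<open>The samples are even in the node, so both nodes \<plusminus>\<open>hf k\<close> carry
  the same coefficient. In the integer indexing they are n = k+1 and n = -k; for k <= N these
  exhaust exactly the range -N..N+1.\<close>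

definition sinc_pair :: "nat \<Rightarrow> complex \<Rightarrow> complex" where
  "sinc_pair k z = sinc_pi (z - of_real (hf k)) + sinc_pi (z + of_real (hf k))"

lemma hf_pos [simp]: "hf k > 0" by (simp add: hf_def)

lemma hf_nonneg [simp]: "hf k \<ge> 0" by (simp add: hf_def)

lemma hf_ge_half: "hf k \<ge> 1/2" by (simp add: hf_def)

lemma sinc_pair_holomorphic: "sinc_pair k holomorphic_on A"
proof -
  have "(\<lambda>z. sinc_pi (z + c)) holomorphic_on UNIV" for c
    by (rule holomorphic_on_compose[OF _ holomorphic_on_subset[OF sinc_pi_holomorphic], unfolded o_def])
      (auto intro!: holomorphic_intros)
  from this[of "- of_real (hf k)"] this[of "of_real (hf k)"]
  have "sinc_pair k holomorphic_on UNIV"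
    unfolding sinc_pair_def[abs_def] by (intro holomorphic_on_add) auto
  then show ?thesis by (rule holomorphic_on_subset) simp
qed

lemma sinc_pair_minus: "sinc_pair k (- z) = sinc_pair k z"
  using sinc_pi_minus[of "z + of_real (hf k)"] sinc_pi_minus[of "z - of_real (hf k)"]
  by (simp add: sinc_pair_def add.commute)

lemma norm_sinc_pair_le: "norm (sinc_pair k z) \<le> 2 * exp (pi * \<bar>Im z\<bar>)"
  unfolding sinc_pair_def
  using norm_sinc_pi_le[of "z - of_real (hf k)"] norm_sinc_pi_le[of "z + of_real (hf k)"]
  by (intro order_trans[OF norm_triangle_ineq]) simp

lemma sinc_pair_eq_cq:
  "sinc_pair k z = (-1) powi (int k + 1) * cq (int k + 1) z + (-1) powi (- int k) * cq (- int k) z"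
  unfolding powi_cq_eq_sinc_pi by (simp add: sinc_pair_def hf_def algebra_simps)

lemma sinc_pair_eq:
  assumes "z \<noteq> of_real (hf k)" "z \<noteq> - of_real (hf k)"
  shows "sinc_pair k z = cos (of_real pi * z) / of_real pi * (-1) ^ k * (1 / (of_real (hf k) - z) + 1 / (of_real (hf k) + z))"
proof -
  have e: "z - of_int (int k + 1) + 1/2 = z - of_real (hf k)" "z - of_int (- int k) + 1/2 = z + of_real (hf k)"
    by (simp_all add: hf_def)
  have s: "sin (of_real pi * (z - of_real (hf k))) = - ((-1) ^ k * cos (of_real pi * z))"
    "sin (of_real pi * (z + of_real (hf k))) = (-1) ^ k * cos (of_real pi * z)"
    using sin_pi_shift[of z "int k + 1"] sin_pi_shift[of z "- int k"] unfolding e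
    by (auto simp: uminus_power_if)
  define d e where "d = of_real (hf k) - z" and "e = of_real (hf k) + z"
  have de: "z - of_real (hf k) = - d" "z + of_real (hf k) = e" by (simp_all add: d_def e_def)
  have ne: "d \<noteq> 0" "e \<noteq> 0" using assms by (auto simp: d_def e_def add_eq_0_iff)
  show ?thesis
    unfolding sinc_pair_def sinc_pi_def s unfolding de d_def[symmetric] e_def[symmetric]
    using ne by (simp add: field_simps)
qed

lemma sinc_pair_0: "sinc_pair k 0 = of_real (2 / pi * ((-1) ^ k * (1 / hf k)))"
  using sinc_pair_eq[of 0 k] hf_pos[of k] by (simp add: less_imp_neq[symmetric])

section \<open>The partial fractions of the cosecant, and the sum of all sinc translates\<close>

text \<open>Obtained by differentiating the reflection formula rGamma(z) rGamma(1-z) = sin(pi z)/pi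
  and dividing by that product.\<close>

lemma Digamma_reflection:
  fixes z :: complex
  assumes z: "z \<notin> \<int>"
  shows "(Digamma (1 - z) - Digamma z) * sin (of_real pi * z) = of_real pi * cos (of_real pi * z)"
proof -
  have z1: "1 - z \<notin> \<int>" using z by (metis Ints_1 Ints_diff diff_diff_eq2 diff_add_cancel add_diff_cancel_left')
  have np: "z \<notin> \<int>\<^sub>\<le>\<^sub>0" "1 - z \<notin> \<int>\<^sub>\<le>\<^sub>0" using z z1 nonpos_Ints_subset_Ints by blast+
  have "((\<lambda>z. rGamma z * rGamma (1 - z)) has_field_derivative
     (- rGamma z * Digamma z) * rGamma (1 - z) + rGamma z * (rGamma (1 - z) * Digamma (1 - z))) (at z)"
    using np by (auto intro!: derivative_eq_intros simp: algebra_simps)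
  moreover have "((\<lambda>z. sin (of_real pi * z) / of_real pi) has_field_derivative cos (of_real pi * z)) (at z)"
    by (auto intro!: derivative_eq_intros)
  moreover have "(\<lambda>z::complex. rGamma z * rGamma (1 - z)) = (\<lambda>z. sin (of_real pi * z) / of_real pi)"
    by (simp add: rGamma_reflection_complex)
  ultimately have "(- rGamma z * Digamma z) * rGamma (1 - z) + rGamma z * (rGamma (1 - z) * Digamma (1 - z)) = cos (of_real pi * z)"
    by (metis DERIV_unique)
  then have "(Digamma (1 - z) - Digamma z) * (rGamma z * rGamma (1 - z)) = cos (of_real pi * z)"
    by (simp add: algebra_simps)
  then show ?thesis unfolding rGamma_reflection_complex by (simp add: field_simps)
qed

text \<open>Separating even and odd k turns the 2N terms into partial sums of four digamma series,
  at u/2, (1-u)/2 and their complements to 1, whose logarithms cancel. With a = pi u/2 the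
  reflection formula gives (pi/2)(cot a + tan a) = pi/sin(2a).\<close>

lemma alternating_reciprocal_limit:
  fixes u :: complex
  assumes u: "u \<notin> \<int>"
  shows "(\<lambda>N. \<Sum>k<2*N. (-1) ^ k * (1 / (of_nat k + u) + 1 / (of_nat k + 1 - u))) \<longlonglongrightarrow> of_real pi / sin (of_real pi * u)"
proof -
  define p where "p = (\<lambda>w m. of_real (ln (real m)) - (\<Sum>n<m. inverse (w + of_nat n)) :: complex)"
  have p: "p w \<longlonglongrightarrow> Digamma w" if "w \<noteq> 0" for w unfolding p_def using that by (rule Digamma_LIMSEQ)
  have two: "a / 2 \<notin> \<int>" if "a \<notin> \<int>" for a :: complex
    using that by (metis Ints_mult Ints_numeral divide_eq_eq_numeral1(1) zero_neq_numeral nonzero_mult_div_cancel_right times_divide_eq_left)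
  have u1: "1 - u \<notin> \<int>" using u by (metis Ints_1 Ints_diff diff_diff_eq2 diff_add_cancel add_diff_cancel_left')
  have h: "u/2 \<notin> \<int>" "(1 - u)/2 \<notin> \<int>" using two u u1 by auto
  then have h': "1 - u/2 \<notin> \<int>" "1 - (1 - u)/2 \<notin> \<int>"
    by (metis Ints_1 Ints_diff diff_diff_eq2 diff_add_cancel add_diff_cancel_left')+
  have ne: "u/2 \<noteq> 0" "(1 - u)/2 \<noteq> 0" "1 - u/2 \<noteq> 0" "1 - (1 - u)/2 \<noteq> 0" using h h' by (metis Ints_0)+
  have half: "inverse (w + of_nat n) / 2 = 1 / (2 * w + of_nat (2 * n))" for w :: complex and n
    by (simp add: field_simps)
  have "(\<Sum>k<2*N. (-1) ^ k * (1 / (of_nat k + u) + 1 / (of_nat k + 1 - u)))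
    = (p (1 - u/2) N - p (u/2) N + (p (1 - (1 - u)/2) N - p ((1 - u)/2) N)) / 2" for N
  proof (induction N)
    case (Suc N)
    have i: "p w (Suc N) = p w N + (of_real (ln (real (Suc N))) - of_real (ln (real N))) - inverse (w + of_nat N)" for w
      by (simp add: p_def)
    have "(\<Sum>k<2*Suc N. (-1) ^ k * (1 / (of_nat k + u) + 1 / (of_nat k + 1 - u)))
      = (\<Sum>k<2*N. (-1) ^ k * (1 / (of_nat k + u) + 1 / (of_nat k + 1 - u)))
       + (1 / (of_nat (2*N) + u) + 1 / (of_nat (2*N) + 1 - u)) - (1 / (of_nat (2*N) + 1 + u) + 1 / (of_nat (2*N) + 2 - u))"
      by (simp add: algebra_simps)
    also have "\<dots> = (p (1 - u/2) N - p (u/2) N + (p (1 - (1 - u)/2) N - p ((1 - u)/2) N)) / 2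
       + (inverse (u/2 + of_nat N)/2 + inverse ((1 - u)/2 + of_nat N)/2) - (inverse (1 - (1 - u)/2 + of_nat N)/2 + inverse (1 - u/2 + of_nat N)/2)"
    proof -
      have tw: "2 * (u/2) = u" "2 * ((1 - u)/2) = 1 - u" "2 * (1 - (1 - u)/2) = 1 + u" "2 * (1 - u/2) = 2 - u"
        by (auto simp: field_simps)
      show ?thesis unfolding Suc.IH half tw by (simp add: algebra_simps)
    qed
    also have "\<dots> = (p (1 - u/2) (Suc N) - p (u/2) (Suc N) + (p (1 - (1 - u)/2) (Suc N) - p ((1 - u)/2) (Suc N))) / 2"
    proof -
      have "(P1 - P2 + (P3 - P4)) / 2 + (a/2 + b/2) - (c/2 + d/2)
        = ((P1 + l - d) - (P2 + l - a) + ((P3 + l - c) - (P4 + l - b))) / 2" for P1 P2 P3 P4 a b c d l :: complex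
        by (simp add: field_simps)
      then show ?thesis unfolding i .
    qed
    finally show ?case .
  qed (simp add: p_def)
  moreover have "(\<lambda>N. (p (1 - u/2) N - p (u/2) N + (p (1 - (1 - u)/2) N - p ((1 - u)/2) N)) / 2) \<longlonglongrightarrow>
    (Digamma (1 - u/2) - Digamma (u/2) + (Digamma (1 - (1 - u)/2) - Digamma ((1 - u)/2))) / 2"
    using ne by (intro tendsto_intros p) auto
  moreover have "(Digamma (1 - u/2) - Digamma (u/2) + (Digamma (1 - (1 - u)/2) - Digamma ((1 - u)/2))) / 2
    = of_real pi / sin (of_real pi * u)"
  proof -
    define a where "a = of_real pi * u / 2"
    have a1: "of_real pi * (u / 2) = a" "of_real pi * ((1 - u) / 2) = of_real (pi/2) - a" "of_real pi * u = 2 * a"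
      by (auto simp: a_def field_simps)
    have sn: "sin (of_real (pi/2) - a) = cos a" "cos (of_real (pi/2) - a) = sin a"
      by (simp_all only: sin_diff cos_diff sin_of_real cos_of_real) simp_all
    have nz: "sin (of_real pi * u) \<noteq> 0"
    proof
      assume "sin (of_real pi * u) = 0"
      then obtain n :: int where "of_real pi * u = of_real (of_int n * pi)" unfolding sin_eq_0 by blast
      then have "u = of_int n" by (simp add: mult.commute)
      then show False using u by simp
    qed
    then have sc: "sin a \<noteq> 0" "cos a \<noteq> 0" unfolding a1 sin_double by auto
    have dg: "Digamma (1 - u/2) - Digamma (u/2) = of_real pi * cos a / sin a"
      "Digamma (1 - (1 - u)/2) - Digamma ((1 - u)/2) = of_real pi * sin a / cos a"
      using Digamma_reflection[OF h(1)] Digamma_reflection[OF h(2)] sc unfolding a1 sn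
      by (simp_all add: eq_divide_eq)
    have "(Digamma (1 - u/2) - Digamma (u/2) + (Digamma (1 - (1 - u)/2) - Digamma ((1 - u)/2))) / 2
      = of_real pi * (sin a ^ 2 + cos a ^ 2) / (2 * sin a * cos a)"
    proof -
      have "(P * c / s + P * s / c) / 2 = P * (s ^ 2 + c ^ 2) / (2 * s * c)" if "s \<noteq> 0" "c \<noteq> 0" for P s c :: complex
        using that by (simp add: field_simps power2_eq_square)
      with dg sc show ?thesis by simp
    qed
    then show ?thesis unfolding a1 sin_double by simp
  qed
  ultimately show ?thesis by (simp only:)
qed

text \<open>With m = \<open>hf k\<close> one has 1/(m-z) + 1/(m+z) - 2/m = 2 z^2/(m (m^2 - z^2)).
  Removing cos(pi z) times the value at 0 thus improves the decay from 1/m to 1/m^3; m >= 2R keeps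
  |m-z| and |m+z| above m/2.\<close>

lemma sinc_pair_remainder:
  assumes z: "norm z \<le> R" and k: "hf k \<ge> 2 * R"
  shows "norm (sinc_pair k z - cos (of_real pi * z) * sinc_pair k 0) \<le> 3 * exp (pi * R) * R\<^sup>2 / hf k ^ 3"
proof -
  define m :: complex where "m = of_real (hf k)"
  have R0: "R \<ge> 0" using z norm_ge_zero order_trans by blast
  have nm: "norm m = hf k" by (simp add: m_def)
  have d: "norm (m - z) \<ge> hf k / 2" "norm (m + z) \<ge> hf k / 2"
    using norm_triangle_ineq2[of m z] norm_diff_ineq[of m z] z k nm by auto
  have ne: "m - z \<noteq> 0" "m + z \<noteq> 0" "m \<noteq> 0" using d hf_pos[of k] nm by (auto simp del: hf_pos)
  have zne: "z \<noteq> of_real (hf k)" "z \<noteq> - of_real (hf k)" using ne by (auto simp: m_def)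
  have z0: "0 \<noteq> complex_of_real (hf k)" "0 \<noteq> - complex_of_real (hf k)" using ne(3) by (auto simp: m_def)
  have "sinc_pair k z - cos (of_real pi * z) * sinc_pair k 0
    = cos (of_real pi * z) / of_real pi * (-1) ^ k * (1 / (m - z) + 1 / (m + z) - 2 / m)"
    unfolding sinc_pair_eq[OF zne] sinc_pair_eq[OF z0] m_def by (simp add: algebra_simps)
  also have "1 / (m - z) + 1 / (m + z) - 2 / m = 2 * z\<^sup>2 / (m * (m - z) * (m + z))"
  proof -
    have "1 / d + 1 / e - 2 / c = (c * e + c * d - 2 * d * e) / (c * d * e)" if "c \<noteq> 0" "d \<noteq> 0" "e \<noteq> 0" for c d e :: complex
      using that by (simp add: field_simps)
    from this[OF ne(3,1,2)] show ?thesis by (simp add: algebra_simps power2_eq_square)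
  qed
  finally have "norm (sinc_pair k z - cos (of_real pi * z) * sinc_pair k 0)
    = norm (cos (of_real pi * z)) / pi * (2 * norm z ^ 2 / (hf k * norm (m - z) * norm (m + z)))"
    by (simp add: norm_mult norm_divide norm_power nm)
  also have "\<dots> \<le> exp (pi * R) / pi * (2 * R ^ 2 / (hf k * (hf k / 2) * (hf k / 2)))"
  proof (intro mult_mono divide_right_mono frac_le)
    have "\<bar>Im z\<bar> \<le> R" using z abs_Im_le_cmod[of z] by linarith
    then have "pi * \<bar>Im z\<bar> \<le> pi * R" by (intro mult_left_mono) auto
    then show "norm (cos (of_real pi * z)) \<le> exp (pi * R)"
    proof -
      have "norm (cos (of_real pi * z)) \<le> exp \<bar>Im (of_real pi * z)\<bar>" by (rule norm_cos_le_exp_Im)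
      also have "\<bar>Im (of_real pi * z)\<bar> = pi * \<bar>Im z\<bar>" by (simp add: abs_mult)
      also have "exp (pi * \<bar>Im z\<bar>) \<le> exp (pi * R)" using \<open>pi * \<bar>Im z\<bar> \<le> pi * R\<close> by simp
      finally show ?thesis .
    qed
  qed (use z R0 d hf_pos[of k] in \<open>auto intro!: mult_mono power_mono\<close>)
  also have "\<dots> = exp (pi * R) * R\<^sup>2 / hf k ^ 3 * (8 / pi)"
    by (simp add: power2_eq_square power3_eq_cube mult_ac)
  also have "\<dots> \<le> exp (pi * R) * R\<^sup>2 / hf k ^ 3 * 3"
    using pi_gt3 by (intro mult_left_mono) (auto simp: field_simps)
  finally show ?thesis by (simp add: mult_ac)
qed

lemma summable_inverse_hf_square: "summable (\<lambda>k. 1 / hf k ^ 2)"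
proof (rule summable_comparison_test')
  have "summable (\<lambda>n. inverse (real n ^ 2))" by (rule inverse_power_summable) simp
  then have "summable (\<lambda>n. inverse (real (Suc n) ^ 2))" by (subst summable_Suc_iff)
  then show "summable (\<lambda>n. 4 * inverse (real (Suc n) ^ 2))" by (rule summable_mult)
  fix n :: nat
  have "(real (Suc n) / 2) ^ 2 \<le> hf n ^ 2" by (intro power_mono) (auto simp: hf_def)
  then have "1 / hf n ^ 2 \<le> 1 / (real (Suc n) / 2) ^ 2" by (intro frac_le) auto
  also have "1 / (real (Suc n) / 2) ^ 2 = 4 * inverse (real (Suc n) ^ 2)"
    by (simp only: power_divide inverse_eq_divide) (simp del: of_nat_Suc)
  finally show "norm (1 / hf n ^ 2) \<le> 4 * inverse (real (Suc n) ^ 2)" by simp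
qed

text \<open>Coefficients of linear growth against a remainder of order 1/\<open>hf k\<close>^3 leave
  a series dominated by 1/\<open>hf k\<close>^2, uniformly on discs. All conditional convergence
  sits in the scalar series at z = 0, which is the hypothesis \<open>conv\<close>; its sum is
  multiplied by cos(pi z).\<close>

lemma sinc_series:
  fixes a :: "nat \<Rightarrow> real"
  assumes bound: "\<And>k. \<bar>a k\<bar> \<le> A * hf k" and conv: "summable (\<lambda>k. (-1) ^ k * (a k / hf k))"
  shows sinc_series_summable: "summable (\<lambda>k. of_real (a k) * sinc_pair k z)"
    and sinc_series_holomorphic: "(\<lambda>z. \<Sum>k. of_real (a k) * sinc_pair k z) holomorphic_on UNIV"
proof -
  define r where "r = (\<lambda>k z. of_real (a k) * (sinc_pair k z - cos (of_real pi * z) * sinc_pair k 0))"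
  define Rm where "Rm = (\<lambda>z. \<Sum>k. r k z)"
  have A0: "A \<ge> 0" 
  proof -
    have "0 \<le> A * hf 0" using bound[of 0] by linarith
    then show ?thesis using hf_pos[of 0] by (simp add: zero_le_mult_iff del: hf_pos)
  qed
  have uni: "uniform_limit (cball 0 R) (\<lambda>n z. \<Sum>k<n. r k z) Rm sequentially" for R
    unfolding Rm_def
  proof (rule Weierstrass_m_test_ev)
    show "summable (\<lambda>k. A * (3 * exp (pi * R) * R\<^sup>2) * (1 / hf k ^ 2))"
      by (intro summable_mult summable_inverse_hf_square)
    have "filterlim hf at_top sequentially" unfolding hf_def by real_asymp
    then have "eventually (\<lambda>k. hf k \<ge> 2 * R) sequentially" by (simp add: filterlim_at_top)
    then show "\<forall>\<^sub>F k in sequentially. \<forall>z\<in>cball 0 R. norm (r k z) \<le> A * (3 * exp (pi * R) * R\<^sup>2) * (1 / hf k ^ 2)"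
    proof eventually_elim
      case (elim k)
      show ?case
      proof
        fix z :: complex assume "z \<in> cball 0 R"
        then have "norm (sinc_pair k z - cos (of_real pi * z) * sinc_pair k 0) \<le> 3 * exp (pi * R) * R\<^sup>2 / hf k ^ 3"
          using elim by (intro sinc_pair_remainder) auto
        then have "norm (r k z) \<le> (A * hf k) * (3 * exp (pi * R) * R\<^sup>2 / hf k ^ 3)"
          unfolding r_def norm_mult using bound[of k] A0 hf_pos[of k] by (intro mult_mono) (auto simp del: hf_pos)
        then show "norm (r k z) \<le> A * (3 * exp (pi * R) * R\<^sup>2) * (1 / hf k ^ 2)"
          using hf_pos[of k] by (simp add: power3_eq_cube power2_eq_square field_simps)
      qed
    qed
  qed
  have sums_r: "(\<lambda>k. r k z) sums Rm z" for z
    using tendsto_uniform_limitI[OF uni[of "norm z"], of z] by (simp add: sums_def)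
  have "Rm holomorphic_on UNIV"
  proof (rule holomorphic_uniform_sequence[OF open_UNIV])
    show "(\<lambda>z. \<Sum>k<n. r k z) holomorphic_on UNIV" for n
      unfolding r_def by (intro holomorphic_intros sinc_pair_holomorphic)
    fix x :: complex
    have "cball x 1 \<subseteq> cball 0 (norm x + 1)"
    proof
      fix w assume "w \<in> cball x 1"
      then show "w \<in> cball 0 (norm x + 1)" using norm_triangle_ineq2[of w x] by (simp add: dist_norm norm_minus_commute)
    qed
    then have "uniform_limit (cball x 1) (\<lambda>n z. \<Sum>k<n. r k z) Rm sequentially"
      by (rule uniform_limit_on_subset[OF uni])
    then show "\<exists>d>0. cball x d \<subseteq> UNIV \<and> uniform_limit (cball x d) (\<lambda>n z. \<Sum>k<n. r k z) Rm sequentially"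
      by (intro exI[of _ 1]) auto
  qed
  define s where "s = (\<Sum>k. of_real (a k) * sinc_pair k 0)"
  have "(\<lambda>k. of_real (a k) * sinc_pair k 0) = (\<lambda>k. of_real (2 / pi * ((-1) ^ k * (a k / hf k))) :: complex)"
    unfolding sinc_pair_0 by (simp add: fun_eq_iff)
  moreover have "summable \<dots>"
    by (intro summable_of_real summable_mult conv)
  ultimately have "(\<lambda>k. of_real (a k) * sinc_pair k 0) sums s"
    unfolding s_def by (simp add: summable_sums)
  then have "(\<lambda>k. cos (of_real pi * z) * (of_real (a k) * sinc_pair k 0) + r k z) sums (cos (of_real pi * z) * s + Rm z)" for z
    by (intro sums_add sums_mult sums_r)
  moreover have "cos (of_real pi * z) * (of_real (a k) * sinc_pair k 0) + r k z = of_real (a k) * sinc_pair k z" for k z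
    by (simp add: r_def algebra_simps)
  ultimately have S: "(\<lambda>k. of_real (a k) * sinc_pair k z) sums (cos (of_real pi * z) * s + Rm z)" for z by simp
  then show "summable (\<lambda>k. of_real (a k) * sinc_pair k z)" by (rule sums_summable)
  have "(\<lambda>z. \<Sum>k. of_real (a k) * sinc_pair k z) = (\<lambda>z. cos (of_real pi * z) * s + Rm z)"
    using S by (auto simp: sums_iff)
  moreover have "(\<lambda>z. cos (of_real pi * z) * s + Rm z) holomorphic_on UNIV"
    by (intro holomorphic_intros \<open>Rm holomorphic_on UNIV\<close>)
  ultimately show "(\<lambda>z. \<Sum>k. of_real (a k) * sinc_pair k z) holomorphic_on UNIV" by simp
qed

lemma summable_alternating_hf: "summable (\<lambda>k. (-1) ^ k * (1 / hf k))"
proof (rule summable)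
  show "(\<lambda>k. 1 / hf k) \<longlonglongrightarrow> 0" unfolding hf_def by real_asymp
qed (auto simp: hf_def intro!: divide_left_mono)

text \<open>Off the real axis this is the partial fraction expansion of pi/cos(pi z), with u = 1/2 -
  z; the real axis follows by continuity because the sum is entire. It allows terms free of k, such
  as exp(-l z) and exp(-l), to be distributed over the sampling series.\<close>

lemma sinc_pair_sums_1: "(\<lambda>k. sinc_pair k z) sums 1"
proof -
  have b: "\<bar>1\<bar> \<le> 2 * hf k" for k by (simp add: hf_def)
  define S where "S = (\<lambda>z. \<Sum>k. sinc_pair k z)"
  have summ: "summable (\<lambda>k. sinc_pair k z)" for z
    using sinc_series_summable[OF b summable_alternating_hf, of z] by simp
  have hol: "S holomorphic_on UNIV"
    using sinc_series_holomorphic[OF b summable_alternating_hf] by (simp add: S_def)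
  have im: "S z = 1" if "Im z \<noteq> 0" for z
  proof -
    define u where "u = 1/2 - z"
    have c: "sin (of_real pi * u) = cos (of_real pi * z)"
      using sin_pi_shift[of "-z" 0] by (simp add: u_def add.commute)
    have "Im u \<noteq> 0" using that by (simp add: u_def)
    then have u: "u \<notin> \<int>" by (auto elim!: Ints_cases)
    have cz: "cos (of_real pi * z) \<noteq> 0"
    proof
      assume "cos (of_real pi * z) = 0"
      then obtain n :: int where "of_real pi * z = of_real (of_int n * pi) + of_real pi / 2" unfolding cos_eq_0 by blast
      then have "Im (of_real pi * z) = Im (of_real (of_int n * pi) + of_real pi / 2)" by (rule arg_cong)
      then show False using that by simp
    qed
    have T: "sinc_pair k z = cos (of_real pi * z) / of_real pi * ((-1) ^ k * (1 / (of_nat k + u) + 1 / (of_nat k + 1 - u)))" for k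
    proof -
      have "z \<noteq> of_real (hf k)" "z \<noteq> - of_real (hf k)" using that by auto
      from sinc_pair_eq[OF this] show ?thesis by (simp add: u_def hf_def algebra_simps)
    qed
    have "(\<lambda>N. cos (of_real pi * z) / of_real pi * (\<Sum>k<2*N. (-1) ^ k * (1 / (of_nat k + u) + 1 / (of_nat k + 1 - u))))
      \<longlonglongrightarrow> cos (of_real pi * z) / of_real pi * (of_real pi / sin (of_real pi * u))"
      by (intro tendsto_intros alternating_reciprocal_limit u)
    then have "(\<lambda>N. \<Sum>k<2*N. sinc_pair k z) \<longlonglongrightarrow> 1"
      using cz by (simp add: T c sum_distrib_left)
    moreover have "(\<lambda>N. \<Sum>k<2*N. sinc_pair k z) \<longlonglongrightarrow> S z"
      using LIMSEQ_subseq_LIMSEQ[of "\<lambda>N. \<Sum>k<N. sinc_pair k z" "S z" "\<lambda>N. 2 * N"] summable_LIMSEQ[OF summ[of z]]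
      by (simp add: S_def o_def strict_mono_def)
    ultimately show ?thesis by (rule LIMSEQ_unique[symmetric])
  qed
  have "S z = 1"
  proof (cases "Im z = 0")
    case True
    have "isCont S z" using holomorphic_on_imp_continuous_on[OF hol] by (simp add: continuous_on_eq_continuous_at)
    moreover have "(\<lambda>j. z + \<i> * of_real (1 / Suc j)) \<longlonglongrightarrow> z + \<i> * of_real 0"
    proof (intro tendsto_intros)
      show "(\<lambda>j. 1 / real (Suc j)) \<longlonglongrightarrow> 0" by real_asymp
    qed
    ultimately have "(\<lambda>j. S (z + \<i> * of_real (1 / Suc j))) \<longlonglongrightarrow> S z"
      by (intro isCont_tendsto_compose[of z S]) auto
    moreover have "S (z + \<i> * of_real (1 / Suc j)) = 1" for j
      using True by (intro im) auto
    ultimately show ?thesis by (simp add: LIMSEQ_const_iff)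
  qed (rule im)
  then show ?thesis using summ by (simp add: sums_iff S_def)
qed

section \<open>Both kernels as series of sinc pairs\<close>

lemma exp_hf_summable:
  assumes "l > 0"
  shows "summable (\<lambda>k. exp (- l * hf k))" "(\<Sum>k. exp (- l * hf k)) = exp (- l / 2) / (1 - exp (- l))"
proof -
  have "(\<lambda>k. exp (- l / 2) * exp (- l) ^ k) sums (exp (- l / 2) * (1 / (1 - exp (- l))))"
    using assms by (intro sums_mult geometric_sums) auto
  moreover have "exp (- l / 2) * exp (- l) ^ k = exp (- l * hf k)" for k
    by (simp add: exp_of_nat_mult[symmetric] exp_add[symmetric] hf_def algebra_simps)
  ultimately have S: "(\<lambda>k. exp (- l * hf k)) sums (exp (- l / 2) / (1 - exp (- l)))" by simp
  show "summable (\<lambda>k. exp (- l * hf k))" using S by (rule sums_summable)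
  show "(\<Sum>k. exp (- l * hf k)) = exp (- l / 2) / (1 - exp (- l))" using S by (rule sums_unique[symmetric])
qed

lemma K_lam_summable_norm:
  assumes "l > 0"
  shows "summable (\<lambda>k. norm (of_real (exp (- l * hf k)) * sinc_pair k z))"
proof (rule summable_comparison_test')
  show "summable (\<lambda>k. exp (- l * hf k) * (2 * exp (pi * \<bar>Im z\<bar>)))"
    by (intro summable_mult2 exp_hf_summable assms)
  show "norm (norm (of_real (exp (- l * hf k)) * sinc_pair k z)) \<le> exp (- l * hf k) * (2 * exp (pi * \<bar>Im z\<bar>))" for k
    using norm_sinc_pair_le[of k z] by (simp add: norm_mult)
qed

text \<open>For l > 0 the exponential weights make the sum over the integers absolutely convergent,
  so it may be split into the families n = k+1 and n = -k and recombined in pairs.\<close>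

lemma K_lam_eq:
  assumes l: "l > 0"
  shows "K_lam l z = (\<Sum>k. of_real (exp (- l * hf k)) * sinc_pair k z)"
proof -
  define h where "h = (\<lambda>n::int. (-1) powi n * of_real (exp (- l * \<bar>of_int n - 1/2\<bar>)) * cq n z)"
  define t where "t = (\<lambda>c k. of_real (exp (- l * hf k)) * sinc_pi (z + of_real (c * hf k)))"
  have tt: "t (-1) k + t 1 k = of_real (exp (- l * hf k)) * sinc_pair k z" for k
    by (simp add: t_def sinc_pair_def algebra_simps)
  have summ: "summable (\<lambda>k. norm (t c k))" if "c = 1 \<or> c = -1" for c
  proof (rule summable_comparison_test')
    show "summable (\<lambda>k. exp (- l * hf k) * exp (pi * \<bar>Im z\<bar>))"
      by (intro summable_mult2 exp_hf_summable l)
    show "norm (norm (t c k)) \<le> exp (- l * hf k) * exp (pi * \<bar>Im z\<bar>)" for k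
      using norm_sinc_pi_le[of "z + of_real (c * hf k)"] by (simp add: t_def norm_mult)
  qed
  have t_sum: "(t c has_sum suminf (t c)) UNIV" if "c = 1 \<or> c = -1" for c
    by (rule norm_summable_imp_has_sum[OF summ[OF that] summable_sums[OF summable_norm_cancel[OF summ[OF that]]]])
  have h1: "h \<circ> (\<lambda>k. int k + 1) = t (-1)"
  proof
    fix k
    have "\<bar>of_int (int k + 1) - 1/2\<bar> = hf k" by (simp add: hf_def)
    moreover have "(-1) powi (int k + 1) * cq (int k + 1) z = sinc_pi (z + of_real (- 1 * hf k))"
      unfolding powi_cq_eq_sinc_pi by (rule arg_cong[where f = sinc_pi]) (simp add: hf_def)
    ultimately show "(h \<circ> (\<lambda>k. int k + 1)) k = t (-1) k"
      unfolding h_def t_def o_def by (metis mult.assoc mult.commute)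
  qed
  have h2: "h \<circ> (\<lambda>k. - int k) = t 1"
  proof
    fix k
    have "\<bar>of_int (- int k) - 1/2\<bar> = hf k" by (simp add: hf_def)
    moreover have "(-1) powi (- int k) * cq (- int k) z = sinc_pi (z + of_real (1 * hf k))"
      unfolding powi_cq_eq_sinc_pi by (rule arg_cong[where f = sinc_pi]) (simp add: hf_def)
    ultimately show "(h \<circ> (\<lambda>k. - int k)) k = t 1 k"
      unfolding h_def t_def o_def by (metis mult.assoc mult.commute)
  qed
  have "(h has_sum suminf (t (-1))) (range (\<lambda>k. int k + 1))"
    by (subst has_sum_reindex) (use t_sum[of "-1"] h1 in \<open>auto simp: inj_on_def\<close>)
  moreover have "(h has_sum suminf (t 1)) (range (\<lambda>k. - int k))"
    by (subst has_sum_reindex) (use t_sum[of 1] h2 in \<open>auto simp: inj_on_def\<close>)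
  ultimately have "(h has_sum (suminf (t (-1)) + suminf (t 1))) (range (\<lambda>k. int k + 1) \<union> range (\<lambda>k. - int k))"
    by (rule has_sum_Un_disjoint) auto
  moreover have "range (\<lambda>k. int k + 1) \<union> range (\<lambda>k. - int k) = UNIV"
  proof (rule sym, rule UNIV_eq_I)
    fix n :: int
    show "n \<in> range (\<lambda>k. int k + 1) \<union> range (\<lambda>k. - int k)"
    proof (cases "n > 0")
      case True
      then have "n = int (nat (n - 1)) + 1" by simp
      then show ?thesis by blast
    next
      case False
      then have "n = - int (nat (- n))" by simp
      then show ?thesis by blast
    qed
  qed
  ultimately have "K_lam l z = suminf (t (-1)) + suminf (t 1)"
    unfolding K_lam_def h_def[symmetric] by (auto dest: infsumI)
  also have "\<dots> = (\<Sum>k. t (-1) k + t 1 k)"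
    by (rule suminf_add) (rule summable_norm_cancel, rule summ, simp)+
  finally show ?thesis by (simp add: tt)
qed

text \<open>A regrouping of the symmetric partial sums: increasing N by 1 adds exactly one pair.
  Convergence is not asserted here.\<close>

lemma K_rho_eq:
  "K_rho \<rho> z = lim (\<lambda>N. \<Sum>k\<le>N. of_real (fr \<rho> (hf k)) * sinc_pair k z)"
proof -
  define h where "h = (\<lambda>n::int. (-1) powi n * of_real (fr \<rho> (of_int n - 1/2)) * cq n z)"
  have ev: "fr \<rho> (- x) = fr \<rho> x" for x by (simp add: fr_def f_rho_def)
  have pair: "h (int k + 1) + h (- int k) = of_real (fr \<rho> (hf k)) * sinc_pair k z" for k
  proof -
    have "of_int (int k + 1) - 1/2 = hf k" "of_int (- int k) - 1/2 = - hf k" by (simp_all add: hf_def)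
    then show ?thesis unfolding h_def sinc_pair_eq_cq by (simp only: ev) (simp add: algebra_simps)
  qed
  have "sum h {- int N..int N + 1} = (\<Sum>k\<le>N. of_real (fr \<rho> (hf k)) * sinc_pair k z)" for N
  proof (induction N)
    case 0
    have "{- int 0..int 0 + 1} = {int 0 + 1, - int 0}" by auto
    then show ?case using pair[of 0] by simp
  next
    case (Suc N)
    have "{- int (Suc N)..int (Suc N) + 1} = insert (int (Suc N) + 1) (insert (- int (Suc N)) {- int N..int N + 1})" by auto
    then show ?case using Suc pair[of "Suc N"] by (simp add: add.commute add.left_commute)
  qed
  then show ?thesis unfolding K_rho_def h_def by simp
qed

section \<open>The interpolation error as a Laplace transform\<close>

lemma has_bochner_integral_two_sided:
  fixes f :: "real \<Rightarrow> 'a :: {banach, second_countable_topology}"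
  assumes I: "has_bochner_integral lborel (\<lambda>x. indicator {0..} x *\<^sub>R f x) I"
    and J: "has_bochner_integral lborel (\<lambda>x. indicator {0..} x *\<^sub>R f (- x)) J"
    and m: "f \<in> borel_measurable borel"
  shows "has_bochner_integral lborel f (I + J)"
proof -
  have "has_bochner_integral lborel (\<lambda>x. indicator {0..} (0 + (-1) * x) *\<^sub>R f (- (0 + (-1) * x))) (J /\<^sub>R \<bar>-1\<bar>)"
    using J by (subst (asm) lborel_has_bochner_integral_real_affine_iff[of "-1" _ _ 0]) auto
  then have J': "has_bochner_integral lborel (\<lambda>x. indicator {..0} x *\<^sub>R f x) J"
    by (simp add: indicator_def)
  note has_bochner_integral_add[OF I J']
  moreover have "AE x in lborel. indicator {0..} x *\<^sub>R f x + indicator {..0} x *\<^sub>R f x = f x"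
    using AE_lborel_singleton[of "0::real"] by eventually_elim (auto simp: indicator_def)
  ultimately show ?thesis
    using m by (subst (asm) has_bochner_integral_cong_AE) auto
qed

lemma has_bochner_integral_exp_Icc:
  fixes b :: complex
  assumes "b \<noteq> 0" "l \<ge> 0"
  shows "has_bochner_integral lborel (\<lambda>w. indicator {0..l} w *\<^sub>R exp (- b * of_real w)) ((1 - exp (- b * of_real l)) / b)"
proof -
  have d: "((\<lambda>z. - exp (- b * z) / b) has_field_derivative exp (- b * z)) (at z)" for z
    using assms by (auto intro!: derivative_eq_intros)
  have c: "continuous_on {0..l} (\<lambda>w. exp (- b * of_real w))" by (intro continuous_intros)
  have "(LINT w|lborel. indicator {0..l} w *\<^sub>R exp (- b * of_real w)) = (1 - exp (- b * of_real l)) / b"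
    using complex_primitive_diff_eq_integral[of 0 l "\<lambda>z. - exp (- b * z) / b" "\<lambda>z. exp (- b * z)"] d c assms
    by (simp add: diff_divide_distrib)
  moreover have "integrable lborel (\<lambda>w. indicator {0..l} w *\<^sub>R exp (- b * of_real w))"
    by (rule borel_integrable_compact[OF compact_Icc c])
  ultimately show ?thesis by (simp add: has_bochner_integral_iff)
qed

lemma integrable_exp_Ici:
  assumes "(b::real) > 0"
  shows "integrable lborel (\<lambda>w. indicator {0..} w *\<^sub>R exp (- b * w))"
proof (rule integrableI_nonneg)
  have "((\<lambda>w. - exp (- b * w) / b) \<longlongrightarrow> 0) at_top" using assms by real_asymp
  moreover have "DERIV (\<lambda>w. - exp (- b * w) / b) w :> exp (- b * w)" for w
    using assms by (auto intro!: derivative_eq_intros)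
  ultimately have "(\<integral>\<^sup>+ w. ennreal (exp (- b * w)) * indicator {0..} w \<partial>lborel) = ennreal (0 - (- exp (- b * 0) / b))"
    by (intro nn_integral_FTC_atLeast) auto
  also have "(\<integral>\<^sup>+ w. ennreal (exp (- b * w)) * indicator {0..} w \<partial>lborel) = (\<integral>\<^sup>+ w. ennreal (indicator {0..} w *\<^sub>R exp (- b * w)) \<partial>lborel)"
    by (intro nn_integral_cong) (auto simp: indicator_def)
  finally show "(\<integral>\<^sup>+ w. ennreal (indicator {0..} w *\<^sub>R exp (- b * w)) \<partial>lborel) < \<infinity>" by simp
qed auto

lemma has_bochner_integral_exp_Ici:
  fixes b :: complex
  assumes b: "Re b > 0"
  shows "has_bochner_integral lborel (\<lambda>w. indicator {0..} w *\<^sub>R exp (- b * of_real w)) (1 / b)"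
proof -
  have b0: "b \<noteq> 0" using b by auto
  let ?s = "\<lambda>(i::nat) w. indicator {0..real i} w *\<^sub>R exp (- b * of_real w)"
  let ?f = "\<lambda>w. indicator {0..} w *\<^sub>R exp (- b * of_real w)"
  let ?w = "\<lambda>w. indicator {0..} w *\<^sub>R exp (- Re b * w)"
  have m: "?f \<in> borel_measurable lborel" "\<And>i. ?s i \<in> borel_measurable lborel" by auto
  have i: "integrable lborel ?w" by (rule integrable_exp_Ici[OF b])
  have lim: "AE w in lborel. (\<lambda>i. ?s i w) \<longlonglongrightarrow> ?f w"
  proof (rule AE_I2, rule tendsto_eventually)
    fix w :: real
    have "eventually (\<lambda>i. real i \<ge> w) sequentially"
      using filterlim_real_sequentially by (simp add: filterlim_at_top)
    then show "eventually (\<lambda>i. ?s i w = ?f w) sequentially" by eventually_elim (auto simp: indicator_def)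
  qed
  have bd: "AE w in lborel. norm (?s i w) \<le> ?w w" for i by (auto simp: indicator_def)
  have L1: "(\<lambda>i. integral\<^sup>L lborel (?s i)) \<longlonglongrightarrow> integral\<^sup>L lborel ?f"
    by (rule integral_dominated_convergence[OF m i lim bd])
  have sv: "integral\<^sup>L lborel (?s i) = (1 - exp (- b * of_real (real i))) / b" for i
    using has_bochner_integral_exp_Icc[OF b0, of "real i"] by (simp add: has_bochner_integral_iff)
  have L2: "(\<lambda>i. (1 - exp (- b * of_real (real i))) / b) \<longlonglongrightarrow> (1 - 0) / b"
  proof (intro tendsto_intros)
    have "(\<lambda>i. exp (- Re b * real i)) \<longlonglongrightarrow> 0" using b by real_asymp
    then have "(\<lambda>i. norm (exp (- b * of_real (real i)))) \<longlonglongrightarrow> 0" by simp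
    then show "(\<lambda>i. exp (- b * of_real (real i))) \<longlonglongrightarrow> 0" by (rule tendsto_norm_zero_cancel)
  qed (rule b0)
  have "integral\<^sup>L lborel ?f = 1 / b" using LIMSEQ_unique[OF L1[unfolded sv] L2] by simp
  moreover have "integrable lborel ?f"
    by (rule integrable_dominated_convergence[OF m i lim bd])
  ultimately show ?thesis by (simp add: has_bochner_integral_iff)
qed

section \<open>The kernel \<open>gk\<close> and the Laplace transform of its differences\<close>

text \<open>Written in the shape in which it arises, as the sum of the geometric series of (-1)^k
  exp(-\<open>hf k\<close> w) for w > 0.\<close>

definition gk :: "real \<Rightarrow> real" where "gk w = exp (- w / 2) / (1 + exp (- w))"

definition gk_gap :: "real \<Rightarrow> real \<Rightarrow> real" where "gk_gap l w = gk \<bar>l - w\<bar> - gk (l + w)"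

definition gk_laplace :: "real \<Rightarrow> complex \<Rightarrow> complex" where
  "gk_laplace l z = (LINT w|lborel. indicator {0..} w *\<^sub>R (exp (- z * of_real w) * of_real (gk_gap l w)))"

text \<open>With A = exp(-a/2) and B = exp(-b/2) the difference factors as
  (A-B)(1-AB)/((1+A^2)(1+B^2)), which shows its sign and bounds it by A - B.\<close>

lemma gk_diff_bounds:
  assumes ab: "0 \<le> a" "a \<le> b"
  shows "0 \<le> gk a - gk b" "gk a - gk b \<le> (b - a) / 2 * exp (- a / 2)"
proof -
  define A B where "A = exp (- a / 2)" and "B = exp (- b / 2)"
  have AB: "0 < B" "B \<le> A" "A \<le> 1" using ab by (auto simp: A_def B_def)
  have sq: "exp (- a) = A\<^sup>2" "exp (- b) = B\<^sup>2" by (simp_all add: A_def B_def exp_double[symmetric])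
  have p: "1 + A\<^sup>2 > 0" "1 + B\<^sup>2 > 0" "(1 + A\<^sup>2) * (1 + B\<^sup>2) \<ge> 1"
    by (auto simp: add_pos_nonneg algebra_simps)
  have e: "gk a - gk b = (A - B) * (1 - A * B) / ((1 + A\<^sup>2) * (1 + B\<^sup>2))"
    unfolding gk_def A_def[symmetric] B_def[symmetric] sq using p by (simp add: field_simps power2_eq_square)
  have "A * B \<le> 1" using AB by (simp add: mult_le_one)
  then have n: "(A - B) * (1 - A * B) \<ge> 0" using AB by (intro mult_nonneg_nonneg) auto
  then show "0 \<le> gk a - gk b" unfolding e using p by (intro divide_nonneg_nonneg) auto
  have "gk a - gk b \<le> (A - B) * (1 - A * B) / 1"
    unfolding e using n p by (intro divide_left_mono) auto
  also have "\<dots> \<le> (A - B) * 1" using AB by (simp add: mult_left_le)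
  also have "A - B = A * (1 - exp (- ((b - a) / 2)))"
    by (simp add: A_def B_def algebra_simps exp_add[symmetric] diff_divide_distrib)
  also have "\<dots> * 1 \<le> A * ((b - a) / 2)"
  proof -
    have "1 - exp (- ((b - a) / 2)) \<le> (b - a) / 2" using exp_ge_add_one_self[of "- ((b - a) / 2)"] by linarith
    then show ?thesis using AB by (simp only: mult_1_right) (intro mult_left_mono, auto)
  qed
  finally show "gk a - gk b \<le> (b - a) / 2 * exp (- a / 2)" by (simp add: A_def mult.commute)
qed

text \<open>Half the distance between the arguments |l-w| and l+w is min(l, w). Estimating the
  minimum by l yields smallness for small l; estimating it by w yields a decay of the Laplace
  transform that is uniform in l.\<close>

lemma gk_gap_bounds:
  assumes "0 \<le> l" "0 \<le> w"
  shows "0 \<le> gk_gap l w" "gk_gap l w \<le> l * exp (- \<bar>l - w\<bar> / 2)" "gk_gap l w \<le> w"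
proof -
  note g = gk_diff_bounds[of "\<bar>l - w\<bar>" "l + w"]
  show "0 \<le> gk_gap l w" unfolding gk_gap_def using g(1) assms by auto
  have e: "gk_gap l w \<le> (l + w - \<bar>l - w\<bar>) / 2 * exp (- \<bar>l - w\<bar> / 2)"
    unfolding gk_gap_def using g(2) assms by auto
  have "(l + w - \<bar>l - w\<bar>) / 2 * exp (- \<bar>l - w\<bar> / 2) \<le> l * exp (- \<bar>l - w\<bar> / 2)"
    using assms by (intro mult_right_mono) auto
  with e show "gk_gap l w \<le> l * exp (- \<bar>l - w\<bar> / 2)" by linarith
  have "(l + w - \<bar>l - w\<bar>) / 2 * exp (- \<bar>l - w\<bar> / 2) \<le> w * 1"
    using assms by (intro mult_mono) auto
  with e show "gk_gap l w \<le> w" by linarith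
qed

lemma gk_partial_sum:
  "(\<Sum>k<N. (-1) ^ k * exp (- hf k * x)) = gk x * (1 - (- exp (- x)) ^ N)"
proof -
  have "(\<Sum>k<N. (-1) ^ k * exp (- hf k * x)) = exp (- x / 2) * (\<Sum>k<N. (- exp (- x)) ^ k)"
    unfolding sum_distrib_left
  proof (rule sum.cong)
    fix k
    have "exp (- hf k * x) = exp (- x / 2) * exp (- x) ^ k"
      by (simp add: exp_of_nat_mult[symmetric] exp_add[symmetric] hf_def algebra_simps)
    then show "(-1) ^ k * exp (- hf k * x) = exp (- x / 2) * (- exp (- x)) ^ k"
      by (simp add: power_minus[of "exp (-x)"])
  qed simp
  also have "(\<Sum>k<N. (- exp (- x)) ^ k) = (1 - (- exp (- x)) ^ N) / (1 + exp (- x))"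
  proof -
    have "- exp (- x) \<noteq> 1" using exp_gt_zero[of "- x"] by linarith
    then show ?thesis by (simp add: sum_gp_strict)
  qed
  finally show ?thesis by (simp add: gk_def)
qed

lemma gk_partial_sum_bound:
  assumes "x \<ge> 0"
  shows "\<bar>\<Sum>k<N. (-1) ^ k * exp (- hf k * x)\<bar> \<le> 2 * exp (- x / 2)"
proof -
  have "\<bar>(- exp (- x)) ^ N\<bar> \<le> 1" using assms by (simp add: power_abs power_le_one)
  then have "\<bar>1 - (- exp (- x)) ^ N\<bar> \<le> 2" by linarith
  moreover have "0 \<le> gk x" unfolding gk_def by (intro divide_nonneg_nonneg) (auto simp: add_nonneg_nonneg)
  moreover have "gk x \<le> exp (- x / 2) / 1" unfolding gk_def by (rule frac_le) auto
  ultimately have "gk x * \<bar>1 - (- exp (- x)) ^ N\<bar> \<le> exp (- x / 2) * 2" by (intro mult_mono) auto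
  then show ?thesis unfolding gk_partial_sum abs_mult using \<open>0 \<le> gk x\<close> by simp
qed

lemma gk_partial_sum_LIMSEQ:
  assumes "x > 0"
  shows "(\<lambda>N. \<Sum>k<N. (-1) ^ k * exp (- hf k * x)) \<longlonglongrightarrow> gk x"
proof -
  have "(\<lambda>N. gk x * (1 - (- exp (- x)) ^ N)) \<longlonglongrightarrow> gk x * (1 - 0)"
    using assms by (intro tendsto_intros LIMSEQ_power_zero) auto
  then show ?thesis unfolding gk_partial_sum by simp
qed

text \<open>One term of the geometric series. With m = \<open>hf k\<close> the Laplace transform is
  (exp(-l z) - exp(-l m)) (1/(m-z) + 1/(m+z)), whose second factor is the one in
  \<open>sinc_pair\<close>. At z = m both sides vanish: the cosine is 0, and so is the difference of
  exponentials.\<close>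

lemma exp_gap_sinc_pair:
  assumes l: "l > 0" and z: "Re z \<ge> 0"
  shows "has_bochner_integral lborel
     (\<lambda>w. cos (of_real pi * z) / of_real pi * (indicator {0..} w *\<^sub>R (exp (- z * of_real w) *
        of_real ((-1) ^ k * exp (- hf k * \<bar>l - w\<bar>) - (-1) ^ k * exp (- hf k * (l + w))))))
     ((exp (- of_real l * z) - of_real (exp (- l * hf k))) * sinc_pair k z)"
proof (cases "z = of_real (hf k)")
  case True
  have "cos (of_real pi * z) = of_real (cos (pi * hf k))" unfolding True by (metis cos_of_real of_real_mult)
  also have "cos (pi * hf k) = 0"
  proof -
    have "pi * hf k = real k * pi + pi / 2" by (simp add: hf_def algebra_simps)
    then show ?thesis by (simp add: cos_add)
  qed
  finally have "cos (of_real pi * z) = 0" by simp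
  moreover have "exp (- of_real l * z) - of_real (exp (- l * hf k)) = 0"
    unfolding True by (simp add: exp_of_real[symmetric])
  ultimately show ?thesis by (simp add: has_bochner_integral_zero)
next
  case False
  define m :: complex where "m = of_real (hf k)"
  have ne: "z - m \<noteq> 0" using False by (simp add: m_def)
  have "Re (z + m) > 0" using z hf_pos[of k] by (simp add: m_def del: hf_pos)
  then have ne2: "z + m \<noteq> 0" by (metis less_irrefl zero_complex.sel(1))
  then have zne: "z \<noteq> of_real (hf k)" "z \<noteq> - of_real (hf k)" using False by (auto simp: m_def)
  note i1 = has_bochner_integral_mult_right[OF has_bochner_integral_exp_Icc[OF ne, of l], of "exp (- m * of_real l)"]
  note i2 = has_bochner_integral_mult_right[OF has_bochner_integral_exp_Icc[OF ne2, of l], of "exp (m * of_real l)"]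
  note i3 = has_bochner_integral_mult_right[OF has_bochner_integral_exp_Ici[OF \<open>Re (z + m) > 0\<close>], of "exp (m * of_real l)"]
  note i4 = has_bochner_integral_mult_right[OF has_bochner_integral_exp_Ici[OF \<open>Re (z + m) > 0\<close>], of "exp (- m * of_real l)"]
  define E where "E = (\<lambda>w. indicator {0..} w *\<^sub>R (exp (- z * of_real w) * of_real (exp (- hf k * \<bar>l - w\<bar>) - exp (- hf k * (l + w)))))"
  have "has_bochner_integral lborel E
     (exp (- m * of_real l) * ((1 - exp (- (z - m) * of_real l)) / (z - m))
      - exp (m * of_real l) * ((1 - exp (- (z + m) * of_real l)) / (z + m))
      + exp (m * of_real l) * (1 / (z + m)) - exp (- m * of_real l) * (1 / (z + m)))"
    (is "has_bochner_integral _ _ ?v")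
  proof -
    have "exp (- m * of_real l) * (indicator {0..l} w *\<^sub>R exp (- (z - m) * of_real w))
      - exp (m * of_real l) * (indicator {0..l} w *\<^sub>R exp (- (z + m) * of_real w))
      + exp (m * of_real l) * (indicator {0..} w *\<^sub>R exp (- (z + m) * of_real w))
      - exp (- m * of_real l) * (indicator {0..} w *\<^sub>R exp (- (z + m) * of_real w)) = E w" for w
    proof -
      have a: "exp (- z * of_real w) * of_real (exp (- hf k * (l - w))) = exp (- m * of_real l) * exp (- (z - m) * of_real w)"
        "exp (- z * of_real w) * of_real (exp (- hf k * (w - l))) = exp (m * of_real l) * exp (- (z + m) * of_real w)"
        "exp (- z * of_real w) * of_real (exp (- hf k * (l + w))) = exp (- m * of_real l) * exp (- (z + m) * of_real w)"
        by (simp_all add: m_def exp_of_real[symmetric] exp_add[symmetric] algebra_simps)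
      consider "w < 0" | "0 \<le> w" "w \<le> l" | "0 \<le> w" "w > l" by linarith
      then show ?thesis
      proof cases
        case 2
        then have "\<bar>l - w\<bar> = l - w" by simp
        then show ?thesis using 2 unfolding E_def of_real_diff right_diff_distrib[of "exp (- z * of_real w)"] by (simp only: a) simp
      next
        case 3
        then have "\<bar>l - w\<bar> = w - l" by simp
        then show ?thesis using 3 unfolding E_def of_real_diff right_diff_distrib[of "exp (- z * of_real w)"] by (simp only: a) simp
      qed (simp add: E_def)
    qed
    with has_bochner_integral_diff[OF has_bochner_integral_add[OF has_bochner_integral_diff[OF i1 i2] i3] i4] l
    show ?thesis by simp
  qed
  moreover have "?v = (exp (- of_real l * z) - exp (- m * of_real l)) * (1 / (m - z) + 1 / (m + z))"
  proof -
    have e: "exp (- m * of_real l) * exp (- (z - m) * of_real l) = exp (- of_real l * z)"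
      "exp (m * of_real l) * exp (- (z + m) * of_real l) = exp (- of_real l * z)"
      by (simp_all add: exp_add[symmetric] algebra_simps)
    have "a * ((1 - c) / (z - m)) - b * ((1 - d) / (z + m)) + b * (1 / (z + m)) - a * (1 / (z + m))
      = (x - a) * (1 / (m - z) + 1 / (m + z))" if "a * c = x" "b * d = x" for a b c d x
    proof -
      have "a * (1 - c) = a - x" "b * (1 - d) = b - x" using that by (auto simp: algebra_simps)
      then have "a * ((1 - c) / (z - m)) = (a - x) / (z - m)" "b * ((1 - d) / (z + m)) = (b - x) / (z + m)"
        by (metis times_divide_eq_right)+
      moreover have "(a - x) / (z - m) = (x - a) / (m - z)" by (metis minus_diff_eq minus_divide_divide)
      moreover have "m + z = z + m" by simp
      moreover have "(x - a) / q - (b - x) / p + b * (1 / p) - a * (1 / p) = (x - a) * (1 / q + 1 / p)" for p q :: complex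
        by (simp add: diff_divide_distrib ring_distribs)
      ultimately show ?thesis by (simp only:)
    qed
    from this[OF e] show ?thesis .
  qed
  ultimately have "has_bochner_integral lborel E ((exp (- of_real l * z) - exp (- m * of_real l)) * (1 / (m - z) + 1 / (m + z)))"
    by simp
  from has_bochner_integral_mult_right[OF this, of "cos (of_real pi * z) / of_real pi * (-1) ^ k"]
  have "has_bochner_integral lborel (\<lambda>w. cos (of_real pi * z) / of_real pi * (-1) ^ k * E w)
    (cos (of_real pi * z) / of_real pi * (-1) ^ k * ((exp (- of_real l * z) - exp (- m * of_real l)) * (1 / (m - z) + 1 / (m + z))))"
    by simp
  moreover have "exp (- m * of_real l) = of_real (exp (- l * hf k))"
    by (simp add: m_def exp_of_real[symmetric] mult.commute)
  moreover have "cos (of_real pi * z) / of_real pi * (-1) ^ k * E w = cos (of_real pi * z) / of_real pi * (indicator {0..} w *\<^sub>R (exp (- z * of_real w) *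
        of_real ((-1) ^ k * exp (- hf k * \<bar>l - w\<bar>) - (-1) ^ k * exp (- hf k * (l + w)))))" for w
    by (simp add: E_def algebra_simps)
  ultimately show ?thesis unfolding sinc_pair_eq[OF zne] m_def[symmetric]
    by (simp only: mult_ac)
qed

lemma has_bochner_integral_exp_Ici_real:
  assumes b: "(b::real) > 0"
  shows "has_bochner_integral lborel (\<lambda>w. indicator {0..} w *\<^sub>R exp (- b * w)) (1 / b)"
proof -
  have "has_bochner_integral lborel (\<lambda>w. Re (indicator {0..} w *\<^sub>R exp (- of_real b * of_real w))) (Re (1 / of_real b))"
    using b by (intro has_bochner_integral_bounded_linear[OF bounded_linear_Re] has_bochner_integral_exp_Ici) simp
  moreover have "Re (indicator {0..} w *\<^sub>R exp (- of_real b * of_real w)) = indicator {0..} w *\<^sub>R exp (- b * w)" for w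
    by (simp add: Re_exp)
  moreover have "Re (1 / of_real b) = 1 / b" by (simp add: Re_divide_of_real)
  ultimately show ?thesis by (simp only:)
qed

lemma has_bochner_integral_exp_Icc_real:
  assumes b: "(b::real) > 0" and l: "l \<ge> 0"
  shows "has_bochner_integral lborel (\<lambda>w. indicator {0..l} w *\<^sub>R exp (- b * w)) ((1 - exp (- b * l)) / b)"
proof -
  have "has_bochner_integral lborel (\<lambda>w. Re (indicator {0..l} w *\<^sub>R exp (- of_real b * of_real w))) (Re ((1 - exp (- of_real b * of_real l)) / of_real b))"
    using b l by (intro has_bochner_integral_bounded_linear[OF bounded_linear_Re] has_bochner_integral_exp_Icc) auto
  moreover have "Re (indicator {0..l} w *\<^sub>R exp (- of_real b * of_real w)) = indicator {0..l} w *\<^sub>R exp (- b * w)" for w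
    by (simp add: Re_exp)
  moreover have "Re ((1 - exp (- of_real b * of_real l)) / of_real b) = (1 - exp (- b * l)) / b"
    by (simp add: Re_divide_of_real Re_exp)
  ultimately show ?thesis by (simp only:)
qed

lemma gk_measurable [measurable]: "gk \<in> borel_measurable borel" "gk_gap l \<in> borel_measurable borel"
  unfolding gk_gap_def[abs_def] gk_def[abs_def] by measurable

text \<open>The dominating function, uniform in N: each alternating geometric partial sum is at most
  twice its leading exponential, and |l-w| >= w - l.\<close>

lemma gk_partial_gap_bound:
  assumes "l > 0" "w \<ge> 0"
  shows "\<bar>(\<Sum>k<N. (-1) ^ k * exp (- hf k * \<bar>l - w\<bar>)) - (\<Sum>k<N. (-1) ^ k * exp (- hf k * (l + w)))\<bar>
    \<le> 4 * exp (l / 2) * exp (- (1/2) * w)"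
proof -
  have "exp (- \<bar>l - w\<bar> / 2) \<le> exp (l / 2 + (- (1/2) * w))" "exp (- (l + w) / 2) \<le> exp (l / 2 + (- (1/2) * w))"
    using assms abs_ge_self[of "w - l"] unfolding exp_le_cancel_iff abs_minus_commute[of l w]
    by (simp_all add: field_simps)
  moreover have "\<bar>\<Sum>k<N. (-1) ^ k * exp (- hf k * \<bar>l - w\<bar>)\<bar> \<le> 2 * exp (- \<bar>l - w\<bar> / 2)"
    "\<bar>\<Sum>k<N. (-1) ^ k * exp (- hf k * (l + w))\<bar> \<le> 2 * exp (- (l + w) / 2)"
    using assms by (intro gk_partial_sum_bound; simp)+
  moreover have "exp (l / 2 + (- (1/2) * w)) = exp (l / 2) * exp (- (1/2) * w)" by (rule exp_add)
  ultimately show ?thesis by linarith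
qed

text \<open>Integrating the geometric series under the Laplace transform reproduces the partial fractions
  of secant and of \<^term>\<open>K_lam l\<close>.\<close>

lemma exp_minus_K_lam_eq:
  assumes l: "l > 0" and z: "Re z \<ge> 0"
  shows "exp (- of_real l * z) - K_lam l z = cos (of_real pi * z) / of_real pi * gk_laplace l z"
proof -
  define Z where "Z = cos (of_real pi * z) / of_real pi"
  define P where "P = (\<lambda>N w. (\<Sum>k<N. (-1) ^ k * exp (- hf k * \<bar>l - w\<bar>)) - (\<Sum>k<N. (-1) ^ k * exp (- hf k * (l + w))))"
  define f where "f = (\<lambda>N w. Z * (indicator {0..} w *\<^sub>R (exp (- z * of_real w) * of_real (P N w))))"
  define F where "F = (\<lambda>w. Z * (indicator {0..} w *\<^sub>R (exp (- z * of_real w) * of_real (gk_gap l w))))"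
  have fN: "has_bochner_integral lborel (f N) (\<Sum>k<N. (exp (- of_real l * z) - of_real (exp (- l * hf k))) * sinc_pair k z)" for N
  proof -
    have "f N = (\<lambda>w. \<Sum>k<N. Z * (indicator {0..} w *\<^sub>R (exp (- z * of_real w) *
        of_real ((-1) ^ k * exp (- hf k * \<bar>l - w\<bar>) - (-1) ^ k * exp (- hf k * (l + w))))))"
      unfolding f_def P_def by (simp add: sum_distrib_left scaleR_sum_right sum_subtractf[symmetric])
    then show ?thesis unfolding Z_def
      by (simp only:) (intro has_bochner_integral_sum exp_gap_sinc_pair l z)
  qed
  have [measurable]: "P N \<in> borel_measurable borel" for N unfolding P_def by measurable
  have meas: "f N \<in> borel_measurable lborel" "F \<in> borel_measurable lborel" for N unfolding f_def F_def by measurable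
  have "(\<lambda>N. integral\<^sup>L lborel (f N)) \<longlonglongrightarrow> integral\<^sup>L lborel F"
  proof (rule integral_dominated_convergence[where w = "\<lambda>w. norm Z * (4 * exp (l / 2)) * (indicator {0..} w *\<^sub>R exp (- (1/2) * w))"])
    show "integrable lborel (\<lambda>w. norm Z * (4 * exp (l / 2)) * (indicator {0..} w *\<^sub>R exp (- (1/2) * w)))"
      by (intro integrable_mult_right integrable_exp_Ici) simp
    show "AE w in lborel. norm (f N w) \<le> norm Z * (4 * exp (l / 2)) * (indicator {0..} w *\<^sub>R exp (- (1/2) * w))" for N
    proof (rule AE_I2)
      fix w :: real
      show "norm (f N w) \<le> norm Z * (4 * exp (l / 2)) * (indicator {0..} w *\<^sub>R exp (- (1/2) * w))"
      proof (cases "w \<ge> 0")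
        case True
        have "norm (exp (- z * of_real w)) \<le> 1" using True z by simp
        moreover have "\<bar>P N w\<bar> \<le> 4 * exp (l / 2) * exp (- (1/2) * w)"
          unfolding P_def by (rule gk_partial_gap_bound[OF l True])
        ultimately have "norm (exp (- z * of_real w)) * \<bar>P N w\<bar> \<le> 1 * (4 * exp (l / 2) * exp (- (1/2) * w))"
          by (intro mult_mono) auto
        then have "norm Z * (norm (exp (- z * of_real w)) * \<bar>P N w\<bar>) \<le> norm Z * (1 * (4 * exp (l / 2) * exp (- (1/2) * w)))"
          by (rule mult_left_mono) simp
        then show ?thesis using True by (simp add: f_def norm_mult mult.assoc)
      qed (simp add: f_def)
    qed
    \<comment> \<open>The point w = l is discarded: there |l-w| = 0 and the series of (-1)^k
      diverges.\<close>
    show "AE w in lborel. (\<lambda>N. f N w) \<longlonglongrightarrow> F w"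
      using AE_lborel_singleton[of l]
    proof eventually_elim
      case (elim w)
      show ?case
      proof (cases "w \<ge> 0")
        case True
        have "(\<lambda>N. P N w) \<longlonglongrightarrow> gk_gap l w"
          unfolding P_def gk_gap_def using l True elim by (intro tendsto_intros gk_partial_sum_LIMSEQ) auto
        then show ?thesis unfolding f_def F_def by (intro tendsto_intros)
      qed (simp add: f_def F_def)
    qed
  qed (rule meas)+
  then have L1: "(\<lambda>N. \<Sum>k<N. (exp (- of_real l * z) - of_real (exp (- l * hf k))) * sinc_pair k z) \<longlonglongrightarrow> integral\<^sup>L lborel F"
    using fN by (simp add: has_bochner_integral_iff)
  \<comment> \<open>exp(-l z) is written as itself times the series summing to 1.\<close>
  have "(\<lambda>k. exp (- of_real l * z) * sinc_pair k z - of_real (exp (- l * hf k)) * sinc_pair k z) sums (exp (- of_real l * z) * 1 - K_lam l z)"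
    unfolding K_lam_eq[OF l]
    by (rule sums_diff[OF sums_mult[OF sinc_pair_sums_1] summable_sums[OF summable_norm_cancel[OF K_lam_summable_norm[OF l]]]])
  then have L2: "(\<lambda>N. \<Sum>k<N. (exp (- of_real l * z) - of_real (exp (- l * hf k))) * sinc_pair k z) \<longlonglongrightarrow> exp (- of_real l * z) - K_lam l z"
    by (simp add: sums_def left_diff_distrib)
  have "integral\<^sup>L lborel F = Z * gk_laplace l z"
    unfolding F_def gk_laplace_def by (rule integral_mult_right_zero)
  with LIMSEQ_unique[OF L2 L1] show ?thesis unfolding Z_def by (simp only:)
qed

text \<open>The difference of kernels is at most l exp(l/2) exp(-w/2), with integral 2 l exp(l/2),
  and exp(1/2) <= 2. The factor l compensates a possibly infinite mass of the measure near
  0.\<close>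

lemma norm_gk_laplace_le:
  assumes l: "0 < l" "l \<le> 1" and z: "Re z \<ge> 0"
  shows "norm (gk_laplace l z) \<le> 4 * l"
proof -
  let ?f = "\<lambda>w. indicator {0..} w *\<^sub>R (exp (- z * of_real w) * of_real (gk_gap l w))"
  let ?b = "\<lambda>w. l * exp (l / 2) * (indicator {0..} w *\<^sub>R exp (- (1/2) * w))"
  have bd: "norm (?f w) \<le> ?b w" for w
  proof (cases "w \<ge> 0")
    case True
    have g: "\<bar>gk_gap l w\<bar> \<le> l * exp (- \<bar>l - w\<bar> / 2)" using gk_gap_bounds[of l w] True l by simp
    have "exp (- \<bar>l - w\<bar> / 2) \<le> exp (l / 2 + (- (1/2) * w))" using abs_ge_self[of "w - l"] unfolding exp_le_cancel_iff abs_minus_commute[of l w] by (simp add: field_simps)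
    then have "l * exp (- \<bar>l - w\<bar> / 2) \<le> l * (exp (l / 2) * exp (- (1/2) * w))" using l by (simp only: exp_add) simp
    with g have "\<bar>gk_gap l w\<bar> \<le> l * (exp (l / 2) * exp (- (1/2) * w))" by linarith
    then have "norm (exp (- z * of_real w)) * \<bar>gk_gap l w\<bar> \<le> 1 * (l * (exp (l / 2) * exp (- (1/2) * w)))"
      using True z by (intro mult_mono) auto
    then show ?thesis using True by (simp add: norm_mult mult.assoc)
  qed simp
  have i: "has_bochner_integral lborel ?b (l * exp (l / 2) * (1 / (1/2)))"
    by (intro has_bochner_integral_mult_right has_bochner_integral_exp_Ici_real) simp
  have ib: "integrable lborel ?b" using i by (simp add: has_bochner_integral_iff)
  have "integrable lborel ?f"
  proof (rule Bochner_Integration.integrable_bound[OF ib])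
    show "AE w in lborel. norm (?f w) \<le> norm (?b w)"
      by (intro AE_I2 order_trans[OF bd]) (simp only: real_norm_def abs_ge_self)
  qed simp
  have "norm (gk_laplace l z) \<le> (LINT w|lborel. norm (?f w))"
    unfolding gk_laplace_def by (rule integral_norm_bound)
  also have "\<dots> \<le> (LINT w|lborel. ?b w)"
    by (rule integral_mono[OF integrable_norm[OF \<open>integrable lborel ?f\<close>] ib bd])
  also have "\<dots> = 2 * l * exp (l / 2)" using i by (simp add: has_bochner_integral_iff)
  also have "\<dots> \<le> 2 * l * 2"
  proof (intro mult_left_mono)
    have "exp (l / 2) ^ 2 \<le> 2 ^ 2" using l exp_le order_trans[of "exp l" "exp 1" 4] by (simp add: exp_double[symmetric])
    then show "exp (l / 2) \<le> 2" by (rule power2_le_imp_le) simp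
  qed (use l in auto)
  finally show ?thesis by simp
qed

text \<open>Nonnegativity is that of the difference of kernels. For the decay, w is absorbed by half
  of the exponential, w <= (2/x) exp(x w/2), and the remaining integral is 2/x; no dependence on l
  survives.\<close>

lemma gk_laplace_real:
  assumes l: "0 < l" and x: "x \<ge> 0"
  obtains r where "r \<ge> 0" "x > 0 \<Longrightarrow> r \<le> 4 / x\<^sup>2" "gk_laplace l (of_real x) = of_real r"
proof
  let ?f = "\<lambda>w. indicator {0..} w *\<^sub>R (exp (- x * w) * gk_gap l w)"
  define r where "r = (LINT w|lborel. ?f w)"
  show "r \<ge> 0" unfolding r_def
    by (rule integral_nonneg_AE) (use gk_gap_bounds(1)[of l] l in \<open>auto simp: indicator_def\<close>)
  have "gk_laplace l (of_real x) = (LINT w|lborel. of_real (?f w))"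
    unfolding gk_laplace_def by (intro Bochner_Integration.integral_cong) (auto simp: indicator_def exp_of_real[symmetric])
  then show "gk_laplace l (of_real x) = of_real r" unfolding r_def by (simp only: integral_complex_of_real)
  show "r \<le> 4 / x\<^sup>2" if "x > 0"
  proof -
    let ?b = "\<lambda>w. 2 / x * (indicator {0..} w *\<^sub>R exp (- (x / 2) * w))"
    have i: "has_bochner_integral lborel ?b (2 / x * (1 / (x / 2)))"
      using that by (intro has_bochner_integral_mult_right has_bochner_integral_exp_Ici_real) simp
    have bd: "norm (?f w) \<le> ?b w" for w
    proof (cases "w \<ge> 0")
      case True
      have "x * w / 2 \<le> exp (x * w / 2)" using exp_ge_add_one_self[of "x * w / 2"] by linarith
      then have "w \<le> 2 / x * exp (x * w / 2)" using that by (simp add: field_simps)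
      then have "\<bar>gk_gap l w\<bar> \<le> 2 / x * exp (x * w / 2)" using gk_gap_bounds[of l w] l True by simp
      then have "exp (- x * w) * \<bar>gk_gap l w\<bar> \<le> exp (- x * w) * (2 / x * exp (x * w / 2))" by (intro mult_left_mono) auto
      also have "\<dots> = 2 / x * (exp (- x * w) * exp (x * w / 2))" by simp
      also have "exp (- x * w) * exp (x * w / 2) = exp (- (x / 2) * w)" by (simp add: exp_add[symmetric])
      finally show ?thesis using True by (simp add: abs_mult)
    qed simp
    have "r \<le> (LINT w|lborel. ?b w)" unfolding r_def
    proof (rule integral_mono)
      show ib: "integrable lborel ?b" using i by (simp add: has_bochner_integral_iff)
      show "integrable lborel ?f"
      proof (rule Bochner_Integration.integrable_bound[OF ib])
        show "AE w in lborel. norm (?f w) \<le> norm (?b w)"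
          by (intro AE_I2 order_trans[OF bd]) (simp only: real_norm_def abs_ge_self)
      qed simp
      show "?f w \<le> ?b w" for w using bd[of w] by (simp add: abs_le_iff)
    qed
    also have "\<dots> = 4 / x\<^sup>2" using i by (simp add: has_bochner_integral_iff power2_eq_square)
    finally show ?thesis .
  qed
qed

lemma K_lam_minus:
  assumes "l > 0" shows "K_lam l (- z) = K_lam l z"
  using assms by (simp add: K_lam_eq sinc_pair_minus)

text \<open>Evenness of both functions reduces to |x|, where the Laplace formula applies. Division
  by pi >= 2 turns 4/x^2 into 2/x^2.\<close>

lemma exp_minus_K_lam_real:
  assumes l: "0 < l"
  obtains r where "r \<ge> 0" "x \<noteq> 0 \<Longrightarrow> r \<le> 2 / x\<^sup>2" "K_lam l (of_real x) = of_real (exp (- l * \<bar>x\<bar>) - cos (pi * x) * r)"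
proof -
  obtain r where r: "r \<ge> 0" "\<bar>x\<bar> > 0 \<Longrightarrow> r \<le> 4 / \<bar>x\<bar>\<^sup>2" "gk_laplace l (of_real \<bar>x\<bar>) = of_real r"
    using gk_laplace_real[OF l, of "\<bar>x\<bar>"] by auto
  have "K_lam l (of_real x) = K_lam l (of_real \<bar>x\<bar>)"
    using K_lam_minus[OF l, of "of_real x"] by (auto simp: abs_if)
  also have "\<dots> = exp (- of_real l * of_real \<bar>x\<bar>) - cos (of_real pi * of_real \<bar>x\<bar>) / of_real pi * gk_laplace l (of_real \<bar>x\<bar>)"
    using exp_minus_K_lam_eq[OF l, of "of_real \<bar>x\<bar>"] by (simp add: algebra_simps)
  also have "exp (- of_real l * of_real \<bar>x\<bar>) = complex_of_real (exp (- l * \<bar>x\<bar>))" by (simp add: exp_of_real[symmetric])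
  also have "cos (of_real pi * of_real \<bar>x\<bar>) = complex_of_real (cos (pi * \<bar>x\<bar>))" by (metis cos_of_real of_real_mult)
  also have "cos (pi * \<bar>x\<bar>) = cos (pi * x)" by (cases "x \<ge> 0") auto
  finally have "K_lam l (of_real x) = of_real (exp (- l * \<bar>x\<bar>) - cos (pi * x) * (r / pi))"
    unfolding r(3) by simp
  moreover have "r / pi \<ge> 0" using r by simp
  moreover have "r / pi \<le> 2 / x\<^sup>2" if "x \<noteq> 0"
  proof -
    have "r / pi \<le> (4 / x\<^sup>2) / 2" using r that pi_gt3 by (intro frac_le) auto
    then show ?thesis by simp
  qed
  ultimately show ?thesis using that by blast
qed

section \<open>Exponential type and growth of the kernels\<close>

text \<open>A linear factor does not affect the type, since 1 + |z| <= (1 + 1/\<epsilon>)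
  exp(\<epsilon> |z|).\<close>

lemma exp_type_leI:
  assumes hol: "K holomorphic_on UNIV" and s: "\<sigma> \<ge> 0" and C: "C \<ge> 0"
    and bd: "\<And>z. norm (K z) \<le> C * (1 + norm z) * exp (\<sigma> * norm z)"
  shows "exp_type_le K \<sigma>"
  unfolding exp_type_le_def
proof (intro conjI hol allI impI exI)
  fix \<epsilon> :: real and z :: complex assume e: "\<epsilon> > 0"
  have "\<epsilon> * norm z \<le> exp (\<epsilon> * norm z)" using exp_ge_add_one_self[of "\<epsilon> * norm z"] by linarith
  then have "norm z \<le> 1 / \<epsilon> * exp (\<epsilon> * norm z)" using e by (simp add: field_simps)
  moreover have "1 \<le> exp (\<epsilon> * norm z)" using e by simp
  ultimately have "1 + norm z \<le> (1 + 1 / \<epsilon>) * exp (\<epsilon> * norm z)" unfolding distrib_right by linarith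
  then have "C * (1 + norm z) * exp (\<sigma> * norm z) \<le> C * ((1 + 1 / \<epsilon>) * exp (\<epsilon> * norm z)) * exp (\<sigma> * norm z)"
    using C by (intro mult_right_mono mult_left_mono) auto
  also have "\<dots> = C * (1 + 1 / \<epsilon>) * exp ((\<sigma> + \<epsilon>) * norm z)"
  proof -
    have "exp ((\<sigma> + \<epsilon>) * norm z) = exp (\<sigma> * norm z) * exp (\<epsilon> * norm z)" by (simp add: distrib_right exp_add)
    then show ?thesis by (simp only: mult_ac)
  qed
  finally show "norm (K z) \<le> C * (1 + 1 / \<epsilon>) * exp ((\<sigma> + \<epsilon>) * norm z)" using bd[of z] by linarith
qed

lemma K_lam_holomorphic:
  assumes l: "l > 0" shows "K_lam l holomorphic_on UNIV"
proof -
  have b: "\<bar>exp (- l * hf k)\<bar> \<le> 2 * hf k" for k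
  proof -
    have "exp (- l * hf k) \<le> 1" using l by simp
    moreover have "1 \<le> 2 * hf k" using hf_ge_half[of k] by linarith
    ultimately show ?thesis unfolding abs_exp_cancel by linarith
  qed
  have "summable (\<lambda>k. (-1) ^ k * (exp (- l * hf k) / hf k))"
  proof (rule summable_comparison_test')
    show "summable (\<lambda>k. 2 * exp (- l * hf k))" by (intro summable_mult exp_hf_summable l)
    show "norm ((-1) ^ k * (exp (- l * hf k) / hf k)) \<le> 2 * exp (- l * hf k)" for k
    proof -
      have "exp (- l * hf k) / hf k \<le> exp (- l * hf k) / (1/2)" by (intro divide_left_mono hf_ge_half) auto
      then show ?thesis by (simp add: abs_mult)
    qed
  qed
  note hol = sinc_series_holomorphic[OF b this]
  have "K_lam l = (\<lambda>z. \<Sum>k. of_real (exp (- l * hf k)) * sinc_pair k z)"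
    by (rule ext) (rule K_lam_eq[OF l])
  then show ?thesis using hol by (simp only:)
qed

text \<open>A termwise estimate without cancellation. It degenerates like 1/l as l tends to 0, so it
  serves for l >= 1 or for one fixed l.\<close>

lemma norm_K_lam_le:
  assumes l: "l > 0"
  shows "norm (K_lam l z) \<le> 2 * exp (pi * \<bar>Im z\<bar>) * (exp (- l / 2) / (1 - exp (- l)))"
proof -
  have "norm (K_lam l z) \<le> (\<Sum>k. norm (of_real (exp (- l * hf k)) * sinc_pair k z))"
    unfolding K_lam_eq[OF l] by (rule summable_norm[OF K_lam_summable_norm[OF l]])
  also have "\<dots> \<le> (\<Sum>k. exp (- l * hf k) * (2 * exp (pi * \<bar>Im z\<bar>)))"
  proof (rule suminf_le)
    show "norm (of_real (exp (- l * hf k)) * sinc_pair k z) \<le> exp (- l * hf k) * (2 * exp (pi * \<bar>Im z\<bar>))" for k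
      using norm_sinc_pair_le[of k z] by (simp add: norm_mult)
  qed (intro K_lam_summable_norm summable_mult2 exp_hf_summable l)+
  also have "\<dots> = (\<Sum>k. exp (- l * hf k)) * (2 * exp (pi * \<bar>Im z\<bar>))"
    by (rule suminf_mult2[symmetric]) (rule exp_hf_summable[OF l])
  finally show ?thesis unfolding exp_hf_summable(2)[OF l] by (simp only: mult_ac)
qed

text \<open>The weight is comparable to min(l, 1/l); this reduces estimates against it to the
  regimes l <= 1 and l >= 1.\<close>

lemma min_inverse_le_weight:
  fixes l :: real
  assumes "l > 0"
  shows "l \<le> 1 \<Longrightarrow> l \<le> 2 * (l / (l\<^sup>2 + 1))" "l \<ge> 1 \<Longrightarrow> 1 / l \<le> 2 * (l / (l\<^sup>2 + 1))"
proof -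
  have p: "l\<^sup>2 + 1 > 0" by (simp add: add_nonneg_pos)
  show "l \<le> 2 * (l / (l\<^sup>2 + 1))" if "l \<le> 1"
  proof -
    have "l\<^sup>2 \<le> 1" using that assms by (simp add: power_le_one)
    then have "l * (l\<^sup>2 + 1) \<le> l * 2" using assms by (intro mult_left_mono) auto
    then show ?thesis using p by (simp add: pos_le_divide_eq mult.commute)
  qed
  show "1 / l \<le> 2 * (l / (l\<^sup>2 + 1))" if "l \<ge> 1"
  proof -
    have "1 \<le> l\<^sup>2" using that by simp
    then have "1 * (l\<^sup>2 + 1) \<le> (2 * l) * l" by (simp add: power2_eq_square)
    then show ?thesis using p assms by (simp add: divide_le_eq pos_le_divide_eq mult.commute power2_eq_square)
  qed
qed

lemma exp_minus_half_le:
  fixes l :: real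
  assumes "l \<ge> 1"
  shows "exp (- l / 2) \<le> 4 * (l / (l\<^sup>2 + 1))"
proof -
  have "l / 2 \<le> exp (l / 2)" using exp_ge_add_one_self[of "l / 2"] by linarith
  then have "exp (- l / 2) \<le> 2 * (1 / l)" using assms by (simp add: exp_minus field_simps)
  then show ?thesis using min_inverse_le_weight(2)[of l] assms by linarith
qed

text \<open>For l <= 1 the difference is (exp(-l z) - exp(-l)) minus the Laplace term. Both are O(l)
  in the right half plane, the first because |exp| <= 1 for nonpositive real part, whence the factor
  1 + |z|; evenness covers the left half plane. For l >= 1 kernel and constant are separately
  O(exp(-l/2)).\<close>

lemma norm_K_lam_minus_exp_le:
  assumes l: "l > 0"
  shows "norm (K_lam l z - of_real (exp (- l))) \<le> 20 * (l / (l\<^sup>2 + 1)) * ((1 + norm z) * exp (pi * norm z))"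
proof -
  let ?t = "l / (l\<^sup>2 + 1)"
  have t0: "?t \<ge> 0" using l by (intro divide_nonneg_nonneg) auto
  have e1: "1 \<le> exp (pi * norm z)" by simp
  have eI: "exp (pi * \<bar>Im z\<bar>) \<le> exp (pi * norm z)"
    using abs_Im_le_cmod[of z] by (simp add: mult_left_mono)
  show ?thesis
  proof (cases "l \<le> 1")
    case True
    have main: "norm (K_lam l w - of_real (exp (- l))) \<le> 10 * ?t * ((1 + norm w) * exp (pi * norm w))" if w: "Re w \<ge> 0" for w
    proof -
      have e1: "1 \<le> exp (pi * norm w)" by simp
      have eI: "exp (pi * \<bar>Im w\<bar>) \<le> exp (pi * norm w)"
        using abs_Im_le_cmod[of w] by (simp add: mult_left_mono)
      have "norm (exp (- of_real l * w) - exp (- of_real l * 1)) \<le> 1 * norm (- of_real l * w - (- of_real l * 1))"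
      proof (rule field_differentiable_bound[where S = "{z. Re z \<le> 0}" and f' = exp])
        show "norm (exp z) \<le> 1" if "z \<in> {z. Re z \<le> 0}" for z :: complex using that by simp
      qed (use l w in \<open>auto intro: has_field_derivative_at_within DERIV_exp convex_halfspace_Re_le\<close>)
      also have "- of_real l * w - (- of_real l * 1) = of_real l * (1 - w)" by (simp add: algebra_simps)
      also have "1 * norm (of_real l * (1 - w)) \<le> l * (1 + norm w)"
        using l norm_triangle_ineq4[of 1 w] by (simp add: norm_mult)
      finally have A: "norm (exp (- of_real l * w) - of_real (exp (- l))) \<le> l * (1 + norm w)"
        by (simp add: exp_of_real[symmetric])
      have "norm (cos (of_real pi * w)) \<le> exp (pi * \<bar>Im w\<bar>)"
        using norm_cos_le_exp_Im[of "of_real pi * w"] by (simp add: abs_mult)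
      then have "norm (cos (of_real pi * w)) \<le> exp (pi * norm w)" using eI by linarith
      then have "norm (cos (of_real pi * w)) / pi \<le> exp (pi * norm w) / pi" by (rule divide_right_mono) simp
      from mult_mono[OF this norm_gk_laplace_le[OF l True w]]
      have "norm (cos (of_real pi * w) / of_real pi * gk_laplace l w) \<le> exp (pi * norm w) / pi * (4 * l)"
        by (simp add: norm_mult norm_divide)
      also have "\<dots> \<le> exp (pi * norm w) / 2 * (4 * l)"
        using l pi_gt3 by (intro mult_right_mono divide_left_mono) auto
      finally have B: "norm (cos (of_real pi * w) / of_real pi * gk_laplace l w) \<le> 2 * l * exp (pi * norm w)" by simp
      have eqd: "K_lam l w - of_real (exp (- l)) = (exp (- of_real l * w) - of_real (exp (- l))) - cos (of_real pi * w) / of_real pi * gk_laplace l w"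
        using exp_minus_K_lam_eq[OF l w] by (simp add: algebra_simps)
      have "norm (K_lam l w - of_real (exp (- l))) \<le> l * (1 + norm w) + 2 * l * exp (pi * norm w)"
        unfolding eqd using norm_triangle_ineq4[of "exp (- of_real l * w) - of_real (exp (- l))" "cos (of_real pi * w) / of_real pi * gk_laplace l w"] A B by linarith
      also have "\<dots> \<le> l * ((1 + norm w) * exp (pi * norm w)) + 2 * l * ((1 + norm w) * exp (pi * norm w))"
      proof (intro add_mono mult_left_mono)
        show "1 + norm w \<le> (1 + norm w) * exp (pi * norm w)" using mult_left_mono[OF e1, of "1 + norm w"] by simp
        show "exp (pi * norm w) \<le> (1 + norm w) * exp (pi * norm w)" by (simp add: distrib_right)
      qed (use l in auto)
      also have "\<dots> = 3 * l * ((1 + norm w) * exp (pi * norm w))" by simp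
      also have "\<dots> \<le> 10 * ?t * ((1 + norm w) * exp (pi * norm w))"
        using min_inverse_le_weight(1)[OF l True] t0 by (intro mult_right_mono) auto
      finally show ?thesis .
    qed
    have "norm (K_lam l z - of_real (exp (- l))) \<le> 10 * ?t * ((1 + norm z) * exp (pi * norm z))"
      using main[of z] main[of "- z"] K_lam_minus[OF l, of z] by (cases "Re z \<ge> 0") auto
    also have "\<dots> \<le> 20 * ?t * ((1 + norm z) * exp (pi * norm z))"
      using t0 by (intro mult_right_mono) auto
    finally show ?thesis .
  next
    case False
    then have l1: "l \<ge> 1" by simp
    have h: "exp (- l) \<le> 1/2"
    proof -
      have "2 \<le> exp l" using exp_ge_add_one_self[of l] l1 by linarith
      then show ?thesis by (simp add: exp_minus field_simps)
    qed
    have "exp (- l / 2) / (1 - exp (- l)) \<le> exp (- l / 2) / (1/2)" using h l by (intro divide_left_mono) auto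
    then have a: "exp (- l / 2) / (1 - exp (- l)) \<le> 2 * exp (- l / 2)" by simp
    have "norm (K_lam l z) \<le> 2 * exp (pi * norm z) * (2 * exp (- l / 2))"
    proof (rule order_trans[OF norm_K_lam_le[OF l]], rule mult_mono)
      show "0 \<le> exp (- l / 2) / (1 - exp (- l))" using l by (intro divide_nonneg_nonneg) simp_all
      show "2 * exp (pi * \<bar>Im z\<bar>) \<le> 2 * exp (pi * norm z)" using eI by linarith
    qed (use a in auto)
    then have "norm (K_lam l z) \<le> 4 * (exp (pi * norm z) * exp (- l / 2))" by simp
    moreover have "exp (- l) \<le> exp (- l / 2)" using l by simp
    moreover have "exp (- l / 2) \<le> exp (pi * norm z) * exp (- l / 2)" using e1 by simp
    moreover have "norm (K_lam l z - of_real (exp (- l))) \<le> norm (K_lam l z) + exp (- l)"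
      using norm_triangle_ineq4[of "K_lam l z" "of_real (exp (- l))"] by simp
    ultimately have "norm (K_lam l z - of_real (exp (- l))) \<le> 5 * (exp (pi * norm z) * exp (- l / 2))" by linarith
    then have "norm (K_lam l z - of_real (exp (- l))) \<le> 5 * exp (- l / 2) * exp (pi * norm z)" by (simp only: mult_ac)
    also have "\<dots> \<le> 20 * ?t * ((1 + norm z) * exp (pi * norm z))"
    proof (rule mult_mono)
      show "5 * exp (- l / 2) \<le> 20 * ?t" using exp_minus_half_le[OF l1] by simp
      show "exp (pi * norm z) \<le> (1 + norm z) * exp (pi * norm z)" by (simp add: distrib_right)
    qed (use t0 in auto)
    finally show ?thesis .
  qed
qed

lemma K_lam_exp_type:
  assumes l: "l > 0" shows "exp_type_le (K_lam l) pi"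
proof (rule exp_type_leI[OF K_lam_holomorphic[OF l], where C = "20 * (l / (l\<^sup>2 + 1)) + exp (- l)"])
  fix z
  have "norm (K_lam l z) \<le> norm (K_lam l z - of_real (exp (- l))) + exp (- l)"
    using norm_triangle_ineq[of "K_lam l z - of_real (exp (- l))" "of_real (exp (- l))"] by simp
  moreover have "exp (- l) * 1 \<le> exp (- l) * ((1 + norm z) * exp (pi * norm z))"
    by (intro mult_left_mono) (auto simp: mult_ge1_I)
  ultimately show "norm (K_lam l z) \<le> (20 * (l / (l\<^sup>2 + 1)) + exp (- l)) * (1 + norm z) * exp (pi * norm z)"
    using norm_K_lam_minus_exp_le[OF l, of z]
    unfolding mult.assoc[of _ "1 + norm z"] distrib_right[of _ _ "(1 + norm z) * exp (pi * norm z)"] by linarith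
qed (use l in \<open>auto intro!: add_nonneg_nonneg divide_nonneg_nonneg\<close>)

section \<open>Integrals of the kernel error over the real line\<close>

lemma integrable_inverse_square: "integrable lborel (\<lambda>x::real. 1 / (1 + \<bar>x\<bar>)\<^sup>2)"
proof -
  have "integrable lborel (\<lambda>x::real. indicator {0..} x *\<^sub>R (1 / (1 + x)\<^sup>2))"
  proof (rule integrableI_nonneg)
    have "((\<lambda>x::real. - 1 / (1 + x)) \<longlongrightarrow> 0) at_top" by real_asymp
    moreover have "DERIV (\<lambda>x. - 1 / (1 + x)) x :> 1 / (1 + x)\<^sup>2" if "0 \<le> x" for x :: real
      using that by (auto intro!: derivative_eq_intros simp: power2_eq_square divide_simps)
    ultimately have "(\<integral>\<^sup>+ x. ennreal (1 / (1 + x)\<^sup>2) * indicator {0..} x \<partial>lborel) = ennreal (0 - (- 1 / (1 + 0)))"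
      by (intro nn_integral_FTC_atLeast) auto
    also have "(\<integral>\<^sup>+ x. ennreal (1 / (1 + x)\<^sup>2) * indicator {0..} x \<partial>lborel) = (\<integral>\<^sup>+ x. ennreal (indicator {0..} x *\<^sub>R (1 / (1 + x)\<^sup>2)) \<partial>lborel)"
      by (intro nn_integral_cong) (auto simp: indicator_def)
    finally show "(\<integral>\<^sup>+ x. ennreal (indicator {0..} x *\<^sub>R (1 / (1 + x)\<^sup>2)) \<partial>lborel) < \<infinity>" by simp
  qed auto
  then have "has_bochner_integral lborel (\<lambda>x::real. indicator {0..} x *\<^sub>R (1 / (1 + x)\<^sup>2)) (LINT x|lborel. indicator {0..} x *\<^sub>R (1 / (1 + x)\<^sup>2))"
    by (rule has_bochner_integral_integrable)
  moreover have "indicator {0..} x *\<^sub>R (1 / (1 + x)\<^sup>2) = indicator {0..} x *\<^sub>R (1 / (1 + \<bar>x\<bar>)\<^sup>2)"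
    "indicator {0..} x *\<^sub>R (1 / (1 + x)\<^sup>2) = indicator {0..} x *\<^sub>R (1 / (1 + \<bar>- x\<bar>)\<^sup>2)" for x :: real
    by (auto simp: indicator_def)
  ultimately have "has_bochner_integral lborel (\<lambda>x::real. 1 / (1 + \<bar>x\<bar>)\<^sup>2) ((LINT x|lborel. indicator {0..} x *\<^sub>R (1 / (1 + x)\<^sup>2)) + (LINT x|lborel. indicator {0..} x *\<^sub>R (1 / (1 + x)\<^sup>2)))"
    by (intro has_bochner_integral_two_sided) (simp_all only:, simp_all)
  then show ?thesis by (simp add: has_bochner_integral_iff)
qed

text \<open>The two half lines contribute 1/b and its conjugate, where b = l + 2 pi i t.\<close>

lemma exp_abs_fourier:
  assumes l: "l > 0"
  shows "has_bochner_integral lborel (\<lambda>x. of_real (exp (- l * \<bar>x\<bar>)) * ee (of_real (- t * x)))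
     (of_real (2 * l / (l\<^sup>2 + 4 * pi\<^sup>2 * t\<^sup>2)))"
proof -
  define b where "b = Complex l (2 * pi * t)"
  have h1: "has_bochner_integral lborel (\<lambda>x. indicator {0..} x *\<^sub>R (of_real (exp (- l * \<bar>x\<bar>)) * ee (of_real (- t * x)))) (1 / b)"
  proof -
    have "indicator {0..} x *\<^sub>R (of_real (exp (- l * \<bar>x\<bar>)) * ee (of_real (- t * x))) = indicator {0..} x *\<^sub>R exp (- b * of_real x)" for x
    proof -
      have "- b * of_real x = of_real (- l * x) + 2 * of_real pi * \<i> * of_real (- t * x)" by (simp add: b_def complex_eq_iff)
      then have "exp (- b * of_real x) = of_real (exp (- l * x)) * ee (of_real (- t * x))"
        by (simp only: exp_add ee_def exp_of_real)
      then show ?thesis by (auto simp: indicator_def)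
    qed
    moreover have "Re b > 0" using l by (simp add: b_def)
    ultimately show ?thesis using has_bochner_integral_exp_Ici[of b] by (simp only:)
  qed
  have h2: "has_bochner_integral lborel (\<lambda>x. indicator {0..} x *\<^sub>R (of_real (exp (- l * \<bar>- x\<bar>)) * ee (of_real (- t * - x)))) (1 / cnj b)"
  proof -
    have "indicator {0..} x *\<^sub>R (of_real (exp (- l * \<bar>- x\<bar>)) * ee (of_real (- t * - x))) = indicator {0..} x *\<^sub>R exp (- cnj b * of_real x)" for x
    proof -
      have "- cnj b * of_real x = of_real (- l * x) + 2 * of_real pi * \<i> * of_real (- t * - x)" by (simp add: b_def complex_eq_iff)
      then have "exp (- cnj b * of_real x) = of_real (exp (- l * x)) * ee (of_real (- t * - x))"
        by (simp only: exp_add ee_def exp_of_real)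
      then show ?thesis by (auto simp: indicator_def)
    qed
    moreover have "Re (cnj b) > 0" using l by (simp add: b_def)
    ultimately show ?thesis using has_bochner_integral_exp_Ici[of "cnj b"] by (simp only:)
  qed
  have hv: "1 / b + 1 / cnj b = of_real (2 * l / (l\<^sup>2 + 4 * pi\<^sup>2 * t\<^sup>2))"
  proof -
    have "b \<noteq> 0" using l by (auto simp: b_def complex_eq_iff)
    then have "1 / b + 1 / cnj b = (b + cnj b) / (b * cnj b)" by (simp add: field_simps)
    also have "b + cnj b = of_real (2 * l)" by (simp add: b_def complex_eq_iff)
    also have "b * cnj b = of_real (l\<^sup>2 + 4 * pi\<^sup>2 * t\<^sup>2)"
      by (simp add: b_def complex_mult_cnj power_mult_distrib)
    finally show ?thesis by simp
  qed
  have hm: "(\<lambda>x. of_real (exp (- l * \<bar>x\<bar>)) * ee (of_real (- t * x))) \<in> borel_measurable borel"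
    unfolding ee_def by measurable
  show ?thesis using has_bochner_integral_two_sided[OF h1 h2 hm] unfolding hv .
qed

lemma integrable_exp_abs:
  assumes "l > 0" shows "integrable lborel (\<lambda>x::real. exp (- l * \<bar>x\<bar>))"
proof -
  have "integrable lborel (\<lambda>x. complex_of_real (exp (- l * \<bar>x\<bar>)))"
    using exp_abs_fourier[OF assms, of 0] by (simp add: has_bochner_integral_iff ee_def)
  from integrable_Re[OF this] show ?thesis by simp
qed

text \<open>The sign of cos(pi x) changes under x -> x + 1. Hence the half line integral satisfies I
  = J - exp(-l) I, where J = (1 - exp(-l/2))^2/l is the integral over [0,1); solving for I produces
  the hyperbolic secant, and evenness doubles it.\<close>

lemma sgn_cos_exp_integral:
  assumes l: "l > 0"
  shows "(LINT x|lborel. sgn (cos (pi * x)) * exp (- l * \<bar>x\<bar>)) = 2 / l - 2 / (l * cosh (l / 2))"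
proof -
  define f where "f = (\<lambda>x. sgn (cos (pi * x)) * exp (- l * x))"
  define I where "I = (LINT x|lborel. indicator {0..} x *\<^sub>R f x)"
  have [measurable]: "f \<in> borel_measurable borel" unfolding f_def by measurable
  have int0: "integrable lborel (\<lambda>x. indicator {0..} x *\<^sub>R f x)"
    by (rule Bochner_Integration.integrable_bound[OF integrable_exp_Ici[OF l]])
      (auto simp: f_def indicator_def abs_mult sgn_if)
  have "(LINT x|lborel. indicator {1..} x *\<^sub>R f x) = - exp (- l) * I"
  proof -
    have "(LINT x|lborel. indicator {1..} x *\<^sub>R f x) = (LINT x|lborel. indicator {1..} (1 + 1 * x) *\<^sub>R f (1 + 1 * x))"
      using lborel_integral_real_affine[of 1 "\<lambda>x. indicator {1..} x *\<^sub>R f x" 1] by simp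
    also have "\<dots> = (LINT x|lborel. - exp (- l) * (indicator {0..} x *\<^sub>R f x))"
    proof (rule Bochner_Integration.integral_cong)
      fix x :: real
      have "cos (pi * (1 + 1 * x)) = - cos (pi * x)" by (simp add: distrib_left cos_add)
      then have "f (1 + 1 * x) = - exp (- l) * f x" by (simp add: f_def sgn_minus exp_add[symmetric] algebra_simps)
      moreover have "indicator {1..} (1 + 1 * x) = (indicator {0..} x :: real)" by (simp add: indicator_def)
      ultimately show "indicator {1..} (1 + 1 * x) *\<^sub>R f (1 + 1 * x) = - exp (- l) * (indicator {0..} x *\<^sub>R f x)" by simp
    qed simp
    finally show ?thesis unfolding I_def by (simp only: integral_mult_right_zero)
  qed
  moreover have "has_bochner_integral lborel (\<lambda>x. indicator {0..<1} x *\<^sub>R f x) ((1 - exp (- l / 2))\<^sup>2 / l)"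
  proof -
    \<comment> \<open>On [0,1) the sign is twice the indicator of [0,1/2] minus that of [0,1], up to
      single points.\<close>
    have h: "has_bochner_integral lborel (\<lambda>w. 2 * (indicator {0..1/2} w *\<^sub>R exp (- l * w)) - indicator {0..1} w *\<^sub>R exp (- l * w))
      (2 * ((1 - exp (- l * (1/2))) / l) - (1 - exp (- l * 1)) / l)"
      using l by (intro has_bochner_integral_diff has_bochner_integral_mult_right has_bochner_integral_exp_Icc_real) auto
    have "exp (- l * 1) = exp (- l / 2) ^ 2" by (simp add: exp_double[symmetric])
    then have v: "2 * ((1 - exp (- l * (1/2))) / l) - (1 - exp (- l * 1)) / l = (1 - exp (- l / 2))\<^sup>2 / l"
      by (simp add: power2_eq_square algebra_simps diff_divide_distrib add_divide_distrib)
    have ae: "AE w in lborel. 2 * (indicator {0..1/2} w *\<^sub>R exp (- l * w)) - indicator {0..1} w *\<^sub>R exp (- l * w) = indicator {0..<1} w *\<^sub>R f w"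
      using AE_lborel_singleton[of "1/2::real"] AE_lborel_singleton[of "1::real"]
    proof eventually_elim
      case (elim w)
      consider "w < 0 \<or> w > 1" | "0 \<le> w" "w < 1/2" | "1/2 < w" "w < 1" using elim by linarith
      then show ?case
      proof cases
        case 2
        have "pi * w < pi * (1/2)" using 2 by (intro mult_strict_left_mono) auto
        moreover have "0 \<le> pi * w" using 2 by simp
        ultimately have "cos (pi * w) > 0" using pi_gt_zero by (intro cos_gt_zero_pi) linarith+
        then show ?thesis using 2 by (simp add: f_def)
      next
        case 3
        have "pi * (1 - w) < pi * (1/2)" using 3 by (intro mult_strict_left_mono) auto
        moreover have "0 \<le> pi * (1 - w)" using 3 by simp
        ultimately have "cos (pi * (1 - w)) > 0" using pi_gt_zero by (intro cos_gt_zero_pi) linarith+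
        moreover have "cos (pi * (1 - w)) = - cos (pi * w)" by (simp add: right_diff_distrib cos_diff)
        ultimately have "cos (pi * w) < 0" by simp
        then show ?thesis using 3 by (simp add: f_def)
      qed (auto simp: indicator_def)
    qed
    show ?thesis using h unfolding v by (subst (asm) has_bochner_integral_cong_AE[OF _ _ ae]) auto
  qed
  moreover have "I = (LINT x|lborel. indicator {0..<1} x *\<^sub>R f x) + (LINT x|lborel. indicator {1..} x *\<^sub>R f x)"
  proof -
    have "integrable lborel (\<lambda>x. indicator {1..} x *\<^sub>R f x)"
      by (rule Bochner_Integration.integrable_bound[OF int0]) (auto simp: indicator_def)
    moreover have "integrable lborel (\<lambda>x. indicator {0..<1} x *\<^sub>R f x)"
      by (rule Bochner_Integration.integrable_bound[OF int0]) (auto simp: indicator_def)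
    moreover have "indicator {0..} x *\<^sub>R f x = indicator {0..<1} x *\<^sub>R f x + indicator {1..} x *\<^sub>R f x" for x
      by (auto simp: indicator_def)
    ultimately show ?thesis unfolding I_def by (simp only: Bochner_Integration.integral_add)
  qed
  ultimately have eq: "I = (1 - exp (- l / 2))\<^sup>2 / l - exp (- l) * I" by (simp add: has_bochner_integral_iff)
  define A where "A = exp (- l / 2)"
  have A: "A > 0" "exp (- l) = A\<^sup>2" by (simp_all add: A_def exp_double[symmetric])
  have ch: "cosh (l / 2) = (1 + A\<^sup>2) / (2 * A)"
    unfolding cosh_field_def A_def by (simp add: exp_minus field_simps power2_eq_square)
  have p: "1 + A\<^sup>2 > 0" by (simp add: add_pos_nonneg)
  have "I * (1 + A\<^sup>2) = (1 - A)\<^sup>2 / l" using eq unfolding A(2) A_def[symmetric] by (simp add: algebra_simps)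
  moreover have "I = I * (1 + A\<^sup>2) / (1 + A\<^sup>2)" using p by simp
  ultimately have "I = (1 - A)\<^sup>2 / l / (1 + A\<^sup>2)" by metis
  then have "I = (1 - A)\<^sup>2 / (l * (1 + A\<^sup>2))" by (simp only: divide_divide_eq_left)
  also have "(1 - A)\<^sup>2 = (1 + A\<^sup>2) - 2 * A" by (simp add: power2_eq_square algebra_simps)
  also have "((1 + A\<^sup>2) - 2 * A) / (l * (1 + A\<^sup>2)) = 1 / l - 2 * A / (l * (1 + A\<^sup>2))"
    using p l by (simp add: diff_divide_distrib)
  also have "2 * A / (l * (1 + A\<^sup>2)) = 1 / (l * cosh (l / 2))" unfolding ch using A p by simp
  finally have I: "I = 1 / l - 1 / (l * cosh (l / 2))" .
  have "has_bochner_integral lborel (\<lambda>x. sgn (cos (pi * x)) * exp (- l * \<bar>x\<bar>)) (I + I)"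
  proof (rule has_bochner_integral_two_sided)
    have hI: "has_bochner_integral lborel (\<lambda>x. indicator {0..} x *\<^sub>R f x) I" using int0 by (simp add: has_bochner_integral_iff I_def)
    moreover have "indicator {0..} x *\<^sub>R f x = indicator {0..} x *\<^sub>R (sgn (cos (pi * x)) * exp (- l * \<bar>x\<bar>))"
      "indicator {0..} x *\<^sub>R f x = indicator {0..} x *\<^sub>R (sgn (cos (pi * - x)) * exp (- l * \<bar>- x\<bar>))" for x
      by (auto simp: indicator_def f_def)
    ultimately show "has_bochner_integral lborel (\<lambda>x. indicator {0..} x *\<^sub>R (sgn (cos (pi * x)) * exp (- l * \<bar>x\<bar>))) I"
      "has_bochner_integral lborel (\<lambda>x. indicator {0..} x *\<^sub>R (sgn (cos (pi * - x)) * exp (- l * \<bar>- x\<bar>))) I"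
      by (simp_all only:)
  qed simp
  then show ?thesis unfolding I by (simp add: has_bochner_integral_iff)
qed

text \<open>\<open>K_lam\<close> is real on the real axis (see \<open>K_lam_of_real\<close>), so
  taking the real part loses nothing and keeps the later integrals real.\<close>

definition K_gap :: "real \<Rightarrow> real \<Rightarrow> real" where
  "K_gap l x = exp (- l * \<bar>x\<bar>) - Re (K_lam l (of_real x))"

lemma K_gap_eq:
  assumes l: "l > 0"
  obtains r where "r \<ge> 0" "x \<noteq> 0 \<Longrightarrow> r \<le> 2 / x\<^sup>2" "K_gap l x = cos (pi * x) * r"
    "K_lam l (of_real x) = of_real (exp (- l * \<bar>x\<bar>) - K_gap l x)"
proof -
  obtain r where r: "r \<ge> 0" "x \<noteq> 0 \<Longrightarrow> r \<le> 2 / x\<^sup>2" "K_lam l (of_real x) = of_real (exp (- l * \<bar>x\<bar>) - cos (pi * x) * r)"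
    using exp_minus_K_lam_real[OF l] by blast
  have g: "K_gap l x = cos (pi * x) * r" unfolding K_gap_def r(3) by simp
  show ?thesis by (rule that[OF r(1) r(2) g]) (simp_all add: r(3) g)
qed

lemma K_lam_of_real:
  assumes "l > 0" shows "K_lam l (of_real x) = of_real (exp (- l * \<bar>x\<bar>) - K_gap l x)"
  using K_gap_eq[OF assms] by metis

text \<open>The sign of the error is that of cos(pi x) for every l. This common sign lets absolute
  values pass through the integral over l.\<close>

lemma K_gap_sgn:
  assumes "l > 0" shows "K_gap l x * sgn (cos (pi * x)) = \<bar>K_gap l x\<bar>"
proof -
  obtain r where r: "r \<ge> 0" "K_gap l x = cos (pi * x) * r" using K_gap_eq[OF assms] by metis
  show ?thesis
    unfolding r(2) abs_mult abs_of_nonneg[OF r(1)] abs_sgn[of "cos (pi * x)"] by (simp only: mult_ac)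
qed

lemma K_gap_continuous:
  assumes "l > 0" shows "continuous_on A (K_gap l)"
  unfolding K_gap_def[abs_def]
  by (intro continuous_intros entire_continuous_on_real K_lam_holomorphic assms)

lemma K_gap_measurable:
  assumes "l > 0" shows "K_gap l \<in> borel_measurable borel"
  by (rule borel_measurable_continuous_onI[OF K_gap_continuous[OF assms]])

lemma K_gap_integrable:
  assumes l: "l > 0" shows "integrable lborel (K_gap l)"
proof -
  define c where "c = 1 + 2 * (exp (- l / 2) / (1 - exp (- l)))"
  \<comment> \<open>For |x| <= 1 the error is at most c and (1+|x|)^2 <= 4; for |x| > 1 it is at
    most 2/x^2 and (1+|x|)^2 <= 4 x^2. The two summands serve these two ranges.\<close>
  define C where "C = 4 * c + 8"
  have c0: "c \<ge> 0" unfolding c_def using l by (intro add_nonneg_nonneg mult_nonneg_nonneg divide_nonneg_nonneg) simp_all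
  have bd: "norm (K_gap l x) \<le> norm (C * (1 / (1 + \<bar>x\<bar>)\<^sup>2))" for x
  proof -
    have p: "(1 + \<bar>x\<bar>)\<^sup>2 > 0" by (rule zero_less_power) (simp add: add_pos_nonneg)
    have "\<bar>K_gap l x\<bar> \<le> C / (1 + \<bar>x\<bar>)\<^sup>2"
    proof (cases "\<bar>x\<bar> \<le> 1")
      case True
      have "exp (- l * \<bar>x\<bar>) \<le> 1" using l by simp
      moreover have "\<bar>Re (K_lam l (of_real x))\<bar> \<le> 2 * (exp (- l / 2) / (1 - exp (- l)))"
        using norm_K_lam_le[OF l, of "of_real x"] abs_Re_le_cmod[of "K_lam l (of_real x)"] by simp
      moreover have "exp (- l * \<bar>x\<bar>) \<ge> 0" by simp
      ultimately have "\<bar>K_gap l x\<bar> \<le> c" unfolding K_gap_def c_def by linarith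
      moreover have "(1 + \<bar>x\<bar>)\<^sup>2 \<le> 2\<^sup>2" using True by (intro power_mono) auto
      then have "c * (1 + \<bar>x\<bar>)\<^sup>2 \<le> C" using c0 mult_left_mono[of "(1 + \<bar>x\<bar>)\<^sup>2" 4 c] by (simp add: C_def)
      then have "c \<le> C / (1 + \<bar>x\<bar>)\<^sup>2" using p by (simp add: pos_le_divide_eq)
      ultimately show ?thesis by linarith
    next
      case False
      then have x0: "x \<noteq> 0" by auto
      obtain r where r: "r \<ge> 0" "r \<le> 2 / x\<^sup>2" "K_gap l x = cos (pi * x) * r" using K_gap_eq[OF l] x0 by metis
      have "\<bar>K_gap l x\<bar> \<le> 1 * r" unfolding r(3) abs_mult using r(1) by (intro mult_mono) auto
      then have "\<bar>K_gap l x\<bar> \<le> 2 / x\<^sup>2" using r(2) by linarith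
      also have "2 / x\<^sup>2 \<le> C / (1 + \<bar>x\<bar>)\<^sup>2"
      proof -
        have "(1 + \<bar>x\<bar>)\<^sup>2 \<le> (2 * \<bar>x\<bar>)\<^sup>2" using False by (intro power_mono) auto
        then have "2 * (1 + \<bar>x\<bar>)\<^sup>2 \<le> 8 * x\<^sup>2" by (simp add: power_mult_distrib)
        also have "\<dots> \<le> C * x\<^sup>2" using c0 by (intro mult_right_mono) (auto simp: C_def)
        finally show ?thesis using p x0 by (simp add: divide_le_eq pos_le_divide_eq mult.commute)
      qed
      finally show ?thesis .
    qed
    then show ?thesis using c0 by (simp add: C_def)
  qed
  show ?thesis
    by (rule Bochner_Integration.integrable_bound[OF integrable_mult_right[OF integrable_inverse_square, of C]])
      (use bd K_gap_measurable[OF l] in auto)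
qed

lemma K_lam_integrable:
  assumes l: "l > 0" shows "integrable lborel (\<lambda>x::real. K_lam l (of_real x))"
proof -
  have "integrable lborel (\<lambda>x. complex_of_real (exp (- l * \<bar>x\<bar>) - K_gap l x))"
    by (intro integrable_of_real Bochner_Integration.integrable_diff integrable_exp_abs K_gap_integrable l)
  then show ?thesis by (simp only: K_lam_of_real[OF l])
qed

text \<open>The absolute value is the error times sgn(cos(pi x)). The part with \<open>K_lam\<close>
  integrates to 0 by duality, because that kernel is integrable of type \<open>pi\<close>; only the
  explicit integral of the exponential remains.\<close>

lemma K_gap_abs_integral:
  assumes l: "l > 0"
  shows "(LINT x|lborel. \<bar>K_gap l x\<bar>) = 2 / l - 2 / (l * cosh (l / 2))"
proof -
  define s where "s = (\<lambda>x. sgn (cos (pi * x)))"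
  have sm: "(\<lambda>x. complex_of_real (s x)) \<in> borel_measurable lborel" unfolding s_def by measurable
  have sb: "norm (complex_of_real (s x)) \<le> 1" for x by (simp add: s_def sgn_if)
  have i1: "integrable lborel (\<lambda>x. complex_of_real (exp (- l * \<bar>x\<bar>)) * of_real (s x))"
    by (rule integrable_mult_bounded[OF integrable_of_real[OF integrable_exp_abs[OF l]] sm sb])
  have i2: "integrable lborel (\<lambda>x. K_lam l (of_real x) * of_real (s x))"
    by (rule integrable_mult_bounded[OF K_lam_integrable[OF l] sm sb])
  have "complex_of_real \<bar>K_gap l x\<bar> = of_real (exp (- l * \<bar>x\<bar>)) * of_real (s x) - K_lam l (of_real x) * of_real (s x)" for x
    unfolding K_gap_sgn[OF l, symmetric] K_lam_of_real[OF l] s_def by (simp add: algebra_simps)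
  then have "of_real (LINT x|lborel. \<bar>K_gap l x\<bar>)
    = (LINT x|lborel. complex_of_real (exp (- l * \<bar>x\<bar>)) * of_real (s x)) - (LINT x|lborel. K_lam l (of_real x) * of_real (s x))"
    unfolding integral_complex_of_real[symmetric] using Bochner_Integration.integral_diff[OF i1 i2] by (simp only:)
  also have "(LINT x|lborel. K_lam l (of_real x) * of_real (s x)) = 0"
    unfolding s_def by (rule exp_type_le_sgn_cos_zero[OF K_lam_exp_type[OF l] K_lam_integrable[OF l]]) simp
  also have "(LINT x|lborel. complex_of_real (exp (- l * \<bar>x\<bar>)) * of_real (s x)) = of_real (LINT x|lborel. sgn (cos (pi * x)) * exp (- l * \<bar>x\<bar>))"
    unfolding integral_complex_of_real[symmetric] s_def by (simp add: mult.commute)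
  finally show ?thesis unfolding sgn_cos_exp_integral[OF l] by (simp only: diff_0_right of_real_eq_iff)
qed

lemma K_gap_fourier:
  assumes l: "l > 0"
  shows "(LINT x|lborel. of_real (K_gap l x) * ee (of_real (- t * x))) = of_real (2 * l / (l\<^sup>2 + 4 * pi\<^sup>2 * t\<^sup>2)) - K_hat l t"
proof -
  have em: "(\<lambda>x. ee (of_real (- t * x))) \<in> borel_measurable lborel" unfolding ee_def by measurable
  have eb: "norm (ee (of_real (- t * x))) \<le> 1" for x by (simp add: ee_def)
  have i2: "integrable lborel (\<lambda>x. K_lam l (of_real x) * ee (of_real (- t * x)))"
    by (rule integrable_mult_bounded[OF K_lam_integrable[OF l] em eb])
  have i1: "integrable lborel (\<lambda>x. of_real (exp (- l * \<bar>x\<bar>)) * ee (of_real (- t * x)))"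
    and v1: "(LINT x|lborel. of_real (exp (- l * \<bar>x\<bar>)) * ee (of_real (- t * x))) = of_real (2 * l / (l\<^sup>2 + 4 * pi\<^sup>2 * t\<^sup>2))"
    using exp_abs_fourier[OF l, of t] by (simp_all only: has_bochner_integral_iff)
  have "of_real (K_gap l x) * ee (of_real (- t * x)) = of_real (exp (- l * \<bar>x\<bar>)) * ee (of_real (- t * x)) - K_lam l (of_real x) * ee (of_real (- t * x))" for x
    unfolding K_lam_of_real[OF l] by (simp add: algebra_simps)
  then show ?thesis unfolding K_hat_def using Bochner_Integration.integral_diff[OF i1 i2] v1 by (simp only:)
qed

section \<open>Bounds for samples and partial sums in terms of the weight\<close>

text \<open>For l <= 1 the mean value theorem gives l |1-a|; for l >= 1 each exponential is at most
  the reciprocal of its exponent. The dependence on a stays explicit, for linear growth at the nodes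
  and for uniformity near a fixed a.\<close>

lemma exp_diff_le_weight:
  fixes l a :: real
  assumes l: "l > 0" and a: "a > 0"
  shows "\<bar>exp (- l * a) - exp (- l)\<bar> \<le> 2 * (1 + a + 1 / a) * (l / (l\<^sup>2 + 1))"
proof -
  let ?t = "l / (l\<^sup>2 + 1)"
  have t0: "?t \<ge> 0" using l by (intro divide_nonneg_nonneg) auto
  show ?thesis
  proof (cases "l \<le> 1")
    case True
    have "norm (exp (- l * a) - exp (- l * 1)) \<le> 1 * norm (- l * a - (- l * 1))"
    proof (rule field_differentiable_bound[where S = "{..0::real}" and f' = exp])
      show "norm (exp z) \<le> 1" if "z \<in> {..0}" for z :: real using that by simp
    qed (use l a in \<open>auto intro: has_field_derivative_at_within DERIV_exp\<close>)
    also have "- l * a - (- l * 1) = l * (1 - a)" by (simp add: algebra_simps)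
    also have "1 * norm (l * (1 - a)) \<le> l * (1 + a + 1 / a)"
      unfolding real_norm_def abs_mult using l a by (simp add: abs_if)
    also have "\<dots> \<le> (2 * ?t) * (1 + a + 1 / a)"
      using min_inverse_le_weight(1)[OF l True] a by (intro mult_right_mono) (auto simp: add_nonneg_nonneg)
    finally show ?thesis by (simp add: mult_ac)
  next
    case False
    then have l1: "l \<ge> 1" by simp
    have e: "exp (- l * b) \<le> (1 / b) * (1 / l)" if "b > 0" for b
    proof -
      have "l * b \<le> exp (l * b)" using exp_ge_add_one_self[of "l * b"] by linarith
      then have "1 / exp (l * b) \<le> 1 / (l * b)" using l that by (intro frac_le) auto
      then show ?thesis by (simp add: exp_minus divide_inverse mult_ac)
    qed
    have "exp (- l * a) \<le> (1 / a) * (2 * ?t)"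
      using order_trans[OF e[OF a] mult_left_mono[OF min_inverse_le_weight(2)[OF l l1], of "1 / a"]] a by simp
    moreover have "exp (- l) \<le> 2 * ?t" using e[of 1] min_inverse_le_weight(2)[OF l l1] by simp
    moreover have "0 \<le> exp (- l * a)" "0 \<le> exp (- l)" by simp_all
    moreover have "0 \<le> 2 * ?t" using t0 by linarith
    then have "0 \<le> (1 / a) * (2 * ?t)" "0 \<le> a * (2 * ?t)"
      using a by (auto intro!: mult_nonneg_nonneg simp del: times_divide_eq_right times_divide_eq_left)
    moreover have "2 * (1 + a + 1 / a) * ?t = 2 * ?t + a * (2 * ?t) + (1 / a) * (2 * ?t)"
      unfolding distrib_left distrib_right by simp
    ultimately show ?thesis using t0 \<open>0 \<le> (1 / a) * (2 * ?t)\<close> by linarith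
  qed
qed

text \<open>Since \<open>hf k\<close> >= 1/2, one has 1 <= 2 \<open>hf k\<close> and
  1/\<open>hf k\<close> <= 4 \<open>hf k\<close>; so 1 + a + 1/a <= 7 a at the nodes, and doubling
  gives 14.\<close>

lemma exp_diff_hf_le_weight:
  assumes l: "l > 0"
  shows "\<bar>exp (- l * hf k) - exp (- l)\<bar> \<le> 14 * hf k * (l / (l\<^sup>2 + 1))"
proof -
  have "1 / hf k \<le> 4 * hf k"
  proof -
    have "(1/2) * (1/2) \<le> hf k * hf k" by (intro mult_mono hf_ge_half) auto
    then show ?thesis using hf_pos[of k] by (simp add: divide_le_eq)
  qed
  moreover have "1 \<le> 2 * hf k" using hf_ge_half[of k] by simp
  ultimately have "1 + hf k + 1 / hf k \<le> 7 * hf k" by linarith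
  then have "2 * (1 + hf k + 1 / hf k) \<le> 14 * hf k" by simp
  then have "2 * (1 + hf k + 1 / hf k) * (l / (l\<^sup>2 + 1)) \<le> 14 * hf k * (l / (l\<^sup>2 + 1))"
    using l by (intro mult_right_mono divide_nonneg_nonneg) auto
  then show ?thesis using exp_diff_le_weight[OF l hf_pos[of k]] by linarith
qed

lemma alternating_sum_bounds:
  fixes a :: "nat \<Rightarrow> real"
  assumes "\<And>k. a k \<ge> 0" "\<And>k. a (Suc k) \<le> a k"
  shows "0 \<le> (\<Sum>k<n. (-1) ^ k * a k) \<and> (\<Sum>k<n. (-1) ^ k * a k) \<le> a 0"
  using assms
proof (induction n arbitrary: a)
  case (Suc n)
  have "(\<Sum>k<Suc n. (-1) ^ k * a k) = a 0 - (\<Sum>k<n. (-1) ^ k * a (Suc k))"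
    by (simp add: sum.lessThan_Suc_shift sum_negf del: sum.lessThan_Suc)
  moreover have "0 \<le> (\<Sum>k<n. (-1) ^ k * a (Suc k)) \<and> (\<Sum>k<n. (-1) ^ k * a (Suc k)) \<le> a (Suc 0)"
    using Suc.IH[of "\<lambda>k. a (Suc k)"] Suc.prems by blast
  ultimately show ?case using Suc.prems(2)[of 0] by linarith
qed simp

text \<open>The terms decay only like 1/\<open>hf k\<close>, so a bound uniform in N must come from
  the alternating signs. The sum is \<phi>(l) - exp(-l) \<phi>(0), where \<phi> has a derivative
  bounded by 2, namely minus a partial geometric sum. For l <= 1 both \<phi>(l) - \<phi>(0) and (1 -
  exp(-l)) \<phi>(0) are at most 2 l; for l >= 1 everything is O(exp(-l/2)).\<close>

lemma alternating_exp_diff_bound: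
  assumes l: "l > 0"
  shows "\<bar>\<Sum>k<N. (-1) ^ k * ((exp (- l * hf k) - exp (- l)) / hf k)\<bar> \<le> 16 * (l / (l\<^sup>2 + 1))"
proof -
  let ?t = "l / (l\<^sup>2 + 1)"
  define \<phi> where "\<phi> = (\<lambda>x. \<Sum>k<N. (-1) ^ k * (exp (- hf k * x) / hf k))"
  have \<phi>b: "0 \<le> \<phi> x \<and> \<phi> x \<le> 2 * exp (- x / 2)" if "x \<ge> 0" for x
  proof -
    have "0 \<le> \<phi> x \<and> \<phi> x \<le> exp (- hf 0 * x) / hf 0" unfolding \<phi>_def
    proof (rule alternating_sum_bounds)
      fix k
      have "- hf (Suc k) * x \<le> - hf k * x" using that by (intro mult_right_mono) (auto simp: hf_def)
      then show "exp (- hf (Suc k) * x) / hf (Suc k) \<le> exp (- hf k * x) / hf k"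
        by (intro frac_le) (auto simp: hf_def)
    qed (auto intro!: divide_nonneg_nonneg)
    then show ?thesis by (simp add: hf_def)
  qed
  have eq: "(\<Sum>k<N. (-1) ^ k * ((exp (- l * hf k) - exp (- l)) / hf k)) = \<phi> l - exp (- l) * \<phi> 0"
    unfolding \<phi>_def sum_distrib_left sum_subtractf[symmetric]
    by (intro sum.cong) (simp_all add: diff_divide_distrib algebra_simps)
  show ?thesis
  proof (cases "l \<le> 1")
    case True
    have "norm (\<phi> l - \<phi> 0) \<le> 2 * norm (l - 0)"
    proof (rule field_differentiable_bound[where S = "{0..}" and f' = "\<lambda>x. - (\<Sum>k<N. (-1) ^ k * exp (- hf k * x))"])
      show "(\<phi> has_field_derivative - (\<Sum>k<N. (-1) ^ k * exp (- hf k * x))) (at x within {0..})" for x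
      proof -
        have "(\<phi> has_field_derivative (\<Sum>k<N. (-1) ^ k * - exp (- hf k * x))) (at x within {0..})"
          unfolding \<phi>_def
        proof (rule DERIV_sum)
          fix k
          have "hf k \<noteq> 0" using hf_pos[of k] by linarith
          then show "((\<lambda>x. (-1) ^ k * (exp (- hf k * x) / hf k)) has_field_derivative (-1) ^ k * - exp (- hf k * x)) (at x within {0..})"
            by (auto intro!: derivative_eq_intros)
        qed
        then show ?thesis by (simp add: sum_negf)
      qed
      fix x :: real assume x: "x \<in> {0..}"
      then have "exp (- x / 2) \<le> 1" by simp
      then show "norm (- (\<Sum>k<N. (-1) ^ k * exp (- hf k * x))) \<le> 2"
        using gk_partial_sum_bound[of x N] x unfolding real_norm_def abs_minus_cancel atLeast_iff by linarith
    qed (use l in auto)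
    then have a: "\<bar>\<phi> l - \<phi> 0\<bar> \<le> 2 * l" using l by simp
    have "1 - exp (- l) \<le> l" using exp_ge_add_one_self[of "- l"] by linarith
    then have "(1 - exp (- l)) * \<phi> 0 \<le> l * 2" using \<phi>b[of 0] l by (intro mult_mono) auto
    moreover have "0 \<le> (1 - exp (- l)) * \<phi> 0" using \<phi>b[of 0] l by simp
    moreover have "\<phi> l - exp (- l) * \<phi> 0 = (\<phi> l - \<phi> 0) + (1 - exp (- l)) * \<phi> 0" by (simp add: algebra_simps)
    ultimately have "\<bar>\<phi> l - exp (- l) * \<phi> 0\<bar> \<le> 4 * l" using a by linarith
    then show ?thesis unfolding eq using min_inverse_le_weight(1)[OF l True] l by linarith
  next
    case False
    then have l1: "l \<ge> 1" by simp
    have "exp (- l) \<le> exp (- l / 2)" using l by simp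
    moreover have "exp (- l) * \<phi> 0 \<le> exp (- l) * 2" "0 \<le> exp (- l) * \<phi> 0" using \<phi>b[of 0] by simp_all
    moreover have "0 \<le> \<phi> l" "\<phi> l \<le> 2 * exp (- l / 2)" using \<phi>b[of l] l by auto
    ultimately have "\<bar>\<phi> l - exp (- l) * \<phi> 0\<bar> \<le> 2 * exp (- l / 2)" using exp_minus_half_le[OF l1] by linarith
    then show ?thesis unfolding eq using exp_minus_half_le[OF l1] exp_gt_zero[of "- l / 2"] by linarith
  qed
qed

text \<open>The finitely many nodes too close to z for the decay estimate are absorbed by adding
  their contributions to the constant.\<close>

lemma sinc_pair_remainder_bound:
  obtains c where "c \<ge> 0" "\<And>k. norm (sinc_pair k z - cos (of_real pi * z) * sinc_pair k 0) \<le> c / hf k ^ 3"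
proof -
  define E where "E = (\<lambda>k. norm (sinc_pair k z - cos (of_real pi * z) * sinc_pair k 0) * hf k ^ 3)"
  obtain N :: nat where N: "real N \<ge> 2 * norm z" using real_arch_simple by blast
  define B where "B = 3 * exp (pi * norm z) * (norm z)\<^sup>2"
  have "E k \<le> B + (\<Sum>k<N. E k)" for k
  proof (cases "k < N")
    case True
    then have "E k \<le> (\<Sum>k<N. E k)" by (intro member_le_sum) (auto simp: E_def)
    then show ?thesis by (simp add: B_def add_increasing)
  next
    case False
    then have "hf k \<ge> 2 * norm z" using N by (simp add: hf_def)
    from sinc_pair_remainder[OF order_refl this]
    have "E k \<le> B" unfolding E_def B_def using hf_pos[of k] by (simp add: pos_le_divide_eq)
    moreover have "0 \<le> (\<Sum>k<N. E k)" by (intro sum_nonneg) (auto simp: E_def)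
    ultimately show ?thesis by linarith
  qed
  then have "norm (sinc_pair k z - cos (of_real pi * z) * sinc_pair k 0) \<le> (B + (\<Sum>k<N. E k)) / hf k ^ 3" for k
    using hf_pos[of k] by (simp add: E_def pos_le_divide_eq)
  moreover have "B + (\<Sum>k<N. E k) \<ge> 0" by (intro add_nonneg_nonneg sum_nonneg) (auto simp: B_def E_def)
  ultimately show ?thesis using that by blast
qed

text \<open>Each pair is split into cos(pi z) times its value at 0 plus a remainder. The first parts
  form the scalar alternating sum with factor 2/pi and bound 16; the remainders are summed
  absolutely, 14 \<open>hf k\<close> against c/\<open>hf k\<close>^3. The constant depends on z but
  not on l or N, as dominated convergence demands.\<close>

lemma sinc_series_partial_bound:
  obtains C where "C \<ge> 0" "\<And>l N. l > 0 \<Longrightarrow>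
    norm (\<Sum>k<N. of_real (exp (- l * hf k) - exp (- l)) * sinc_pair k z) \<le> C * (l / (l\<^sup>2 + 1))"
proof -
  obtain c where c: "c \<ge> 0" "\<And>k. norm (sinc_pair k z - cos (of_real pi * z) * sinc_pair k 0) \<le> c / hf k ^ 3"
    using sinc_pair_remainder_bound by blast
  define S where "S = (\<Sum>k. 1 / hf k ^ 2)"
  define C where "C = norm (cos (of_real pi * z)) * (2 / pi * 16) + 14 * c * S"
  have S0: "S \<ge> 0" unfolding S_def by (intro suminf_nonneg summable_inverse_hf_square) simp
  show ?thesis
  proof
    show "C \<ge> 0" unfolding C_def using c(1) S0 by simp
    fix l :: real and N assume l: "l > 0"
    let ?t = "l / (l\<^sup>2 + 1)"
    let ?d = "\<lambda>k. exp (- l * hf k) - exp (- l)"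
    let ?E = "\<lambda>k. sinc_pair k z - cos (of_real pi * z) * sinc_pair k 0"
    have t0: "?t \<ge> 0" using l by (intro divide_nonneg_nonneg) auto
    have "(\<Sum>k<N. of_real (?d k) * sinc_pair k z)
      = cos (of_real pi * z) * (\<Sum>k<N. of_real (?d k) * sinc_pair k 0) + (\<Sum>k<N. of_real (?d k) * ?E k)"
      unfolding sum_distrib_left sum.distrib[symmetric] by (intro sum.cong) (simp_all add: algebra_simps)
    moreover have "(\<Sum>k<N. of_real (?d k) * sinc_pair k 0) = of_real (2 / pi * (\<Sum>k<N. (-1) ^ k * (?d k / hf k)))"
      unfolding sinc_pair_0 of_real_sum of_real_mult sum_distrib_left by (intro sum.cong) (simp_all add: mult_ac)
    moreover have "norm (complex_of_real (2 / pi * (\<Sum>k<N. (-1) ^ k * (?d k / hf k)))) \<le> 2 / pi * (16 * ?t)"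
      unfolding norm_of_real abs_mult using alternating_exp_diff_bound[OF l, of N] by (intro mult_mono) auto
    moreover have "norm (\<Sum>k<N. of_real (?d k) * ?E k) \<le> 14 * c * ?t * S"
    proof -
      have "norm (of_real (?d k) * ?E k) \<le> 14 * c * ?t * (1 / hf k ^ 2)" for k
      proof -
        have "norm (of_real (?d k) * ?E k) \<le> (14 * hf k * ?t) * (c / hf k ^ 3)"
          unfolding norm_mult norm_of_real
          by (rule mult_mono[OF exp_diff_hf_le_weight[OF l] c(2)]) (intro mult_nonneg_nonneg t0, simp_all)
        also have "\<dots> = 14 * c * ?t * (1 / hf k ^ 2)"
          using hf_pos[of k] by (simp add: power3_eq_cube power2_eq_square)
        finally show ?thesis .
      qed
      then have "norm (\<Sum>k<N. of_real (?d k) * ?E k) \<le> (\<Sum>k<N. 14 * c * ?t * (1 / hf k ^ 2))"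
        by (intro order_trans[OF norm_sum] sum_mono)
      also have "\<dots> = 14 * c * ?t * (\<Sum>k<N. 1 / hf k ^ 2)" by (simp only: sum_distrib_left)
      also have "\<dots> \<le> 14 * c * ?t * S" unfolding S_def
      proof (rule mult_left_mono)
        show "0 \<le> 14 * c * ?t" by (intro mult_nonneg_nonneg t0 c(1)) simp
      qed (intro sum_le_suminf summable_inverse_hf_square, auto)
      finally show ?thesis .
    qed
    ultimately have "norm (\<Sum>k<N. of_real (?d k) * sinc_pair k z)
      \<le> norm (cos (of_real pi * z)) * (2 / pi * (16 * ?t)) + 14 * c * ?t * S"
    proof -
      have "norm u \<le> norm v * p + q" if "u = v * X + Y" "X = w" "norm w \<le> p" "norm Y \<le> q" for u v w X Y :: complex and p q
      proof -
        have "norm u \<le> norm v * norm X + norm Y" unfolding that(1) by (metis norm_triangle_ineq norm_mult)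
        also have "\<dots> \<le> norm v * p + q" using that by (intro add_mono mult_left_mono) auto
        finally show ?thesis .
      qed
      then show ?thesis
        using \<open>(\<Sum>k<N. of_real (?d k) * sinc_pair k z) = _\<close> \<open>(\<Sum>k<N. of_real (?d k) * sinc_pair k 0) = _\<close>
          \<open>norm (complex_of_real (2 / pi * (\<Sum>k<N. (-1) ^ k * (?d k / hf k)))) \<le> _\<close> \<open>norm (\<Sum>k<N. of_real (?d k) * ?E k) \<le> _\<close>
        by blast
    qed
    also have "\<dots> = C * ?t" unfolding C_def distrib_right by (simp only: mult_ac)
    finally show "norm (\<Sum>k<N. of_real (?d k) * sinc_pair k z) \<le> C * ?t" .
  qed
qed

section \<open>Integration against the measure\<close>

lemma ext_int_integrable:
  assumes g: "integrable M g" shows "ext_int M g = ereal (LINT l|M. g l)"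
proof -
  have "(\<integral>\<^sup>+ l. ennreal (g l) \<partial>M) \<noteq> \<infinity>" "(\<integral>\<^sup>+ l. ennreal (- g l) \<partial>M) \<noteq> \<infinity>"
    using g by (auto simp: real_integrable_def)
  then obtain a b where ab: "a \<ge> 0" "b \<ge> 0" "(\<integral>\<^sup>+ l. ennreal (g l) \<partial>M) = ennreal a" "(\<integral>\<^sup>+ l. ennreal (- g l) \<partial>M) = ennreal b"
    by (metis ennreal_cases infinity_ennreal_def)
  then show ?thesis unfolding ext_int_def real_lebesgue_integral_def[OF g] ab(3,4) by (simp add: enn2ereal_ennreal)
qed

lemma ext_int_nonneg:
  assumes "\<And>l. l \<in> space M \<Longrightarrow> g l \<ge> 0"
  shows "ext_int M g = enn2ereal (\<integral>\<^sup>+ l. ennreal (g l) \<partial>M)"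
proof -
  have "(\<integral>\<^sup>+ l. ennreal (- g l) \<partial>M) = (\<integral>\<^sup>+ l. 0 \<partial>M)"
    by (rule nn_integral_cong) (use assms in \<open>simp add: ennreal_neg\<close>)
  then show ?thesis unfolding ext_int_def by (simp add: zero_ennreal.rep_eq)
qed

lemma ext_int_eq_infinity:
  assumes nn: "\<And>l. l \<in> space M \<Longrightarrow> g l \<ge> 0" and m: "g \<in> borel_measurable M" and ni: "\<not> integrable M g"
  shows "ext_int M g = \<infinity>"
proof -
  have "(\<integral>\<^sup>+ l. ennreal (g l) \<partial>M) = \<infinity>"
  proof (rule ccontr)
    assume "(\<integral>\<^sup>+ l. ennreal (g l) \<partial>M) \<noteq> \<infinity>"
    then have "integrable M g"
      using nn m by (intro integrableI_nonneg AE_I2) (auto simp: less_top)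
    then show False using ni by contradiction
  qed
  then show ?thesis by (subst ext_int_nonneg) (rule nn, assumption, simp)
qed

text \<open>The extremal theory at type \<open>pi\<close> is developed for one such measure. It is
  instantiated for both \<mu> and \<nu>, the extremal statements being used for \<nu>.\<close>

locale decay_measure =
  fixes \<rho> :: "real measure"
  assumes sets_rho: "sets \<rho> = sets (restrict_space borel {0<..})"
    and weight_integrable: "integrable \<rho> (\<lambda>l. l / (l\<^sup>2 + 1))"
begin

lemma space_rho: "space \<rho> = {0<..}"
  using sets_eq_imp_space_eq[OF sets_rho] by (simp add: space_restrict_space)

lemma measurable_rho: "f \<in> borel_measurable borel \<Longrightarrow> f \<in> borel_measurable \<rho>"
  by (subst measurable_cong_sets[OF sets_rho refl]) (rule measurable_restrict_space1)

lemma weight_bound_integrable: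
  fixes f :: "real \<Rightarrow> 'b :: {banach, second_countable_topology}"
  assumes m: "f \<in> borel_measurable \<rho>" and b: "\<And>l. l > 0 \<Longrightarrow> norm (f l) \<le> C * (l / (l\<^sup>2 + 1))"
  shows "integrable \<rho> f"
proof (rule Bochner_Integration.integrable_bound[OF integrable_mult_right[OF weight_integrable, of C] m], rule AE_I2)
  fix l assume "l \<in> space \<rho>"
  then have "norm (f l) \<le> C * (l / (l\<^sup>2 + 1))" by (intro b) (simp add: space_rho)
  then show "norm (f l) \<le> norm (C * (l / (l\<^sup>2 + 1)))" unfolding real_norm_def by linarith
qed

lemma weight_bound_integral:
  fixes f :: "real \<Rightarrow> 'b :: {banach, second_countable_topology}"
  assumes m: "f \<in> borel_measurable \<rho>" and b: "\<And>l. l > 0 \<Longrightarrow> norm (f l) \<le> C * (l / (l\<^sup>2 + 1))"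
  shows "norm (LINT l|\<rho>. f l) \<le> C * (LINT l|\<rho>. l / (l\<^sup>2 + 1))"
proof -
  have "norm (LINT l|\<rho>. f l) \<le> (LINT l|\<rho>. norm (f l))" by (rule integral_norm_bound)
  also have "\<dots> \<le> (LINT l|\<rho>. C * (l / (l\<^sup>2 + 1)))"
  proof (rule integral_mono[OF integrable_norm[OF weight_bound_integrable[OF m]] integrable_mult_right[OF weight_integrable]])
    show "norm (f l) \<le> C * (l / (l\<^sup>2 + 1))" if "l \<in> space \<rho>" for l
      using that by (intro b) (simp add: space_rho)
  qed (rule b)
  finally show ?thesis by (simp only: integral_mult_right_zero)
qed

text \<open>The superlevel sets of the weight have finite measure by Markov's inequality, and they
  exhaust the half line because the weight is positive. Needed for Fubini.\<close>

lemma sigma_finite_rho: "sigma_finite_measure \<rho>"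
proof
  define A where "A = (\<lambda>n::nat. {l \<in> space \<rho>. l / (l\<^sup>2 + 1) \<ge> 1 / real (Suc n)})"
  have m: "(\<lambda>l. l / (l\<^sup>2 + 1)) \<in> borel_measurable \<rho>" using weight_integrable by (rule borel_measurable_integrable)
  have "A n \<in> sets \<rho>" for n unfolding A_def using m by measurable
  moreover have "(\<Union>n. A n) = space \<rho>"
  proof
    show "space \<rho> \<subseteq> (\<Union>n. A n)"
    proof
      fix l assume l: "l \<in> space \<rho>"
      then have "l / (l\<^sup>2 + 1) > 0" by (intro divide_pos_pos) (auto simp: space_rho add_nonneg_pos)
      then obtain n where "1 / real (Suc n) < l / (l\<^sup>2 + 1)" using nat_approx_posE by blast
      then show "l \<in> (\<Union>n. A n)" using l by (auto simp: A_def intro!: exI[of _ n])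
    qed
  qed (auto simp: A_def)
  moreover have "emeasure \<rho> (A n) \<noteq> \<infinity>" for n
  proof -
    have "emeasure \<rho> {l \<in> space \<rho>. l / (l\<^sup>2 + 1) \<ge> 1 / real (Suc n)} \<le> ennreal (1 / (1 / real (Suc n)) * (LINT l|\<rho>. l / (l\<^sup>2 + 1)))"
      by (rule integral_Markov_inequality[OF weight_integrable])
        (auto simp: space_rho intro!: AE_I2 divide_nonneg_nonneg)
    then show ?thesis unfolding A_def by (metis ennreal_less_top infinity_ennreal_def leD)
  qed
  ultimately show "\<exists>A. countable A \<and> A \<subseteq> sets \<rho> \<and> \<Union> A = space \<rho> \<and> (\<forall>a\<in>A. emeasure \<rho> a \<noteq> \<infinity>)"
    by (intro exI[of _ "range A"]) auto
qed

lemma exp_diff_measurable: "(\<lambda>l. exp (- l * a) - exp (- l)) \<in> borel_measurable \<rho>"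
  by (rule measurable_rho) measurable

lemma exp_diff_integrable:
  assumes "x \<noteq> 0" shows "integrable \<rho> (\<lambda>l. exp (- l * \<bar>x\<bar>) - exp (- l))"
  by (rule weight_bound_integrable[OF exp_diff_measurable]) (use exp_diff_le_weight[of _ "\<bar>x\<bar>"] assms in simp)

text \<open>Integrability can fail only at x = 0. There the integrand 1 - exp(-l) is nonnegative, so
  the extended integral is genuinely infinite and not a difference of two infinities.\<close>

lemma f_rho_eq_infinity:
  assumes "\<not> integrable \<rho> (\<lambda>l. exp (- l * \<bar>x\<bar>) - exp (- l))"
  shows "x = 0" "f_rho \<rho> x = \<infinity>"
proof -
  show x: "x = 0" using assms exp_diff_integrable by blast
  show "f_rho \<rho> x = \<infinity>"
    unfolding f_rho_def by (rule ext_int_eq_infinity[OF _ exp_diff_measurable assms]) (simp add: x space_rho)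
qed

text \<open>At \<^term>\<open>x = 0\<close> the function \<^term>\<open>f_rho \<rho>\<close> may be infinite; both sides are then \<^term>\<open>0\<close>.\<close>

lemma fr_eq: "fr \<rho> x = (LINT l|\<rho>. exp (- l * \<bar>x\<bar>) - exp (- l))"
proof (cases "integrable \<rho> (\<lambda>l. exp (- l * \<bar>x\<bar>) - exp (- l))")
  case True
  then show ?thesis unfolding fr_def f_rho_def ext_int_integrable[OF True] by simp
next
  case False
  then show ?thesis
    unfolding fr_def f_rho_eq_infinity(2)[OF False] using not_integrable_integral_eq[OF False]
    by (simp only: real_of_ereal.simps)
qed

lemma f_rho_cases:
  "f_rho \<rho> x = (if integrable \<rho> (\<lambda>l. exp (- l * \<bar>x\<bar>) - exp (- l)) then ereal (fr \<rho> x) else \<infinity>)"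
  using f_rho_eq_infinity(2) by (auto simp: fr_eq f_rho_def ext_int_integrable)

lemma f_rho_eq:
  assumes "x \<noteq> 0" shows "f_rho \<rho> x = ereal (fr \<rho> x)"
  unfolding f_rho_def fr_eq ext_int_integrable[OF exp_diff_integrable[OF assms]] by (rule refl)

text \<open>Measurability in l is read off from the series over pairs, which represents
  \<open>K_lam\<close> for l > 0, that is, on the whole space of \<open>\<rho>\<close>.\<close>

lemma K_lam_measurable_rho: "(\<lambda>l. K_lam l z) \<in> borel_measurable \<rho>"
proof -
  have "(\<lambda>l. \<Sum>k. of_real (exp (- l * hf k)) * sinc_pair k z) \<in> borel_measurable \<rho>"
    by (rule measurable_rho) measurable
  then show ?thesis by (rule measurable_cong[THEN iffD2, rotated]) (auto simp: space_rho K_lam_eq)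
qed

lemma K_lam_diff_measurable: "(\<lambda>l. K_lam l z - of_real (exp (- l))) \<in> borel_measurable \<rho>"
  by (rule borel_measurable_diff[OF K_lam_measurable_rho measurable_rho]) measurable

lemma K_lam_diff_integrable: "integrable \<rho> (\<lambda>l. K_lam l z - of_real (exp (- l)))"
  by (rule weight_bound_integrable[OF K_lam_diff_measurable, where C = "20 * ((1 + norm z) * exp (pi * norm z))"])
    (use norm_K_lam_minus_exp_le[of _ z] in \<open>simp add: mult_ac\<close>)

text \<open>The alternating cancellation in \<^term>\<open>sinc_pair\<close> provides the dominating function that allows
  the sampling series of the integral to be computed under the integral sign.\<close>

lemma sampling_partial_sum_LIMSEQ:
  "(\<lambda>N. \<Sum>k<N. of_real (fr \<rho> (hf k)) * sinc_pair k z) \<longlonglongrightarrow> (LINT l|\<rho>. K_lam l z - of_real (exp (- l)))"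
proof -
  define s where "s = (\<lambda>N l. \<Sum>k<N. of_real (exp (- l * hf k) - exp (- l)) * sinc_pair k z)"
  obtain C where C: "\<And>l N. l > 0 \<Longrightarrow> norm (s N l) \<le> C * (l / (l\<^sup>2 + 1))"
    unfolding s_def using sinc_series_partial_bound by metis
  have sm: "s N \<in> borel_measurable \<rho>" for N unfolding s_def by (rule measurable_rho) measurable
  have "(\<lambda>N. LINT l|\<rho>. s N l) \<longlonglongrightarrow> (LINT l|\<rho>. K_lam l z - of_real (exp (- l)))"
  proof (rule integral_dominated_convergence[OF K_lam_diff_measurable sm integrable_mult_right[OF weight_integrable, of C]])
    show "AE l in \<rho>. (\<lambda>N. s N l) \<longlonglongrightarrow> K_lam l z - of_real (exp (- l))"
    proof (rule AE_I2)
      fix l assume "l \<in> space \<rho>"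
      then have l: "l > 0" by (simp add: space_rho)
      have "(\<lambda>k. of_real (exp (- l * hf k)) * sinc_pair k z - of_real (exp (- l)) * sinc_pair k z) sums (K_lam l z - of_real (exp (- l)) * 1)"
        unfolding K_lam_eq[OF l]
        by (rule sums_diff[OF summable_sums[OF summable_norm_cancel[OF K_lam_summable_norm[OF l]]] sums_mult[OF sinc_pair_sums_1]])
      then show "(\<lambda>N. s N l) \<longlonglongrightarrow> K_lam l z - of_real (exp (- l))"
        unfolding s_def by (simp add: sums_def left_diff_distrib)
    qed
    show "AE l in \<rho>. norm (s N l) \<le> C * (l / (l\<^sup>2 + 1))" for N
      by (rule AE_I2, rule C) (simp add: space_rho)
  qed
  moreover have "(LINT l|\<rho>. s N l) = (\<Sum>k<N. of_real (fr \<rho> (hf k)) * sinc_pair k z)" for N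
  proof -
    have i: "integrable \<rho> (\<lambda>l. exp (- l * hf k) - exp (- l))" for k
      using exp_diff_integrable[of "hf k"] hf_pos[of k] by (simp add: less_imp_neq[symmetric])
    have "(LINT l|\<rho>. s N l) = (\<Sum>k<N. LINT l|\<rho>. of_real (exp (- l * hf k) - exp (- l)) * sinc_pair k z)"
      unfolding s_def by (rule Bochner_Integration.integral_sum) (intro integrable_mult_left integrable_of_real i)
    also have "\<dots> = (\<Sum>k<N. of_real (fr \<rho> (hf k)) * sinc_pair k z)"
      unfolding fr_eq by (simp only: integral_mult_left_zero integral_complex_of_real abs_of_nonneg[OF hf_nonneg])
    finally show ?thesis .
  qed
  ultimately show ?thesis by simp
qed

text \<open>Shows that the \<open>lim\<close> in the definition of \<open>K_rho\<close> is an actual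
  limit; sums up to N inclusive are the sums below N + 1.\<close>

lemma K_rho_eq_integral: "K_rho \<rho> z = (LINT l|\<rho>. K_lam l z - of_real (exp (- l)))"
  unfolding K_rho_eq
  by (rule limI) (use LIMSEQ_Suc[OF sampling_partial_sum_LIMSEQ[of z]] in \<open>simp only: lessThan_Suc_atMost\<close>)

text \<open>Holomorphy comes from the sampling series, not from differentiation under the integral
  sign.\<close>

lemma K_rho_holomorphic: "K_rho \<rho> holomorphic_on UNIV"
proof -
  define A where "A = 14 * (LINT l|\<rho>. l / (l\<^sup>2 + 1))"
  have bd: "\<bar>fr \<rho> (hf k)\<bar> \<le> A * hf k" for k
  proof -
    have "norm (LINT l|\<rho>. exp (- l * \<bar>hf k\<bar>) - exp (- l)) \<le> (14 * hf k) * (LINT l|\<rho>. l / (l\<^sup>2 + 1))"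
      by (rule weight_bound_integral[OF exp_diff_measurable]) (use exp_diff_hf_le_weight[of _ k] in simp)
    then show ?thesis unfolding fr_eq A_def by (simp only: real_norm_def mult_ac)
  qed
  have sums: "(\<lambda>k. of_real (fr \<rho> (hf k)) * sinc_pair k z) sums K_rho \<rho> z" for z
    unfolding sums_def K_rho_eq_integral by (rule sampling_partial_sum_LIMSEQ)
  have "(\<lambda>k. of_real (fr \<rho> (hf k)) * sinc_pair k 0) = (\<lambda>k. complex_of_real (2 / pi * ((-1) ^ k * (fr \<rho> (hf k) / hf k))))"
    unfolding sinc_pair_0 by (simp add: fun_eq_iff)
  \<comment> \<open>Convergence of the sampling series at z = 0 is, up to the factor 2/pi, the
    alternating condition required of the coefficients.\<close>
  then have "summable (\<lambda>k. complex_of_real (2 / pi * ((-1) ^ k * (fr \<rho> (hf k) / hf k))))"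
    using sums_summable[OF sums[of 0]] by (simp only:)
  then have "summable (\<lambda>k. 2 / pi * ((-1) ^ k * (fr \<rho> (hf k) / hf k)))"
    by (drule_tac summable_Re) simp
  then have "summable (\<lambda>k. pi / 2 * (2 / pi * ((-1) ^ k * (fr \<rho> (hf k) / hf k))))" by (rule summable_mult)
  then have conv: "summable (\<lambda>k. (-1) ^ k * (fr \<rho> (hf k) / hf k))" by simp
  have "K_rho \<rho> = (\<lambda>z. \<Sum>k. of_real (fr \<rho> (hf k)) * sinc_pair k z)"
    using sums by (auto simp: sums_iff)
  then show ?thesis using sinc_series_holomorphic[OF bd conv] by (simp only:)
qed

lemma K_rho_exp_type: "exp_type_le (K_rho \<rho>) pi"
proof (rule exp_type_leI[OF K_rho_holomorphic, where C = "20 * (LINT l|\<rho>. l / (l\<^sup>2 + 1))"])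
  show "0 \<le> 20 * (LINT l|\<rho>. l / (l\<^sup>2 + 1))"
    by (intro mult_nonneg_nonneg integral_nonneg_AE AE_I2 divide_nonneg_nonneg) (auto simp: space_rho)
  fix z
  have "norm (K_rho \<rho> z) \<le> (20 * ((1 + norm z) * exp (pi * norm z))) * (LINT l|\<rho>. l / (l\<^sup>2 + 1))"
    unfolding K_rho_eq_integral
    by (rule weight_bound_integral[OF K_lam_diff_measurable]) (use norm_K_lam_minus_exp_le[of _ z] in \<open>simp add: mult_ac\<close>)
  then show "norm (K_rho \<rho> z) \<le> 20 * (LINT l|\<rho>. l / (l\<^sup>2 + 1)) * (1 + norm z) * exp (pi * norm z)"
    by (simp only: mult_ac)
qed simp

lemma K_rho_of_real:
  "K_rho \<rho> (of_real x) = of_real (Re (K_rho \<rho> (of_real x)))"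
  "integrable \<rho> (\<lambda>l. Re (K_lam l (of_real x)) - exp (- l))"
  "Re (K_rho \<rho> (of_real x)) = (LINT l|\<rho>. Re (K_lam l (of_real x)) - exp (- l))"
proof -
  have i: "integrable \<rho> (\<lambda>l. K_lam l (of_real x) - of_real (exp (- l)))" by (rule K_lam_diff_integrable)
  from integrable_Re[OF i] show "integrable \<rho> (\<lambda>l. Re (K_lam l (of_real x)) - exp (- l))" by simp
  have "K_rho \<rho> (of_real x) = (LINT l|\<rho>. complex_of_real (Re (K_lam l (of_real x)) - exp (- l)))"
    unfolding K_rho_eq_integral
    by (intro Bochner_Integration.integral_cong refl) (auto simp: space_rho K_lam_of_real)
  also have "\<dots> = of_real (LINT l|\<rho>. Re (K_lam l (of_real x)) - exp (- l))" by (rule integral_complex_of_real)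
  finally have eq: "K_rho \<rho> (of_real x) = of_real (LINT l|\<rho>. Re (K_lam l (of_real x)) - exp (- l))" .
  then show "Re (K_rho \<rho> (of_real x)) = (LINT l|\<rho>. Re (K_lam l (of_real x)) - exp (- l))" by simp
  show "K_rho \<rho> (of_real x) = of_real (Re (K_rho \<rho> (of_real x)))" unfolding eq by simp
qed

lemma K_gap_eq_diff: "K_gap l x = (exp (- l * \<bar>x\<bar>) - exp (- l)) - (Re (K_lam l (of_real x)) - exp (- l))"
  by (simp add: K_gap_def)

lemma K_gap_measurable_rho: "(\<lambda>l. K_gap l x) \<in> borel_measurable \<rho>"
  unfolding K_gap_eq_diff
  by (rule borel_measurable_diff[OF exp_diff_measurable borel_measurable_integrable[OF K_rho_of_real(2)]])

lemma K_gap_integrable_rho: "x \<noteq> 0 \<Longrightarrow> integrable \<rho> (\<lambda>l. K_gap l x)"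
  unfolding K_gap_eq_diff by (intro Bochner_Integration.integrable_diff exp_diff_integrable K_rho_of_real(2))

lemma K_gap_integral_rho: "x \<noteq> 0 \<Longrightarrow> (LINT l|\<rho>. K_gap l x) = fr \<rho> x - Re (K_rho \<rho> (of_real x))"
  unfolding K_gap_eq_diff fr_eq K_rho_of_real(3)
  by (intro Bochner_Integration.integral_diff exp_diff_integrable K_rho_of_real(2))

text \<open>If f is infinite then x = 0, where cos(pi x) = 1 makes the error nonnegative for every
  l; its extended integral is therefore infinite as well, because the \<open>K_rho\<close> part is
  finite.\<close>

lemma f_rho_minus_K_rho: "f_rho \<rho> x - ereal (Re (K_rho \<rho> (of_real x))) = ext_int \<rho> (\<lambda>l. K_gap l x)"
proof (cases "integrable \<rho> (\<lambda>l. exp (- l * \<bar>x\<bar>) - exp (- l))")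
  case True
  have i: "integrable \<rho> (\<lambda>l. K_gap l x)"
    unfolding K_gap_eq_diff by (intro Bochner_Integration.integrable_diff True K_rho_of_real(2))
  have "(LINT l|\<rho>. K_gap l x) = (LINT l|\<rho>. exp (- l * \<bar>x\<bar>) - exp (- l)) - Re (K_rho \<rho> (of_real x))"
    unfolding K_gap_eq_diff K_rho_of_real(3) by (intro Bochner_Integration.integral_diff True K_rho_of_real(2))
  then show ?thesis unfolding f_rho_def ext_int_integrable[OF True] ext_int_integrable[OF i] by simp
next
  case False
  note f_rho_eq_infinity[OF False]
  moreover have "ext_int \<rho> (\<lambda>l. K_gap l x) = \<infinity>"
  proof (rule ext_int_eq_infinity[OF _ K_gap_measurable_rho])
    show "K_gap l x \<ge> 0" if "l \<in> space \<rho>" for l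
      using K_gap_sgn[of l 0] that by (simp add: space_rho f_rho_eq_infinity(1)[OF False])
    show "\<not> integrable \<rho> (\<lambda>l. K_gap l x)"
    proof
      assume "integrable \<rho> (\<lambda>l. K_gap l x)"
      from Bochner_Integration.integrable_add[OF this K_rho_of_real(2)[of x]] show False
        using False by (simp add: K_gap_def)
    qed
  qed
  ultimately show ?thesis by simp
qed

end

section \<open>The integrated error: Fubini, L1 norm and Fourier transform\<close>

text \<open>The L1 norm of \<open>K_gap l\<close> over the real line, for l > 0.\<close>

definition gap_norm :: "real \<Rightarrow> real" where "gap_norm l = 2 / l - 2 / (l * cosh (l / 2))"

text \<open>With A = exp(-l/2) the value is 2 (1-A)^2/(l (1+A^2)). Here 1 - A is at most l/2, which
  serves small l, and at most 1, which serves large l.\<close>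

lemma gap_norm_bounds:
  assumes l: "l > 0"
  shows "0 \<le> gap_norm l" "gap_norm l \<le> 4 * (l / (l\<^sup>2 + 1))"
proof -
  define A where "A = exp (- l / 2)"
  have A: "A > 0" "A \<le> 1" using l by (simp_all add: A_def)
  have ch: "cosh (l / 2) = (1 + A\<^sup>2) / (2 * A)"
    unfolding cosh_field_def A_def by (simp add: exp_minus field_simps power2_eq_square)
  have p: "1 + A\<^sup>2 > 0" "1 + A\<^sup>2 \<ge> 1" by (simp_all add: add_pos_nonneg)
  have "2 / (l * cosh (l / 2)) = 2 * (2 * A) / (l * (1 + A\<^sup>2))" unfolding ch using A p by simp
  also have "2 / l - \<dots> = (2 * (1 + A\<^sup>2) - 2 * (2 * A)) / (l * (1 + A\<^sup>2))"
  proof -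
    have "2 / l = 2 * (1 + A\<^sup>2) / (l * (1 + A\<^sup>2))"
      by (rule mult_divide_mult_cancel_right[symmetric]) (use p(1) in linarith)
    then show ?thesis by (simp only: diff_divide_distrib)
  qed
  also have "2 * (1 + A\<^sup>2) - 2 * (2 * A) = 2 * (1 - A)\<^sup>2" by (simp add: power2_eq_square algebra_simps)
  finally have e: "gap_norm l = 2 * (1 - A)\<^sup>2 / (l * (1 + A\<^sup>2))" unfolding gap_norm_def .
  show "0 \<le> gap_norm l" unfolding e using l p by (intro divide_nonneg_nonneg mult_nonneg_nonneg) auto
  have "l * 1 \<le> l * (1 + A\<^sup>2)" using l p by (intro mult_left_mono) auto
  then have b: "gap_norm l \<le> 2 * (1 - A)\<^sup>2 / l" unfolding e using l by (intro divide_left_mono) (auto simp: add_pos_nonneg)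
  have t0: "l / (l\<^sup>2 + 1) \<ge> 0" using l by (intro divide_nonneg_nonneg) auto
  show "gap_norm l \<le> 4 * (l / (l\<^sup>2 + 1))"
  proof (cases "l \<le> 1")
    case True
    have "1 - A \<le> l / 2" using exp_ge_add_one_self[of "- l / 2"] by (simp add: A_def)
    then have "(1 - A)\<^sup>2 \<le> (l / 2)\<^sup>2" using A by (intro power_mono) auto
    then have "2 * (1 - A)\<^sup>2 / l \<le> 2 * (l / 2)\<^sup>2 / l" using l by (intro divide_right_mono) auto
    also have "\<dots> = l / 2" using l by (simp add: power2_eq_square)
    finally have "gap_norm l \<le> l / 2" using b by linarith
    then have "gap_norm l \<le> l" using l by linarith
    then show ?thesis using min_inverse_le_weight(1)[OF l True] t0 by linarith
  next
    case False
    then have l1: "l \<ge> 1" by simp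
    have "(1 - A)\<^sup>2 \<le> 1\<^sup>2" using A by (intro power_mono) auto
    then have "2 * (1 - A)\<^sup>2 / l \<le> 2 * 1 / l" using l by (intro divide_right_mono) auto
    then have "gap_norm l \<le> 2 * (1 / l)" using b by simp
    then show ?thesis using min_inverse_le_weight(2)[OF l l1] by linarith
  qed
qed

lemma AE_lborel_obtains:
  fixes a b :: real
  assumes ae: "AE x in lborel. P x" and ab: "a < b"
  obtains x where "a < x" "x < b" "P x"
proof -
  have "\<exists>x. a < x \<and> x < b \<and> P x"
  proof (rule ccontr)
    assume c: "\<not> ?thesis"
    have "AE x in lborel. x \<notin> {a<..<b}" using ae by eventually_elim (use c in auto)
    then have "{a<..<b} \<in> null_sets lborel" by (subst AE_iff_null_sets) auto
    then show False using ab by (simp add: null_sets_def)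
  qed
  then show ?thesis using that by blast
qed

lemma exp_type_le_diff:
  assumes "exp_type_le F \<sigma>" "exp_type_le G \<sigma>"
  shows "exp_type_le (\<lambda>z. F z - G z) \<sigma>"
  unfolding exp_type_le_def
proof (intro conjI allI impI)
  show "(\<lambda>z. F z - G z) holomorphic_on UNIV"
    using assms by (intro holomorphic_intros) (auto simp: exp_type_le_def)
  fix \<epsilon> :: real assume "\<epsilon> > 0"
  then obtain A B where AB: "\<And>z. norm (F z) \<le> A * exp ((\<sigma> + \<epsilon>) * norm z)" "\<And>z. norm (G z) \<le> B * exp ((\<sigma> + \<epsilon>) * norm z)"
    using assms unfolding exp_type_le_def by meson
  have "norm (F z - G z) \<le> (A + B) * exp ((\<sigma> + \<epsilon>) * norm z)" for z
    unfolding distrib_right[of A B] by (rule order_trans[OF norm_triangle_ineq4 add_mono[OF AB]])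
  then show "\<exists>C. \<forall>z. norm (F z - G z) \<le> C * exp ((\<sigma> + \<epsilon>) * norm z)" by blast
qed

context decay_measure
begin

lemma gap_norm_integrable: "integrable \<rho> gap_norm"
proof (rule weight_bound_integrable[where C = 4])
  show "gap_norm \<in> borel_measurable \<rho>" unfolding gap_norm_def[abs_def] cosh_field_def by (rule measurable_rho) measurable
  show "norm (gap_norm l) \<le> 4 * (l / (l\<^sup>2 + 1))" if "l > 0" for l
    using gap_norm_bounds[OF that] unfolding real_norm_def by linarith
qed

lemma pair_sigma_finite_rho: "pair_sigma_finite \<rho> lborel"
  by (intro pair_sigma_finite.intro sigma_finite_rho lborel.sigma_finite_measure_axioms)

lemma K_gap_pair_measurable: "(\<lambda>(l, x). K_gap l x) \<in> borel_measurable (\<rho> \<Otimes>\<^sub>M lborel)"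
proof -
  have id: "(\<lambda>l. l) \<in> borel_measurable \<rho>" by (rule measurable_rho) measurable
  have [measurable]: "(\<lambda>p. fst p) \<in> borel_measurable (\<rho> \<Otimes>\<^sub>M lborel)"
    by (rule measurable_compose[OF measurable_fst id])
  have [measurable]: "sinc_pair k \<in> borel_measurable borel" for k
    by (intro borel_measurable_continuous_onI holomorphic_on_imp_continuous_on sinc_pair_holomorphic)
  have "(\<lambda>p. exp (- fst p * \<bar>snd p\<bar>) - Re (\<Sum>k. of_real (exp (- fst p * hf k)) * sinc_pair k (of_real (snd p)))) \<in> borel_measurable (\<rho> \<Otimes>\<^sub>M lborel)"
    by measurable
  then show ?thesis
    by (rule measurable_cong[THEN iffD2, rotated]) (auto simp: space_pair_measure space_rho K_gap_def K_lam_eq)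
qed

text \<open>The inner L1 norm over x is known exactly as \<open>gap_norm\<close>, and that is
  integrable against the measure.\<close>

lemma K_gap_pair_integrable: "integrable (\<rho> \<Otimes>\<^sub>M lborel) (\<lambda>(l, x). K_gap l x)"
proof (rule pair_sigma_finite.Fubini_integrable[OF pair_sigma_finite_rho K_gap_pair_measurable])
  have "integrable \<rho> (\<lambda>l. LINT x|lborel. \<bar>K_gap l x\<bar>) \<longleftrightarrow> integrable \<rho> gap_norm"
    by (rule Bochner_Integration.integrable_cong) (auto simp: space_rho gap_norm_def K_gap_abs_integral)
  then show "integrable \<rho> (\<lambda>l. LINT x|lborel. norm (case (l, x) of (l, x) \<Rightarrow> K_gap l x))"
    using gap_norm_integrable by simp
  show "AE l in \<rho>. integrable lborel (\<lambda>x. case (l, x) of (l, x) \<Rightarrow> K_gap l x)"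
    by (auto simp: space_rho K_gap_integrable)
qed

text \<open>The approximation error at type \<open>pi\<close>. If f is infinite at 0,
  \<open>fr\<close> takes the default value 0 there, which affects one point only.\<close>

definition err :: "real \<Rightarrow> real" where "err x = fr \<rho> x - Re (K_rho \<rho> (of_real x))"

lemma err_eq: "x \<noteq> 0 \<Longrightarrow> err x = (LINT l|\<rho>. K_gap l x)"
  unfolding err_def by (rule K_gap_integral_rho[symmetric])

text \<open>All the errors \<open>K_gap l x\<close> share the sign of cos(pi x), so integration over
  l causes no cancellation. At the zeros of the cosine every one of them vanishes.\<close>

lemma err_sgn_abs:
  assumes x: "x \<noteq> 0"
  shows "err x * sgn (cos (pi * x)) = (LINT l|\<rho>. \<bar>K_gap l x\<bar>)" "err x * sgn (cos (pi * x)) = \<bar>err x\<bar>"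
proof -
  have "err x * sgn (cos (pi * x)) = (LINT l|\<rho>. K_gap l x * sgn (cos (pi * x)))"
    unfolding err_eq[OF x] by (rule integral_mult_left_zero[symmetric])
  also have "\<dots> = (LINT l|\<rho>. \<bar>K_gap l x\<bar>)"
    by (intro Bochner_Integration.integral_cong refl K_gap_sgn) (simp add: space_rho)
  finally show 1: "err x * sgn (cos (pi * x)) = (LINT l|\<rho>. \<bar>K_gap l x\<bar>)" .
  show "err x * sgn (cos (pi * x)) = \<bar>err x\<bar>"
  proof (cases "cos (pi * x) = 0")
    case True
    have "(LINT l|\<rho>. K_gap l x) = (LINT l|\<rho>. 0)"
    proof (intro Bochner_Integration.integral_cong refl)
      fix l assume "l \<in> space \<rho>"
      then have "\<bar>K_gap l x\<bar> = 0" using K_gap_sgn[of l x] True by (simp add: space_rho)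
      then show "K_gap l x = 0" by simp
    qed
    then show ?thesis using err_eq[OF x] by simp
  next
    case False
    have "0 \<le> err x * sgn (cos (pi * x))" unfolding 1 by (intro integral_nonneg_AE) auto
    then have "err x * sgn (cos (pi * x)) = \<bar>err x * sgn (cos (pi * x))\<bar>" by simp
    also have "\<dots> = \<bar>err x\<bar>" using False by (simp add: abs_mult sgn_if)
    finally show ?thesis .
  qed
qed

lemma err_AE: "AE x in lborel. err x = (LINT l|\<rho>. K_gap l x)"
  using AE_lborel_singleton[of "0::real"] by eventually_elim (rule err_eq)

lemma err_measurable: "err \<in> borel_measurable borel"
proof -
  have "(\<lambda>x. LINT l|\<rho>. K_gap l x) \<in> borel_measurable lborel"
    by (rule borel_measurable_integrable[OF pair_sigma_finite.integrable_snd[OF pair_sigma_finite_rho K_gap_pair_integrable]])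
  then have "(\<lambda>x. if x = 0 then err 0 else (LINT l|\<rho>. K_gap l x)) \<in> borel_measurable borel" by simp
  moreover have "err = (\<lambda>x. if x = 0 then err 0 else (LINT l|\<rho>. K_gap l x))"
    by (rule ext) (simp add: err_eq)
  ultimately show ?thesis by (simp only:)
qed

lemma err_integrable: "integrable lborel err"
  by (rule integrable_cong_AE_imp[OF pair_sigma_finite.integrable_snd[OF pair_sigma_finite_rho K_gap_pair_integrable]])
    (use err_measurable err_AE in auto)

text \<open>Because of the common sign the absolute value moves inside the integral over l, and
  Fubini then yields an equality rather than an estimate.\<close>

lemma err_L1: "(LINT x|lborel. \<bar>err x\<bar>) = (LINT l|\<rho>. gap_norm l)"
proof -
  have i: "integrable (\<rho> \<Otimes>\<^sub>M lborel) (\<lambda>(l, x). \<bar>K_gap l x\<bar>)"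
    using integrable_abs[OF K_gap_pair_integrable] by (simp add: case_prod_beta')
  have "(LINT x|lborel. \<bar>err x\<bar>) = (LINT x|lborel. LINT l|\<rho>. \<bar>K_gap l x\<bar>)"
  proof (rule integral_cong_AE)
    show "(\<lambda>x. \<bar>err x\<bar>) \<in> borel_measurable lborel" using err_measurable by simp
    show "(\<lambda>x. LINT l|\<rho>. \<bar>K_gap l x\<bar>) \<in> borel_measurable lborel"
      by (rule borel_measurable_integrable[OF pair_sigma_finite.integrable_snd[OF pair_sigma_finite_rho i]])
    show "AE x in lborel. \<bar>err x\<bar> = (LINT l|\<rho>. \<bar>K_gap l x\<bar>)"
      using AE_lborel_singleton[of "0::real"] by eventually_elim (metis err_sgn_abs)
  qed
  also have "\<dots> = (LINT l|\<rho>. LINT x|lborel. \<bar>K_gap l x\<bar>)"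
    by (rule pair_sigma_finite.Fubini_integral[OF pair_sigma_finite_rho i])
  also have "\<dots> = (LINT l|\<rho>. gap_norm l)"
    by (intro Bochner_Integration.integral_cong refl) (auto simp: space_rho gap_norm_def K_gap_abs_integral)
  finally show ?thesis .
qed

text \<open>For t nonzero the transform of exp(-l |x|) is itself dominated by the weight, so the
  transform of the error splits into two integrable parts; integrability of \<open>K_hat\<close> is
  obtained as that of a difference.\<close>

lemma err_fourier:
  assumes t: "t \<noteq> 0"
  shows K_hat_integrable: "integrable \<rho> (\<lambda>l. K_hat l t)"
    and "(LINT x|lborel. of_real (err x) * ee (of_real (- t * x)))
    = of_real (LINT l|\<rho>. 2 * l / (l\<^sup>2 + 4 * pi\<^sup>2 * t\<^sup>2)) - (LINT l|\<rho>. K_hat l t)"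
proof -
  have em: "(\<lambda>x::real. ee (of_real (- t * x))) \<in> borel_measurable borel" unfolding ee_def by measurable
  have eb: "norm (ee (of_real (- t * x))) \<le> 1" for x by (simp add: ee_def)
  have i: "integrable (\<rho> \<Otimes>\<^sub>M lborel) (\<lambda>(l, x). of_real (K_gap l x) * ee (of_real (- t * x)))"
  proof -
    have "(\<lambda>p. ee (of_real (- t * snd p))) \<in> borel_measurable (\<rho> \<Otimes>\<^sub>M lborel)"
      using measurable_compose[OF measurable_snd[of \<rho> lborel]] em by simp
    then have "integrable (\<rho> \<Otimes>\<^sub>M lborel) (\<lambda>p. of_real (case p of (l, x) \<Rightarrow> K_gap l x) * ee (of_real (- t * snd p)))"
      by (rule integrable_mult_bounded[OF integrable_of_real[OF K_gap_pair_integrable] _ eb])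
    then show ?thesis by (simp add: case_prod_beta')
  qed
  \<comment> \<open>Chosen so that c (l^2 + 1) <= l^2 + 4 pi^2 t^2; positive because t is not
    0.\<close>
  define c where "c = min 1 (4 * pi\<^sup>2 * t\<^sup>2)"
  have c: "c > 0" "c \<le> 1" "c \<le> 4 * pi\<^sup>2 * t\<^sup>2" using t by (auto simp: c_def)
  have "integrable \<rho> (\<lambda>l. 2 * l / (l\<^sup>2 + 4 * pi\<^sup>2 * t\<^sup>2))"
  proof (rule weight_bound_integrable[where C = "2 / c"])
    show "(\<lambda>l. 2 * l / (l\<^sup>2 + 4 * pi\<^sup>2 * t\<^sup>2)) \<in> borel_measurable \<rho>" by (rule measurable_rho) measurable
    fix l :: real assume l: "l > 0"
    have "c * l\<^sup>2 \<le> 1 * l\<^sup>2" using c by (intro mult_right_mono) auto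
    then have "c * (l\<^sup>2 + 1) \<le> l\<^sup>2 + 4 * pi\<^sup>2 * t\<^sup>2" using c by (simp add: distrib_left)
    then have "2 * l / (l\<^sup>2 + 4 * pi\<^sup>2 * t\<^sup>2) \<le> 2 * l / (c * (l\<^sup>2 + 1))"
      using l c by (intro divide_left_mono) (auto intro!: mult_pos_pos add_pos_nonneg)
    moreover have "2 * l / (l\<^sup>2 + 4 * pi\<^sup>2 * t\<^sup>2) \<ge> 0" using l by (intro divide_nonneg_nonneg) auto
    ultimately show "norm (2 * l / (l\<^sup>2 + 4 * pi\<^sup>2 * t\<^sup>2)) \<le> 2 / c * (l / (l\<^sup>2 + 1))" by simp
  qed
  then have i2: "integrable \<rho> (\<lambda>l. complex_of_real (2 * l / (l\<^sup>2 + 4 * pi\<^sup>2 * t\<^sup>2)))" by (rule integrable_of_real)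
  have "integrable \<rho> (\<lambda>l. LINT x|lborel. of_real (K_gap l x) * ee (of_real (- t * x)))"
    by (rule pair_sigma_finite.integrable_fst[OF pair_sigma_finite_rho i])
  from Bochner_Integration.integrable_diff[OF i2 this]
  show i3: "integrable \<rho> (\<lambda>l. K_hat l t)"
    by (rule Bochner_Integration.integrable_cong[THEN iffD1, OF refl, rotated])
      (simp only: space_rho greaterThan_iff K_gap_fourier, simp)
  have "(LINT x|lborel. of_real (err x) * ee (of_real (- t * x))) = (LINT x|lborel. LINT l|\<rho>. of_real (K_gap l x) * ee (of_real (- t * x)))"
  proof (rule integral_cong_AE)
    show "(\<lambda>x. of_real (err x) * ee (of_real (- t * x))) \<in> borel_measurable lborel"
      using err_measurable em by simp
    show "(\<lambda>x. LINT l|\<rho>. of_real (K_gap l x) * ee (of_real (- t * x))) \<in> borel_measurable lborel"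
      by (rule borel_measurable_integrable[OF pair_sigma_finite.integrable_snd[OF pair_sigma_finite_rho i]])
    show "AE x in lborel. of_real (err x) * ee (of_real (- t * x)) = (LINT l|\<rho>. of_real (K_gap l x) * ee (of_real (- t * x)))"
      using err_AE by eventually_elim (simp only: integral_mult_left_zero integral_complex_of_real)
  qed
  also have "\<dots> = (LINT l|\<rho>. LINT x|lborel. of_real (K_gap l x) * ee (of_real (- t * x)))"
    by (rule pair_sigma_finite.Fubini_integral[OF pair_sigma_finite_rho i])
  also have "\<dots> = (LINT l|\<rho>. of_real (2 * l / (l\<^sup>2 + 4 * pi\<^sup>2 * t\<^sup>2)) - K_hat l t)"
    by (intro Bochner_Integration.integral_cong refl K_gap_fourier) (simp add: space_rho)
  also have "\<dots> = (LINT l|\<rho>. complex_of_real (2 * l / (l\<^sup>2 + 4 * pi\<^sup>2 * t\<^sup>2))) - (LINT l|\<rho>. K_hat l t)"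
    by (rule Bochner_Integration.integral_diff[OF i2 i3])
  finally show "(LINT x|lborel. of_real (err x) * ee (of_real (- t * x)))
    = of_real (LINT l|\<rho>. 2 * l / (l\<^sup>2 + 4 * pi\<^sup>2 * t\<^sup>2)) - (LINT l|\<rho>. K_hat l t)" by (simp only: integral_complex_of_real)
qed

end

section \<open>Extremality and uniqueness\<close>

context decay_measure
begin

lemma gap_norm_integral_nonneg: "0 \<le> (LINT l|\<rho>. gap_norm l)"
  by (intro integral_nonneg_AE AE_I2 gap_norm_bounds) (simp add: space_rho)

lemma fr_eq_err: "complex_of_real (fr \<rho> x) = of_real (err x) + K_rho \<rho> (of_real x)"
  using K_rho_of_real(1)[of x] by (simp add: err_def)

text \<open>Dominated convergence, with |X n| eventually between |p|/2 and 2|p| so that the factor 1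
  + a + 1/a stays bounded. Continuity is what carries almost-everywhere information to the sampling
  nodes.\<close>

lemma fr_isCont:
  assumes p: "p \<noteq> 0" shows "isCont (fr \<rho>) p"
  unfolding continuous_at_sequentially
proof (intro allI impI)
  fix X assume X: "X \<longlonglongrightarrow> p"
  define C where "C = 2 * (1 + 2 * \<bar>p\<bar> + 2 / \<bar>p\<bar>)"
  have ev: "eventually (\<lambda>n. \<bar>X n\<bar> > \<bar>p\<bar> / 2 \<and> \<bar>X n\<bar> < 2 * \<bar>p\<bar>) sequentially"
    by (rule eventually_conj; rule order_tendstoD[OF tendsto_rabs[OF X]]) (use p in auto)
  then obtain N where N: "\<And>n. n \<ge> N \<Longrightarrow> \<bar>X n\<bar> > \<bar>p\<bar> / 2 \<and> \<bar>X n\<bar> < 2 * \<bar>p\<bar>"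
    by (auto simp: eventually_sequentially)
  have "(\<lambda>n. fr \<rho> (X (n + N))) \<longlonglongrightarrow> fr \<rho> p"
    unfolding fr_eq
  proof (rule integral_dominated_convergence[OF exp_diff_measurable exp_diff_measurable integrable_mult_right[OF weight_integrable, of C]])
    show "AE l in \<rho>. (\<lambda>n. exp (- l * \<bar>X (n + N)\<bar>) - exp (- l)) \<longlonglongrightarrow> exp (- l * \<bar>p\<bar>) - exp (- l)"
      by (intro AE_I2 tendsto_intros LIMSEQ_ignore_initial_segment[OF X])
    show "AE l in \<rho>. norm (exp (- l * \<bar>X (n + N)\<bar>) - exp (- l)) \<le> C * (l / (l\<^sup>2 + 1))" for n
    proof (rule AE_I2)
      fix l assume "l \<in> space \<rho>"
      then have l: "l > 0" by (simp add: space_rho)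
      define a where "a = \<bar>X (n + N)\<bar>"
      have a: "a > \<bar>p\<bar> / 2" "a < 2 * \<bar>p\<bar>" using N[of "n + N"] by (auto simp: a_def)
      then have a0: "a > 0" using p by linarith
      have "1 / a \<le> 1 / (\<bar>p\<bar> / 2)" using a p by (intro frac_le) auto
      then have "2 * (1 + a + 1 / a) \<le> C" unfolding C_def using a by (intro mult_left_mono add_mono) auto
      then have "2 * (1 + a + 1 / a) * (l / (l\<^sup>2 + 1)) \<le> C * (l / (l\<^sup>2 + 1))"
        using l by (intro mult_right_mono divide_nonneg_nonneg) auto
      then show "norm (exp (- l * \<bar>X (n + N)\<bar>) - exp (- l)) \<le> C * (l / (l\<^sup>2 + 1))"
        using exp_diff_le_weight[OF l a0] unfolding a_def real_norm_def by linarith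
    qed
  qed
  then show "(fr \<rho> \<circ> X) \<longlonglongrightarrow> fr \<rho> p" unfolding o_def by (rule LIMSEQ_offset)
qed

text \<open>Complex valued, since a competitor \<open>Kt\<close> need not be real on the real
  axis.\<close>

definition dev :: "(complex \<Rightarrow> complex) \<Rightarrow> real \<Rightarrow> complex" where
  "dev Kt x = of_real (fr \<rho> x) - Kt (of_real x)"

lemma dev_measurable:
  assumes Kt: "exp_type_le Kt pi" shows "dev Kt \<in> borel_measurable borel"
proof -
  have [measurable]: "err \<in> borel_measurable borel" by (rule err_measurable)
  have [measurable]: "(\<lambda>x::real. Kt (of_real x)) \<in> borel_measurable borel" "(\<lambda>x::real. K_rho \<rho> (of_real x)) \<in> borel_measurable borel"
    using Kt K_rho_exp_type by (auto intro!: borel_measurable_continuous_onI entire_continuous_on_real simp: exp_type_le_def)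
  show ?thesis unfolding dev_def[abs_def] fr_eq_err by measurable
qed

lemma dev_diff:
  "Kt (of_real x) - K_rho \<rho> (of_real x) = of_real (err x) - dev Kt x"
  by (simp add: dev_def fr_eq_err)

text \<open>The deviation of \<open>Kt\<close> is that of the extremal function minus
  \<open>Kt\<close> - \<open>K_rho\<close>. This difference is integrable of type \<open>pi\<close>,
  hence orthogonal to the sign of the cosine; so the integral does not depend on the competitor and
  equals the L1 norm of \<open>err\<close>.\<close>

lemma dev_sgn_integral:
  assumes Kt: "exp_type_le Kt pi" and int: "integrable lborel (dev Kt)"
  shows "(LINT x|lborel. dev Kt x * of_real (sgn (cos (pi * x)))) = of_real (LINT l|\<rho>. gap_norm l)"
    and "integrable lborel (\<lambda>x. dev Kt x * of_real (sgn (cos (pi * x))))"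
    and "integrable lborel (\<lambda>x::real. Kt (of_real x) - K_rho \<rho> (of_real x))"
proof -
  define s where "s = (\<lambda>x. sgn (cos (pi * x)))"
  have sm: "(\<lambda>x. complex_of_real (s x)) \<in> borel_measurable lborel" unfolding s_def by measurable
  have sb: "norm (complex_of_real (s x)) \<le> 1" for x by (simp add: s_def sgn_if)
  show iG: "integrable lborel (\<lambda>x::real. Kt (of_real x) - K_rho \<rho> (of_real x))"
    unfolding dev_diff by (intro Bochner_Integration.integrable_diff integrable_of_real err_integrable int)
  have i1: "integrable lborel (\<lambda>x. of_real (err x) * complex_of_real (s x))"
    by (rule integrable_mult_bounded[OF integrable_of_real[OF err_integrable] sm sb])
  have i2: "integrable lborel (\<lambda>x. (Kt (of_real x) - K_rho \<rho> (of_real x)) * complex_of_real (s x))"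
    by (rule integrable_mult_bounded[OF iG sm sb])
  show i3: "integrable lborel (\<lambda>x. dev Kt x * of_real (sgn (cos (pi * x))))"
    using integrable_mult_bounded[OF int sm sb] by (simp only: s_def)
  have e: "dev Kt x * of_real (s x) = of_real (err x) * of_real (s x) - (Kt (of_real x) - K_rho \<rho> (of_real x)) * of_real (s x)" for x
    unfolding dev_diff by (simp add: algebra_simps)
  have "(LINT x|lborel. dev Kt x * of_real (s x)) = (LINT x|lborel. of_real (err x) * complex_of_real (s x)) - (LINT x|lborel. (Kt (of_real x) - K_rho \<rho> (of_real x)) * of_real (s x))"
    unfolding e by (rule Bochner_Integration.integral_diff[OF i1 i2])
  also have "(LINT x|lborel. (Kt (of_real x) - K_rho \<rho> (of_real x)) * of_real (s x)) = 0"
    unfolding s_def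
    using exp_type_le_sgn_cos_zero[OF exp_type_le_diff[OF Kt K_rho_exp_type] iG] by simp
  also have "(LINT x|lborel. of_real (err x) * complex_of_real (s x)) = (LINT x|lborel. complex_of_real \<bar>err x\<bar>)"
  proof (rule integral_cong_AE)
    show "(\<lambda>x. of_real (err x) * complex_of_real (s x)) \<in> borel_measurable lborel"
      using i1 by (rule borel_measurable_integrable)
    show "(\<lambda>x. complex_of_real \<bar>err x\<bar>) \<in> borel_measurable lborel" using err_measurable by simp
    show "AE x in lborel. of_real (err x) * complex_of_real (s x) = complex_of_real \<bar>err x\<bar>"
      using AE_lborel_singleton[of "0::real"]
      by eventually_elim (simp add: s_def of_real_mult[symmetric] err_sgn_abs(2) del: of_real_mult)
  qed
  finally show "(LINT x|lborel. dev Kt x * of_real (sgn (cos (pi * x)))) = of_real (LINT l|\<rho>. gap_norm l)"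
    by (simp only: integral_complex_of_real err_L1 s_def diff_0_right)
qed

lemma nn_integral_dev:
  assumes Kt: "exp_type_le Kt pi"
  shows "(\<integral>\<^sup>+ x. ennreal (norm (dev Kt x)) \<partial>lborel) = \<infinity> \<or>
    (integrable lborel (dev Kt) \<and> (\<integral>\<^sup>+ x. ennreal (norm (dev Kt x)) \<partial>lborel) = ennreal (LINT x|lborel. norm (dev Kt x)))"
proof (cases "(\<integral>\<^sup>+ x. ennreal (norm (dev Kt x)) \<partial>lborel) = \<infinity>")
  case False
  then have i: "integrable lborel (dev Kt)"
    using dev_measurable[OF Kt] by (intro integrableI_bounded) (auto simp: less_top)
  then show ?thesis by (intro disjI2 conjI nn_integral_eq_integral integrable_norm) auto
qed simp

lemma dev_norm_ge:
  assumes Kt: "exp_type_le Kt pi" and int: "integrable lborel (dev Kt)"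
  shows "(LINT l|\<rho>. gap_norm l) \<le> (LINT x|lborel. norm (dev Kt x))"
proof -
  have "(LINT l|\<rho>. gap_norm l) = norm (LINT x|lborel. dev Kt x * of_real (sgn (cos (pi * x))))"
    unfolding dev_sgn_integral(1)[OF Kt int] using gap_norm_integral_nonneg by simp
  also have "\<dots> \<le> (LINT x|lborel. norm (dev Kt x * of_real (sgn (cos (pi * x)))))" by (rule integral_norm_bound)
  also have "\<dots> \<le> (LINT x|lborel. norm (dev Kt x))"
    by (intro integral_mono integrable_norm dev_sgn_integral(2) Kt int) (simp add: norm_mult sgn_if)
  finally show ?thesis .
qed

lemma extremal_lower_bound:
  assumes Kt: "exp_type_le Kt pi"
  shows "ennreal (LINT l|\<rho>. gap_norm l) \<le> (\<integral>\<^sup>+ x. ennreal (norm (dev Kt x)) \<partial>lborel)"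
  using nn_integral_dev[OF Kt] dev_norm_ge[OF Kt] by (auto intro: ennreal_leI)

lemma extremal_attained:
  "(\<integral>\<^sup>+ x. ennreal (norm (dev (K_rho \<rho>) x)) \<partial>lborel) = ennreal (LINT l|\<rho>. gap_norm l)"
proof -
  have "norm (dev (K_rho \<rho>) x) = \<bar>err x\<bar>" for x by (simp add: dev_def fr_eq_err)
  then have "(\<integral>\<^sup>+ x. ennreal (norm (dev (K_rho \<rho>) x)) \<partial>lborel) = (\<integral>\<^sup>+ x. ennreal \<bar>err x\<bar> \<partial>lborel)" by simp
  also have "\<dots> = ennreal (LINT x|lborel. \<bar>err x\<bar>)"
    by (intro nn_integral_eq_integral integrable_abs err_integrable) auto
  finally show ?thesis unfolding err_L1 .
qed

section \<open>The case of equality\<close>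

text \<open>Let w be the deviation times the sign. Then |dev| - Re w is nonnegative with integral 0,
  so it vanishes almost everywhere; since |w| <= |dev| = Re w, the imaginary part vanishes
  too.\<close>

lemma extremal_sign_AE:
  assumes Kt: "exp_type_le Kt pi" and int: "integrable lborel (dev Kt)"
    and eq: "(LINT x|lborel. norm (dev Kt x)) = (LINT l|\<rho>. gap_norm l)"
  shows "AE x in lborel. dev Kt x * of_real (sgn (cos (pi * x))) = of_real (norm (dev Kt x))"
proof -
  define w where "w = (\<lambda>x. dev Kt x * of_real (sgn (cos (pi * x))))"
  have iw: "integrable lborel w" unfolding w_def by (rule dev_sgn_integral(2)[OF Kt int])
  have nw: "norm (w x) \<le> norm (dev Kt x)" for x by (simp add: w_def norm_mult sgn_if)
  have re: "Re (w x) \<le> norm (dev Kt x)" for x using complex_Re_le_cmod[of "w x"] nw[of x] by linarith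
  have ih: "integrable lborel (\<lambda>x. norm (dev Kt x) - Re (w x))"
    by (intro Bochner_Integration.integrable_diff integrable_norm int integrable_Re iw)
  have "(LINT x|lborel. norm (dev Kt x) - Re (w x)) = (LINT x|lborel. norm (dev Kt x)) - (LINT x|lborel. Re (w x))"
    by (intro Bochner_Integration.integral_diff integrable_norm int integrable_Re iw)
  also have "(LINT x|lborel. Re (w x)) = Re (LINT x|lborel. w x)" by (rule integral_Re[OF iw])
  also have "(LINT x|lborel. w x) = of_real (LINT l|\<rho>. gap_norm l)" unfolding w_def by (rule dev_sgn_integral(1)[OF Kt int])
  finally have "(LINT x|lborel. norm (dev Kt x) - Re (w x)) = 0" using eq by simp
  then have "AE x in lborel. norm (dev Kt x) - Re (w x) = 0"
    using integral_nonneg_eq_0_iff_AE[OF ih] re by simp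
  then show ?thesis
  proof eventually_elim
    case (elim x)
    have nd: "norm (dev Kt x) = Re (w x)" using elim by simp
    have "norm (w x) ^ 2 \<le> Re (w x) ^ 2" using nw[of x] unfolding nd by (intro power_mono) auto
    then have "Re (w x) ^ 2 + Im (w x) ^ 2 \<le> Re (w x) ^ 2" by (simp only: cmod_power2)
    then have "Im (w x) = 0" by simp
    then have "w x = of_real (norm (dev Kt x))" unfolding nd by (simp add: complex_eq_iff)
    then show ?case by (simp only: w_def)
  qed
qed

text \<open>The cosine changes sign at p, and almost everywhere the deviation times this sign equals
  its modulus. Approaching p from both sides gives |dev p| = dev p and |dev p| = - dev p, up to a
  common sign.\<close>

lemma dev_half_integer_eq_0:
  fixes k :: int
  assumes Kt: "exp_type_le Kt pi"
    and ae: "AE x in lborel. dev Kt x * of_real (sgn (cos (pi * x))) = of_real (norm (dev Kt x))"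
  shows "dev Kt (of_int k + 1/2) = 0"
proof -
  define p where "p = real_of_int k + 1/2"
  have p0: "p \<noteq> 0"
  proof
    assume "p = 0"
    then have "real_of_int (2 * k + 1) = 0" by (simp add: p_def)
    then show False by presburger
  qed
  have cp: "cos (pi * p) = 0"
  proof -
    have "pi * p = pi * of_int k + pi / 2" by (simp add: p_def algebra_simps)
    then show ?thesis by (simp add: cos_add)
  qed
  define q where "q = sin (pi * p)"
  have q: "q \<noteq> 0" using cp sin_cos_squared_add[of "pi * p"] by (auto simp: q_def)
  have cont: "isCont (dev Kt) p"
  proof -
    have "isCont (\<lambda>x. Kt (of_real x)) p"
      using entire_continuous_on_real[of Kt UNIV] Kt by (simp add: exp_type_le_def continuous_on_eq_continuous_at)
    then show ?thesis unfolding dev_def[abs_def] by (intro continuous_intros fr_isCont p0)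
  qed
  \<comment> \<open>The next zeros of the cosine are at distance 1 from p, so the sign is constant
    on either side up to there.\<close>
  have sign: "sgn (cos (pi * (p + h))) = - sgn q * sgn h" if "\<bar>h\<bar> < 1" for h
  proof -
    have "cos (pi * (p + h)) = - (q * sin (pi * h))" by (simp add: distrib_left cos_add cp q_def)
    moreover have "sgn (sin (pi * h)) = sgn h"
    proof -
      have pos: "sin (pi * y) > 0" if "0 < y" "y < 1" for y
        using that by (intro sin_gt_zero) auto
      consider "h = 0" | "h > 0" | "h < 0" by linarith
      then show ?thesis
      proof cases
        case 2
        then show ?thesis using pos[of h] \<open>\<bar>h\<bar> < 1\<close> by simp
      next
        case 3
        then show ?thesis using pos[of "- h"] \<open>\<bar>h\<bar> < 1\<close> by simp
      qed simp
    qed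
    ultimately show ?thesis by (simp add: sgn_minus sgn_mult)
  qed
  have side: "- (of_real (sgn q) * of_real \<sigma>) * dev Kt p = of_real (norm (dev Kt p))" if \<sigma>: "\<sigma> = 1 \<or> \<sigma> = -1" for \<sigma> :: real
  proof -
    have "\<exists>h. 0 < h \<and> h < 1 / real (Suc n) \<and> - (of_real (sgn q) * of_real \<sigma>) * dev Kt (p + \<sigma> * h) = of_real (norm (dev Kt (p + \<sigma> * h)))" for n
    proof -
      define e where "e = 1 / real (Suc n)"
      have e: "0 < e" "e \<le> 1" by (simp_all add: e_def)
      \<comment> \<open>\<sigma> selects the side of p; an interval of positive length always
        contains a point outside the exceptional null set.\<close>
      obtain x where x: "min (p + \<sigma> * e) p < x" "x < max (p + \<sigma> * e) p" "dev Kt x * of_real (sgn (cos (pi * x))) = of_real (norm (dev Kt x))"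
      proof (rule AE_lborel_obtains[OF ae])
        show "min (p + \<sigma> * e) p < max (p + \<sigma> * e) p" using e \<sigma> by auto
      qed
      define h where "h = \<sigma> * (x - p)"
      have h: "0 < h" "h < e" "x = p + \<sigma> * h" using x(1,2) \<sigma> e by (auto simp: h_def)
      have "sgn (cos (pi * x)) = - sgn q * sgn (\<sigma> * h)" unfolding h(3) using h e \<sigma> by (intro sign) auto
      also have "sgn (\<sigma> * h) = \<sigma>" using h \<sigma> by auto
      finally have "- (of_real (sgn q) * of_real \<sigma>) * dev Kt x = of_real (norm (dev Kt x))" using x(3) by (simp add: mult_ac)
      then show ?thesis using h unfolding e_def by blast
    qed
    then obtain h where h: "\<And>n. 0 < h n" "\<And>n. h n < 1 / real (Suc n)"
      "\<And>n. - (of_real (sgn q) * of_real \<sigma>) * dev Kt (p + \<sigma> * h n) = of_real (norm (dev Kt (p + \<sigma> * h n)))" by metis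
    have i0: "(\<lambda>n. 1 / real (Suc n)) \<longlonglongrightarrow> 0" by real_asymp
    have "h \<longlonglongrightarrow> 0"
      by (rule Lim_null_comparison[OF _ i0]) (use h in \<open>auto intro!: always_eventually less_imp_le simp: abs_of_pos\<close>)
    then have "(\<lambda>n. p + \<sigma> * h n) \<longlonglongrightarrow> p + \<sigma> * 0" by (intro tendsto_intros)
    then have d: "(\<lambda>n. dev Kt (p + \<sigma> * h n)) \<longlonglongrightarrow> dev Kt p"
      by (intro isCont_tendsto_compose[OF cont]) simp
    have "(\<lambda>n. - (of_real (sgn q) * of_real \<sigma>) * dev Kt (p + \<sigma> * h n)) \<longlonglongrightarrow> - (of_real (sgn q) * of_real \<sigma>) * dev Kt p"
      by (intro tendsto_intros d)
    moreover have "(\<lambda>n. complex_of_real (norm (dev Kt (p + \<sigma> * h n)))) \<longlonglongrightarrow> of_real (norm (dev Kt p))"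
      by (intro tendsto_intros d)
    ultimately show ?thesis unfolding h(3) by (rule LIMSEQ_unique)
  qed
  have "complex_of_real (norm (dev Kt p)) = - of_real (norm (dev Kt p))"
    using side[of 1] side[of "-1"] by simp
  then have "norm (dev Kt p) = 0" by (simp add: complex_eq_iff)
  then show ?thesis by (simp add: p_def)
qed

text \<open>Both \<open>Kt\<close> and \<open>K_rho\<close> interpolate f at all half-integers, so
  their difference is an integrable function of type \<open>pi\<close> vanishing there.\<close>

lemma extremal_unique:
  assumes Kt: "exp_type_le Kt pi"
    and eq: "(\<integral>\<^sup>+ x. ennreal (norm (dev Kt x)) \<partial>lborel) = ennreal (LINT l|\<rho>. gap_norm l)"
  shows "Kt = K_rho \<rho>"
proof -
  have int: "integrable lborel (dev Kt)" and v: "ennreal (LINT x|lborel. norm (dev Kt x)) = ennreal (LINT l|\<rho>. gap_norm l)"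
    using nn_integral_dev[OF Kt] eq by auto
  have "(LINT x|lborel. norm (dev Kt x)) = (LINT l|\<rho>. gap_norm l)"
    using v gap_norm_integral_nonneg by (subst (asm) ennreal_inj) auto
  from extremal_sign_AE[OF Kt int this]
  have z: "dev Kt (of_int k + 1/2) = 0" for k :: int by (rule dev_half_integer_eq_0[OF Kt])
  \<comment> \<open>Interpolation by \<open>K_rho\<close> itself follows from the same sign
    argument, without evaluating the sampling series at a node.\<close>
  have zK: "dev (K_rho \<rho>) (of_int k + 1/2) = 0" for k :: int
  proof (rule dev_half_integer_eq_0[OF K_rho_exp_type])
    have e: "dev (K_rho \<rho>) x = of_real (err x)" for x by (simp add: dev_def fr_eq_err)
    show "AE x in lborel. dev (K_rho \<rho>) x * of_real (sgn (cos (pi * x))) = of_real (norm (dev (K_rho \<rho>) x))"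
      using AE_lborel_singleton[of "0::real"] unfolding e
      by eventually_elim (simp add: of_real_mult[symmetric] err_sgn_abs(2) del: of_real_mult)
  qed
  have "Kt z - K_rho \<rho> z = 0" for z
  proof (rule exp_type_le_pi_eq_0[OF exp_type_le_diff[OF Kt K_rho_exp_type] dev_sgn_integral(3)[OF Kt int]])
    fix k :: int
    show "Kt (of_int k + 1/2) - K_rho \<rho> (of_int k + 1/2) = 0"
      using z[of k] zK[of k] by (simp add: dev_def)
  qed
  then show ?thesis by (simp add: fun_eq_iff)
qed

end

lemma exp_type_le_scale_add:
  assumes F: "exp_type_le F \<sigma>" and s: "\<sigma> \<ge> 0" and d: "\<delta> > 0"
  shows "exp_type_le (\<lambda>z. F (of_real \<delta> * z) + c) (\<sigma> * \<delta>)"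
  unfolding exp_type_le_def
proof (intro conjI allI impI)
  have "F holomorphic_on UNIV" using F by (simp add: exp_type_le_def)
  then have "(\<lambda>z. F (of_real \<delta> * z)) holomorphic_on UNIV"
    by (intro holomorphic_on_compose[of "\<lambda>z. of_real \<delta> * z" UNIV F, unfolded o_def])
      (auto intro!: holomorphic_intros intro: holomorphic_on_subset)
  then show "(\<lambda>z. F (of_real \<delta> * z) + c) holomorphic_on UNIV" by (intro holomorphic_intros)
  fix \<epsilon> :: real assume e: "\<epsilon> > 0"
  then obtain C where C: "\<And>z. norm (F z) \<le> C * exp ((\<sigma> + \<epsilon> / \<delta>) * norm z)"
    using F d unfolding exp_type_le_def by (meson divide_pos_pos)
  have "norm (F (of_real \<delta> * z) + c) \<le> (C + norm c) * exp ((\<sigma> * \<delta> + \<epsilon>) * norm z)" for z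
  proof -
    have "(\<sigma> + \<epsilon> / \<delta>) * norm (of_real \<delta> * z) = (\<sigma> * \<delta> + \<epsilon>) * norm z" using d by (simp add: norm_mult field_simps)
    then have 1: "norm (F (of_real \<delta> * z)) \<le> C * exp ((\<sigma> * \<delta> + \<epsilon>) * norm z)" using C[of "of_real \<delta> * z"] by simp
    have "norm c * 1 \<le> norm c * exp ((\<sigma> * \<delta> + \<epsilon>) * norm z)" using s d e by (intro mult_left_mono) auto
    then show ?thesis
      unfolding distrib_right[of C] using 1 norm_triangle_ineq[of "F (of_real \<delta> * z)" c] by linarith
  qed
  then show "\<exists>C. \<forall>z. norm (F (of_real \<delta> * z) + c) \<le> C * exp ((\<sigma> * \<delta> + \<epsilon>) * norm z)" by blast
qed

section \<open>Dilation\<close>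

locale dilated_measures =
  fixes \<mu> \<nu> :: "real measure" and \<delta> :: real
  assumes mu_sets: "sets \<mu> = sets (restrict_space borel {0<..})"
    and mu_int: "integrable \<mu> (\<lambda>l. l / (l\<^sup>2 + 1))"
    and delta_pos: "\<delta> > 0"
    and nu_sets: "sets \<nu> = sets (restrict_space borel {0<..})"
    and nu_def: "\<And>E. E \<in> sets \<nu> \<Longrightarrow> emeasure \<nu> E = emeasure \<mu> ((\<lambda>x. \<delta> * x) ` E)"
begin

sublocale M: decay_measure \<mu>
  by (rule decay_measure.intro[OF mu_sets mu_int])

lemma dilation_measurable: "(\<lambda>l. l / \<delta>) \<in> measurable \<mu> \<nu>"
proof -
  have "(\<lambda>l. l / \<delta>) \<in> measurable \<mu> (restrict_space borel {0<..})"
    by (rule measurable_restrict_space2) (use delta_pos in \<open>auto simp: M.space_rho intro!: M.measurable_rho\<close>)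
  then show ?thesis by (subst measurable_cong_sets[OF refl nu_sets])
qed

text \<open>Multiplication by \<delta> inverts division by \<delta> on the half line, so the set
  \<delta>E is the preimage of E; integrals against \<nu> thus become integrals against
  \<mu>.\<close>

lemma nu_eq_distr: "\<nu> = distr \<mu> \<nu> (\<lambda>l. l / \<delta>)"
proof (rule measure_eqI)
  fix E assume E: "E \<in> sets \<nu>"
  have "(\<lambda>l. l / \<delta>) -` E \<inter> space \<mu> = (\<lambda>x. \<delta> * x) ` E"
  proof
    show "(\<lambda>l. l / \<delta>) -` E \<inter> space \<mu> \<subseteq> (\<lambda>x. \<delta> * x) ` E"
      using delta_pos by (auto intro!: rev_image_eqI)
    have "E \<subseteq> {0<..}" using E sets.sets_into_space[OF E] sets_eq_imp_space_eq[OF nu_sets] by (simp add: space_restrict_space)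
    then show "(\<lambda>x. \<delta> * x) ` E \<subseteq> (\<lambda>l. l / \<delta>) -` E \<inter> space \<mu>"
      using delta_pos by (auto simp: M.space_rho)
  qed
  then show "emeasure \<nu> E = emeasure (distr \<mu> \<nu> (\<lambda>l. l / \<delta>)) E"
    using nu_def[OF E] emeasure_distr[OF dilation_measurable E] by simp
qed simp

lemma nu_transfer:
  fixes f :: "real \<Rightarrow> 'b :: {banach, second_countable_topology}"
  assumes m: "f \<in> borel_measurable \<nu>"
  shows nu_integrable_iff: "integrable \<nu> f \<longleftrightarrow> integrable \<mu> (\<lambda>l. f (l / \<delta>))"
    and nu_integral_eq: "(LINT l|\<nu>. f l) = (LINT l|\<mu>. f (l / \<delta>))"
proof -
  show "integrable \<nu> f \<longleftrightarrow> integrable \<mu> (\<lambda>l. f (l / \<delta>))"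
    by (subst nu_eq_distr) (rule integrable_distr_eq[OF dilation_measurable m])
  show "(LINT l|\<nu>. f l) = (LINT l|\<mu>. f (l / \<delta>))"
    by (subst nu_eq_distr) (rule integral_distr[OF dilation_measurable m])
qed

lemma nu_ext_int:
  assumes m: "f \<in> borel_measurable \<nu>" shows "ext_int \<nu> f = ext_int \<mu> (\<lambda>l. f (l / \<delta>))"
proof -
  have "(\<integral>\<^sup>+ l. g l \<partial>\<nu>) = (\<integral>\<^sup>+ l. g (l / \<delta>) \<partial>\<mu>)" if "g \<in> borel_measurable \<nu>" for g
    by (subst nu_eq_distr) (rule nn_integral_distr[OF dilation_measurable], simp add: that)
  then show ?thesis unfolding ext_int_def using m by simp
qed

lemma nu_weight_integrable: "integrable \<nu> (\<lambda>l. l / (l\<^sup>2 + 1))"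
proof (subst nu_integrable_iff)
  show "(\<lambda>l. l / (l\<^sup>2 + 1)) \<in> borel_measurable \<nu>"
    by (subst measurable_cong_sets[OF nu_sets refl]) (rule measurable_restrict_space1, measurable)
  \<comment> \<open>Chosen so that c (l^2 + 1) <= l^2 + \<delta>^2, which compares the rescaled
    weight with the original one.\<close>
  define c where "c = min 1 (\<delta>\<^sup>2)"
  have c: "c > 0" "c \<le> 1" "c \<le> \<delta>\<^sup>2" using delta_pos by (auto simp: c_def)
  show "integrable \<mu> (\<lambda>l. l / \<delta> / ((l / \<delta>)\<^sup>2 + 1))"
  proof (rule M.weight_bound_integrable[where C = "\<delta> / c"])
    show "(\<lambda>l. l / \<delta> / ((l / \<delta>)\<^sup>2 + 1)) \<in> borel_measurable \<mu>" by (rule M.measurable_rho) measurable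
    fix l :: real assume l: "l > 0"
    have "c * l\<^sup>2 \<le> 1 * l\<^sup>2" using c by (intro mult_right_mono) auto
    then have "c * (l\<^sup>2 + 1) \<le> l\<^sup>2 + \<delta>\<^sup>2" using c by (simp add: distrib_left)
    then have "\<delta> * l / (l\<^sup>2 + \<delta>\<^sup>2) \<le> \<delta> * l / (c * (l\<^sup>2 + 1))"
      using l c delta_pos by (intro divide_left_mono) (auto intro!: mult_pos_pos add_pos_nonneg)
    moreover have "l / \<delta> / ((l / \<delta>)\<^sup>2 + 1) = \<delta> * l / (l\<^sup>2 + \<delta>\<^sup>2)"
    proof -
      have "(l / \<delta>)\<^sup>2 + 1 = (l\<^sup>2 + \<delta>\<^sup>2) / \<delta>\<^sup>2" using delta_pos by (simp add: power_divide add_divide_distrib)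
      then show ?thesis using delta_pos by (simp add: power2_eq_square)
    qed
    moreover have "\<delta> * l / (l\<^sup>2 + \<delta>\<^sup>2) \<ge> 0" using l delta_pos by (intro divide_nonneg_nonneg) auto
    ultimately show "norm (l / \<delta> / ((l / \<delta>)\<^sup>2 + 1)) \<le> \<delta> / c * (l / (l\<^sup>2 + 1))" by simp
  qed
qed

sublocale N: decay_measure \<nu>
  by (rule decay_measure.intro[OF nu_sets nu_weight_integrable])

lemma scaled_exponent: "l / \<delta> * \<bar>\<delta> * x\<bar> = l * \<bar>x\<bar>"
  using delta_pos by (simp add: abs_mult)

lemma K_gap_scaled: "K_gap (l / \<delta>) (\<delta> * x) = exp (- l * \<bar>x\<bar>) - Re (K_lam (l / \<delta>) (of_real (\<delta> * x)))"
  unfolding K_gap_def by (simp only: mult_minus_left scaled_exponent)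

lemma inverse_delta_integrable: "integrable \<mu> (\<lambda>l. exp (- l * \<bar>1 / \<delta>\<bar>) - exp (- l))"
  using delta_pos by (intro M.exp_diff_integrable) simp

text \<open>The origin of the constant f(1/\<delta>): after rescaling, the subtracted exponential
  exp(-l/\<delta>) is the value of exp(-l |x|) at x = 1/\<delta>.\<close>

lemma scaled_exp_diff:
  "exp (- (l / \<delta>) * \<bar>\<delta> * x\<bar>) - exp (- (l / \<delta>)) = (exp (- l * \<bar>x\<bar>) - exp (- l)) - (exp (- l * \<bar>1 / \<delta>\<bar>) - exp (- l))"
  using delta_pos by (simp only: mult_minus_left scaled_exponent) simp

lemma nu_exp_diff_integrable_iff:
  "integrable \<nu> (\<lambda>l. exp (- l * \<bar>\<delta> * x\<bar>) - exp (- l)) \<longleftrightarrow> integrable \<mu> (\<lambda>l. exp (- l * \<bar>x\<bar>) - exp (- l))"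
  unfolding nu_integrable_iff[OF N.exp_diff_measurable] scaled_exp_diff
proof
  assume "integrable \<mu> (\<lambda>l. (exp (- l * \<bar>x\<bar>) - exp (- l)) - (exp (- l * \<bar>1 / \<delta>\<bar>) - exp (- l)))"
  from Bochner_Integration.integrable_add[OF this inverse_delta_integrable]
  show "integrable \<mu> (\<lambda>l. exp (- l * \<bar>x\<bar>) - exp (- l))" by simp
qed (rule Bochner_Integration.integrable_diff[OF _ inverse_delta_integrable])

lemma fr_nu:
  assumes "integrable \<mu> (\<lambda>l. exp (- l * \<bar>x\<bar>) - exp (- l))"
  shows "fr \<nu> (\<delta> * x) = fr \<mu> x - fr \<mu> (1 / \<delta>)"
  unfolding N.fr_eq M.fr_eq nu_integral_eq[OF N.exp_diff_measurable] scaled_exp_diff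
  by (rule Bochner_Integration.integral_diff[OF assms inverse_delta_integrable])

lemma f_rho_nu: "f_rho \<mu> x - f_rho \<mu> (1 / \<delta>) = f_rho \<nu> (\<delta> * x)"
proof -
  have "f_rho \<mu> (1 / \<delta>) = ereal (fr \<mu> (1 / \<delta>))" using delta_pos by (intro M.f_rho_eq) simp
  then show ?thesis
    unfolding M.f_rho_cases[of x] N.f_rho_cases nu_exp_diff_integrable_iff using fr_nu[of x] by simp
qed

lemma err_nu:
  assumes "x \<noteq> 0"
  shows "N.err (\<delta> * x) = fr \<mu> x - fr \<mu> (1 / \<delta>) - Re (K_rho \<nu> (of_real (\<delta> * x)))"
  unfolding N.err_def fr_nu[OF M.exp_diff_integrable[OF assms]] ..

lemma lborel_scale:
  fixes f :: "real \<Rightarrow> 'b :: {banach, second_countable_topology}"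
  shows "(LINT x|lborel. f (\<delta> * x)) = (1 / \<delta>) *\<^sub>R (LINT x|lborel. f x)"
  using lborel_integral_real_affine[of \<delta> f 0] delta_pos by simp

lemma gap_norm_scaled: "gap_norm (l / \<delta>) = \<delta> * (2 / l - 2 / (l * cosh (l / (2 * \<delta>))))"
  using delta_pos by (simp add: gap_norm_def right_diff_distrib mult.commute)

lemma gap_norm_integral_scaled:
  "(LINT l|\<nu>. gap_norm l) = \<delta> * (LINT l|\<mu>. 2 / l - 2 / (l * cosh (l / (2 * \<delta>))))"
  unfolding nu_integral_eq[OF borel_measurable_integrable[OF N.gap_norm_integrable]] gap_norm_scaled
  by (rule integral_mult_right_zero)

text \<open>Coincides with the dilated \<open>N.err\<close> away from 0. At 0 an infinite f leads to
  different default values on the two sides, which is why the comparison is made almost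
  everywhere.\<close>

definition scaled_err :: "real \<Rightarrow> real" where
  "scaled_err x = fr \<mu> x - fr \<mu> (1 / \<delta>) - Re (K_rho \<nu> (of_real (\<delta> * x)))"

lemma scaled_err_AE: "AE x in lborel. scaled_err x = N.err (\<delta> * x)"
  using AE_lborel_singleton[of "0::real"] by eventually_elim (simp add: scaled_err_def err_nu)

lemma scaled_err_measurable: "scaled_err \<in> borel_measurable borel"
proof -
  have [measurable]: "N.err \<in> borel_measurable borel" by (rule N.err_measurable)
  have "(\<lambda>x. if x = 0 then scaled_err 0 else N.err (\<delta> * x)) \<in> borel_measurable borel" by measurable
  moreover have "scaled_err = (\<lambda>x. if x = 0 then scaled_err 0 else N.err (\<delta> * x))"
    by (rule ext) (simp add: err_nu scaled_err_def)
  ultimately show ?thesis by (simp only:)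
qed

lemma scaled_err_integrable: "integrable lborel scaled_err"
proof (rule integrable_cong_AE_imp)
  show "integrable lborel (\<lambda>x. N.err (\<delta> * x))"
    using lborel_integrable_real_affine[OF N.err_integrable, of \<delta> 0] delta_pos by simp
qed (use scaled_err_measurable scaled_err_AE in auto)

lemma scaled_err_L1: "(LINT x|lborel. \<bar>scaled_err x\<bar>) = (LINT l|\<mu>. 2 / l - 2 / (l * cosh (l / (2 * \<delta>))))"
proof -
  have [measurable]: "N.err \<in> borel_measurable borel" by (rule N.err_measurable)
  have "(LINT x|lborel. \<bar>scaled_err x\<bar>) = (LINT x|lborel. \<bar>N.err (\<delta> * x)\<bar>)"
    by (rule integral_cong_AE) (use scaled_err_measurable scaled_err_AE in auto)
  also have "\<dots> = (1 / \<delta>) * (LINT x|lborel. \<bar>N.err x\<bar>)"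
    using lborel_scale[of "\<lambda>x. \<bar>N.err x\<bar>"] by simp
  finally show ?thesis unfolding N.err_L1 gap_norm_integral_scaled using delta_pos by simp
qed

text \<open>The substitution x -> \<delta> x turns the frequency t into t/\<delta> and contributes
  1/\<delta>. In the first integral this factor is cancelled by rescaling the integrand; in front of
  \<open>K_hat\<close> it remains.\<close>

lemma scaled_err_fourier:
  assumes t: "t \<noteq> 0"
  shows "(LINT x|lborel. (of_real (fr \<mu> x - fr \<mu> (1/\<delta>)) - K_rho \<nu> (of_real (\<delta> * x))) * ee (of_real (- t * x)))
    = of_real (LINT l|\<mu>. 2 * l / (l\<^sup>2 + 4 * pi\<^sup>2 * t\<^sup>2)) - of_real (1/\<delta>) * (LINT l|\<mu>. K_hat (l/\<delta>) (t/\<delta>))"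
proof -
  have t': "t / \<delta> \<noteq> 0" using t delta_pos by simp
  have [measurable]: "N.err \<in> borel_measurable borel" "scaled_err \<in> borel_measurable borel"
    by (rule N.err_measurable, rule scaled_err_measurable)
  have em [measurable]: "(\<lambda>x::real. ee (of_real (- t * x))) \<in> borel_measurable borel" unfolding ee_def by measurable
  have e: "of_real (fr \<mu> x - fr \<mu> (1/\<delta>)) - K_rho \<nu> (of_real (\<delta> * x)) = of_real (scaled_err x)" for x
    using N.K_rho_of_real(1)[of "\<delta> * x"] by (simp add: scaled_err_def)
  have tx: "- (t / \<delta>) * (\<delta> * x) = - t * x" for x using delta_pos by simp
  have "(LINT x|lborel. of_real (scaled_err x) * ee (of_real (- t * x))) = (LINT x|lborel. of_real (N.err (\<delta> * x)) * ee (of_real (- (t / \<delta>) * (\<delta> * x))))"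
    unfolding tx
  proof (rule integral_cong_AE)
    show "AE x in lborel. of_real (scaled_err x) * ee (of_real (- t * x)) = of_real (N.err (\<delta> * x)) * ee (of_real (- t * x))"
      using scaled_err_AE by eventually_elim (simp only:)
  qed measurable
  also have "\<dots> = (1 / \<delta>) *\<^sub>R (LINT x|lborel. of_real (N.err x) * ee (of_real (- (t / \<delta>) * x)))"
    by (rule lborel_scale)
  also have "(LINT x|lborel. of_real (N.err x) * ee (of_real (- (t / \<delta>) * x)))
     = of_real (LINT l|\<nu>. 2 * l / (l\<^sup>2 + 4 * pi\<^sup>2 * (t / \<delta>)\<^sup>2)) - (LINT l|\<nu>. K_hat l (t / \<delta>))"
    by (rule N.err_fourier[OF t'])
  also have "(LINT l|\<nu>. K_hat l (t / \<delta>)) = (LINT l|\<mu>. K_hat (l / \<delta>) (t / \<delta>))"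
    by (rule nu_integral_eq[OF borel_measurable_integrable[OF N.K_hat_integrable[OF t']]])
  also have "(LINT l|\<nu>. 2 * l / (l\<^sup>2 + 4 * pi\<^sup>2 * (t / \<delta>)\<^sup>2)) = (LINT l|\<mu>. 2 * (l / \<delta>) / ((l / \<delta>)\<^sup>2 + 4 * pi\<^sup>2 * (t / \<delta>)\<^sup>2))"
    by (rule nu_integral_eq, rule N.measurable_rho) measurable
  also have "\<dots> = (LINT l|\<mu>. \<delta> * (2 * l / (l\<^sup>2 + 4 * pi\<^sup>2 * t\<^sup>2)))"
  proof (rule Bochner_Integration.integral_cong[OF refl])
    fix l
    have "(l / \<delta>)\<^sup>2 + 4 * pi\<^sup>2 * (t / \<delta>)\<^sup>2 = (l\<^sup>2 + 4 * pi\<^sup>2 * t\<^sup>2) / \<delta>\<^sup>2"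
      by (simp add: power_divide add_divide_distrib)
    then show "2 * (l / \<delta>) / ((l / \<delta>)\<^sup>2 + 4 * pi\<^sup>2 * (t / \<delta>)\<^sup>2) = \<delta> * (2 * l / (l\<^sup>2 + 4 * pi\<^sup>2 * t\<^sup>2))"
      using delta_pos by (simp add: power2_eq_square)
  qed
  also have "\<dots> = \<delta> * (LINT l|\<mu>. 2 * l / (l\<^sup>2 + 4 * pi\<^sup>2 * t\<^sup>2))" by (rule integral_mult_right_zero)
  finally show ?thesis unfolding e using delta_pos by (simp add: scaleR_conv_of_real right_diff_distrib)
qed

text \<open>Carries competitors of type pi \<delta> for \<mu> to competitors of type
  \<open>pi\<close> for \<nu>; its inverse sends K to K(\<delta> z) + f(1/\<delta>).\<close>

definition rescale :: "(complex \<Rightarrow> complex) \<Rightarrow> complex \<Rightarrow> complex" where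
  "rescale Kt z = Kt (of_real (1 / \<delta>) * z) + - of_real (fr \<mu> (1 / \<delta>))"

lemma rescale_exp_type:
  assumes "exp_type_le Kt (pi * \<delta>)" shows "exp_type_le (rescale Kt) pi"
  using exp_type_le_scale_add[OF assms, of "1 / \<delta>" "- of_real (fr \<mu> (1 / \<delta>))"] delta_pos
  by (simp add: rescale_def[abs_def])

lemma rescale_eq_iff: "rescale Kt = K_rho \<nu> \<longleftrightarrow> Kt = (\<lambda>z. K_rho \<nu> (of_real \<delta> * z) + of_real (fr \<mu> (1 / \<delta>)))"
proof
  assume r: "rescale Kt = K_rho \<nu>"
  show "Kt = (\<lambda>z. K_rho \<nu> (of_real \<delta> * z) + of_real (fr \<mu> (1 / \<delta>)))"
  proof
    fix z
    have "K_rho \<nu> (of_real \<delta> * z) = Kt (of_real (1 / \<delta>) * (of_real \<delta> * z)) - of_real (fr \<mu> (1 / \<delta>))"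
      unfolding r[symmetric] by (simp add: rescale_def)
    then show "Kt z = K_rho \<nu> (of_real \<delta> * z) + of_real (fr \<mu> (1 / \<delta>))" using delta_pos by simp
  qed
next
  assume "Kt = (\<lambda>z. K_rho \<nu> (of_real \<delta> * z) + of_real (fr \<mu> (1 / \<delta>)))"
  then show "rescale Kt = K_rho \<nu>" using delta_pos by (simp add: rescale_def[abs_def] fun_eq_iff)
qed

text \<open>The constant f(1/\<delta>) subtracted from the competitor is also the difference between
  the two functions f, so deviations agree pointwise off 0 and only the Jacobian \<delta>
  remains.\<close>

lemma nn_integral_rescale:
  assumes Kt: "exp_type_le Kt (pi * \<delta>)"
  shows "(\<integral>\<^sup>+ x. ennreal (norm (N.dev (rescale Kt) x)) \<partial>lborel)
    = ennreal \<delta> * (\<integral>\<^sup>+ x. ennreal (cmod (of_real (fr \<mu> x) - Kt (of_real x))) \<partial>lborel)"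
proof -
  have [measurable]: "N.dev (rescale Kt) \<in> borel_measurable borel"
    by (rule N.dev_measurable[OF rescale_exp_type[OF Kt]])
  have "(\<integral>\<^sup>+ x. ennreal (norm (N.dev (rescale Kt) x)) \<partial>lborel)
    = ennreal \<bar>\<delta>\<bar> * (\<integral>\<^sup>+ x. ennreal (norm (N.dev (rescale Kt) (0 + \<delta> * x))) \<partial>lborel)"
    by (rule nn_integral_real_affine) (use delta_pos in auto)
  also have "(\<integral>\<^sup>+ x. ennreal (norm (N.dev (rescale Kt) (0 + \<delta> * x))) \<partial>lborel)
    = (\<integral>\<^sup>+ x. ennreal (cmod (of_real (fr \<mu> x) - Kt (of_real x))) \<partial>lborel)"
  proof (rule nn_integral_cong_AE)
    show "AE x in lborel. ennreal (norm (N.dev (rescale Kt) (0 + \<delta> * x))) = ennreal (cmod (of_real (fr \<mu> x) - Kt (of_real x)))"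
      using AE_lborel_singleton[of "0::real"]
    proof eventually_elim
      case (elim x)
      have "N.dev (rescale Kt) (0 + \<delta> * x) = of_real (fr \<mu> x) - Kt (of_real x)"
        unfolding N.dev_def add_0 fr_nu[OF M.exp_diff_integrable[OF elim]] using delta_pos by (simp add: rescale_def)
      then show ?case by (simp only:)
    qed
  qed
  finally show ?thesis using delta_pos by simp
qed

lemma lower_bound:
  assumes Kt: "exp_type_le Kt (pi * \<delta>)"
  shows "ennreal (LINT l|\<mu>. 2 / l - 2 / (l * cosh (l / (2 * \<delta>)))) \<le> (\<integral>\<^sup>+ x. ennreal (cmod (of_real (fr \<mu> x) - Kt (of_real x))) \<partial>lborel)"
    (is "?W \<le> ?I")
proof -
  have "ennreal \<delta> * ?W \<le> ennreal \<delta> * ?I"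
    using N.extremal_lower_bound[OF rescale_exp_type[OF Kt]] delta_pos
    unfolding nn_integral_rescale[OF Kt] gap_norm_integral_scaled by (simp add: ennreal_mult')
  then show ?thesis using delta_pos by (simp add: ennreal_mult_le_mult_iff)
qed

lemma equality_iff:
  assumes Kt: "exp_type_le Kt (pi * \<delta>)"
  shows "(\<integral>\<^sup>+ x. ennreal (cmod (of_real (fr \<mu> x) - Kt (of_real x))) \<partial>lborel) = ennreal (LINT l|\<mu>. 2 / l - 2 / (l * cosh (l / (2 * \<delta>))))
    \<longleftrightarrow> Kt = (\<lambda>z. K_rho \<nu> (of_real \<delta> * z) + of_real (fr \<mu> (1 / \<delta>)))"
    (is "?I = ?W \<longleftrightarrow> _")
proof -
  have "?I = ?W \<longleftrightarrow> ennreal \<delta> * ?I = ennreal \<delta> * ?W"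
    using delta_pos by (simp add: ennreal_mult_cancel_left)
  also have "\<dots> \<longleftrightarrow> (\<integral>\<^sup>+ x. ennreal (norm (N.dev (rescale Kt) x)) \<partial>lborel) = ennreal (LINT l|\<nu>. gap_norm l)"
    unfolding nn_integral_rescale[OF Kt] gap_norm_integral_scaled using delta_pos by (simp add: ennreal_mult')
  also have "\<dots> \<longleftrightarrow> rescale Kt = K_rho \<nu>"
    using N.extremal_unique[OF rescale_exp_type[OF Kt]] N.extremal_attained by metis
  finally show ?thesis unfolding rescale_eq_iff .
qed

end

theorem theorem1p3:
  fixes \<mu> \<nu> :: "real measure" and \<delta> :: real
  assumes mu_sets: "sets \<mu> = sets (restrict_space borel {0<..})"
    and mu_int: "integrable \<mu> (\<lambda>l. l / (l\<^sup>2 + 1))"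
    and delta_pos: "\<delta> > 0"
    and nu_sets: "sets \<nu> = sets (restrict_space borel {0<..})"
    and nu_def: "\<And>E. E \<in> sets \<nu> \<Longrightarrow> emeasure \<nu> E = emeasure \<mu> ((\<lambda>x. \<delta> * x) ` E)"
  shows
    "(exp_type_le (\<lambda>z. K_rho \<nu> (of_real \<delta> * z) + of_real (fr \<mu> (1/\<delta>))) (pi * \<delta>)) \<and>
    (\<forall>x::real. x \<noteq> 0 \<longrightarrow>
       integrable \<mu> (\<lambda>l. exp (- l * \<bar>x\<bar>) - Re (K_lam (l/\<delta>) (of_real (\<delta> * x))))) \<and>
    (\<forall>x::real. f_rho \<mu> x - f_rho \<mu> (1/\<delta>) - ereal (Re (K_rho \<nu> (of_real (\<delta> * x)))) =
       ext_int \<mu> (\<lambda>l. exp (- l * \<bar>x\<bar>) - Re (K_lam (l/\<delta>) (of_real (\<delta> * x))))) \<and>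
    (integrable lborel (\<lambda>x. fr \<mu> x - fr \<mu> (1/\<delta>) - Re (K_rho \<nu> (of_real (\<delta> * x)))) \<and>
     (LINT x|lborel. \<bar>fr \<mu> x - fr \<mu> (1/\<delta>) - Re (K_rho \<nu> (of_real (\<delta> * x)))\<bar>) =
     (LINT l|\<mu>. 2 / l - 2 / (l * cosh (l / (2 * \<delta>))))) \<and>
    (\<forall>t::real. t \<noteq> 0 \<longrightarrow>
       (LINT x|lborel. (of_real (fr \<mu> x - fr \<mu> (1/\<delta>)) - K_rho \<nu> (of_real (\<delta> * x)))
                        * ee (of_real (- t * x))) =
       of_real (LINT l|\<mu>. 2 * l / (l\<^sup>2 + 4 * pi\<^sup>2 * t\<^sup>2))
         - of_real (1/\<delta>) * (LINT l|\<mu>. K_hat (l/\<delta>) (t/\<delta>))) \<and>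
    (\<forall>Kt. exp_type_le Kt (pi * \<delta>) \<longrightarrow>
       (\<integral>\<^sup>+ x. ennreal (cmod (of_real (fr \<mu> x) - Kt (of_real x))) \<partial>lborel)
         \<ge> ennreal (LINT l|\<mu>. 2 / l - 2 / (l * cosh (l / (2 * \<delta>))))) \<and>
    (\<forall>Kt. exp_type_le Kt (pi * \<delta>) \<longrightarrow>
       ((\<integral>\<^sup>+ x. ennreal (cmod (of_real (fr \<mu> x) - Kt (of_real x))) \<partial>lborel)
         = ennreal (LINT l|\<mu>. 2 / l - 2 / (l * cosh (l / (2 * \<delta>))))
        \<longleftrightarrow> Kt = (\<lambda>z. K_rho \<nu> (of_real \<delta> * z) + of_real (fr \<mu> (1/\<delta>)))))"
proof -
  interpret dilated_measures \<mu> \<nu> \<delta>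
    by (rule dilated_measures.intro[OF mu_sets mu_int delta_pos nu_sets nu_def])
  show ?thesis
  proof (intro conjI allI impI)
    show "exp_type_le (\<lambda>z. K_rho \<nu> (of_real \<delta> * z) + of_real (fr \<mu> (1/\<delta>))) (pi * \<delta>)"
      by (rule exp_type_le_scale_add[OF N.K_rho_exp_type _ delta_pos]) simp
    show "integrable \<mu> (\<lambda>l. exp (- l * \<bar>x\<bar>) - Re (K_lam (l/\<delta>) (of_real (\<delta> * x))))" if "x \<noteq> 0" for x
      unfolding K_gap_scaled[symmetric] nu_integrable_iff[OF N.K_gap_measurable_rho, symmetric]
      by (rule N.K_gap_integrable_rho) (use that delta_pos in simp)
    show "f_rho \<mu> x - f_rho \<mu> (1/\<delta>) - ereal (Re (K_rho \<nu> (of_real (\<delta> * x)))) =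
       ext_int \<mu> (\<lambda>l. exp (- l * \<bar>x\<bar>) - Re (K_lam (l/\<delta>) (of_real (\<delta> * x))))" for x
      unfolding f_rho_nu N.f_rho_minus_K_rho nu_ext_int[OF N.K_gap_measurable_rho] K_gap_scaled ..
    show "integrable lborel (\<lambda>x. fr \<mu> x - fr \<mu> (1/\<delta>) - Re (K_rho \<nu> (of_real (\<delta> * x))))"
      using scaled_err_integrable unfolding scaled_err_def[abs_def] .
    show "(LINT x|lborel. \<bar>fr \<mu> x - fr \<mu> (1/\<delta>) - Re (K_rho \<nu> (of_real (\<delta> * x)))\<bar>) =
     (LINT l|\<mu>. 2 / l - 2 / (l * cosh (l / (2 * \<delta>))))"
      using scaled_err_L1 unfolding scaled_err_def .
  qed (fact scaled_err_fourier lower_bound equality_iff)+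
qed

end
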